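(* Let $F_0,\dots,F_n$ be the $n+1$ generic multihomogeneous polynomials of degrees $\boldsymbol d_i=(d_{i,1},\dots,d_{i,r})$, $0\le i\le n$. Let $\boldsymbol\mu=(\mu_1,\dots,\mu_r)$ be such that $0\le\mu_j<\min_{0\le i\le n}d_{i,j}$ for all $j=1,\dots,r$. Then the $A_k$-module $(I^{\mathrm{sat}}/I)_{\boldsymbol\delta-\boldsymbol\mu}$ is free, and the family of (classes of) multigraded Sylvester forms $$\big\{\mathrm{sylv}_{\alpha_1,\dots,\alpha_r}\ :\ \alpha_j\in\mathbb N^{n_j+1},\ |\alpha_j|=\mu_j,\ j=1,\dots,r\big\}$$ is an $A_k$-basis of it.
   Context: Setting. Let $r\ge 1$ and $n_1,\dots,n_r\ge 1$ be integers, $n=n_1+\cdots+n_r$, and let $k$ be a commutative ring. For $j=1,\dots,r$ let $\boldsymbol x_j=(x_{j,0},\dots,x_{j,n_j})$. For $i=0,\dots,n$ fix $\boldsymbol d_i=(d_{i,1},\dots,d_{i,r})$ with all $d_{i,j}\ge 1$. Let $A_k$ be the polynomial ring over $k$ in the indeterminates $U_{i,\alpha_1,\dots,\alpha_r}$, where $0\le i\le n$ and $\alpha_j\in\mathbb N^{n_j+1}$ with $|\alpha_j|=d_{i,j}$. Let $C=A_k[\boldsymbol x_1,\dots,\boldsymbol x_r]$, which is $\mathbb Z^r$-graded by giving each $x_{j,l}$ the degree $\boldsymbol e_j$ and elements of $A_k$ degree $0$. The generic multihomogeneous polynomials are $F_i=\sum U_{i,\alpha_1,\dots,\alpha_r}\boldsymbol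 x_1^{\alpha_1}\cdots\boldsymbol x_r^{\alpha_r}\in C$, the sum being over all $(\alpha_1,\dots,\alpha_r)$ with $|\alpha_j|=d_{i,j}$. Put $\mathfrak m_j=(\boldsymbol x_j)\subset C$, $\mathfrak b=\prod_{j=1}^r\mathfrak m_j$, $I=(F_0,\dots,F_n)$, $B=C/I$, $I^{\mathrm{sat}}=(I:\mathfrak b^\infty)=\{p\in C:\exists N,\ \mathfrak b^Np\subset I\}$, and $\boldsymbol\delta=\sum_{i=0}^n\boldsymbol d_i-(n_1+1,\dots,n_r+1)$. Multigraded Sylvester forms. Let $\alpha_j=(\alpha^{(j)}_0,\dots,\alpha^{(j)}_{n_j})\in\mathbb N^{n_j+1}$ with $|\alpha_j|=\sum_{l=0}^{n_j}\alpha^{(j)}_l<\min_i d_{i,j}$ for $j=1,\dots,r$. Fix an ordering of the polynomials, of the groups of variables and of the variables in each group (here, the one given by the indexing). Each $F_i$ can be decomposed, with multihomogeneous $F^{(l)}_{i,j}\in C$, as $$F_i=\sum_{j=0}^{n_1-1}x_{1,j}^{\alpha^{(1)}_j+1}F^{(1)}_{i,j}+x_{1,n_1}^{\alpha^{(1)}_{n_1}+1}\Big(\sum_{j=0}^{n_2-1}x_{2,j}^{\alpha^{(2)}_j+1}F^{(2)}_{i,j}+x_{2,n_2}^{\alpha^{(2)}_{n_2}+1}\Big(\cdots+x_{r-1,n_{r-1}}^{\alpha^{(r-1)}_{n_{r-1}}+1}\Big(\sum_{j=0}^{n_r}x_{r,j}^{\alpha^{(r)}_j+1}F^{(r)}_{i,j}\Big)\Big)\Big).$$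 Such a decomposition is chosen for each $i$ (it is obtained by first decomposing $F_i$ over the $x_{1,j}^{\alpha_j^{(1)}+1}$, $0\le j\le n_1$, then the coefficient of $x_{1,n_1}^{\alpha^{(1)}_{n_1}+1}$ over the $x_{2,j}^{\alpha^{(2)}_j+1}$, and so on). Let $\mathcal D_{\alpha_1,\dots,\alpha_r}$ be the determinant of the $(n+1)\times(n+1)$ matrix whose row indexed by $i=0,\dots,n$ is $$\big(F^{(1)}_{i,0},\dots,F^{(1)}_{i,n_1-1},F^{(2)}_{i,0},\dots,F^{(2)}_{i,n_2-1},\dots,F^{(r-1)}_{i,n_{r-1}-1},F^{(r)}_{i,0},\dots,F^{(r)}_{i,n_r}\big).$$ With $v_i=\sum_{j=i+1}^rn_j$, the Sylvester form is $\mathrm{Sylv}_{\alpha_1,\dots,\alpha_r}=\big(\prod_{i=1}^{r-1}x_{i,n_i}^{(\alpha^{(i)}_{n_i}+1)v_i}\big)\mathcal D_{\alpha_1,\dots,\alpha_r}$, and $\mathrm{sylv}_{\alpha_1,\dots,\alpha_r}$ is its class in $B$; it lies in $(I^{\mathrm{sat}}/I)_{(\delta_1-|\alpha_1|,\dots,\delta_r-|\alpha_r|)}$. *)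

theory Defs
  imports
    "HOL-Algebra.Ideal_Product"
    "HOL-Algebra.QuotRing"
    "HOL-Algebra.Module"
    "HOL-Library.Poly_Mapping"
    "Jordan_Normal_Form.Determinant"
begin

section \<open>Free modules\<close>

text \<open>A family of elements of a module, indexed by a set \<open>J\<close>, is a basis if it generates the
  module and is linearly independent. Being a family, it is independent only if no element is
  repeated (over a nonzero ring).\<close>

definition module_basis ::
    "('a, 'm) ring_scheme \<Rightarrow> ('a, 'b, 'q) module_scheme \<Rightarrow> 'j set \<Rightarrow> ('j \<Rightarrow> 'b) \<Rightarrow> bool" where
  "module_basis R M J b \<longleftrightarrow>
     Module.module R M \<and>
     b \<in> J \<rightarrow> carrier M \<and>
     (\<forall>x \<in> carrier M. \<exists>S c. finite S \<and> S \<subseteq> J \<and> c \<in> S \<rightarrow> carrier R \<and>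
        x = (\<Oplus>\<^bsub>M\<^esub>s\<in>S. c s \<odot>\<^bsub>M\<^esub> b s)) \<and>
     (\<forall>S c. finite S \<and> S \<subseteq> J \<and> c \<in> S \<rightarrow> carrier R \<and>
        (\<Oplus>\<^bsub>M\<^esub>s\<in>S. c s \<odot>\<^bsub>M\<^esub> b s) = \<zero>\<^bsub>M\<^esub> \<longrightarrow> (\<forall>s \<in> S. c s = \<zero>\<^bsub>R\<^esub>))"

definition free_module :: "('a, 'm) ring_scheme \<Rightarrow> ('a, 'b, 'q) module_scheme \<Rightarrow> bool" where
  "free_module R M \<longleftrightarrow> (\<exists>E. module_basis R M E (\<lambda>x. x))"


section \<open>The multigraded polynomial ring\<close>

text \<open>The variable \<open>x\<^bsub>j,l\<^esub>\<close> is the pair \<open>(j, l)\<close>; groups are numbered \<open>1, \<dots>, r\<close> and the variables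
  of group \<open>j\<close> are numbered \<open>0, \<dots>, ns j\<close>. A tuple \<open>(\<alpha>\<^sub>1, \<dots>, \<alpha>\<^sub>r)\<close> of exponent vectors is one
  finitely supported function \<open>\<alpha>\<close> on variables, \<open>lookup \<alpha> (j, l)\<close> being the \<open>l\<close>-th entry of
  \<open>\<alpha>\<^sub>j\<close>. The indeterminate \<open>U\<^bsub>i,\<alpha>\<^esub>\<close> is the pair \<open>(i, \<alpha>)\<close>. Polynomials are finitely
  supported functions from monomials to coefficients; as the types contain infinitely many
  indeterminates, the rings in question are cut out by carrier sets.\<close>

type_synonym expo = "(nat \<times> nat) \<Rightarrow>\<^sub>0 nat"
type_synonym 'k coeff = "((nat \<times> expo) \<Rightarrow>\<^sub>0 nat) \<Rightarrow>\<^sub>0 'k"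
type_synonym 'k cpoly = "expo \<Rightarrow>\<^sub>0 'k coeff"

definition xvars :: "nat \<Rightarrow> (nat \<Rightarrow> nat) \<Rightarrow> (nat \<times> nat) set" where
  "xvars r ns = {(j, l). j \<in> {1..r} \<and> l \<le> ns j}"

definition total_dim :: "nat \<Rightarrow> (nat \<Rightarrow> nat) \<Rightarrow> nat" where
  "total_dim r ns = (\<Sum>j=1..r. ns j)"

definition group_deg :: "(nat \<Rightarrow> nat) \<Rightarrow> expo \<Rightarrow> nat \<Rightarrow> nat" where
  "group_deg ns \<alpha> j = (\<Sum>l=0..ns j. Poly_Mapping.lookup \<alpha> (j, l))"

definition expts :: "nat \<Rightarrow> (nat \<Rightarrow> nat) \<Rightarrow> (nat \<Rightarrow> nat) \<Rightarrow> expo set" where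
  "expts r ns e = {\<alpha>. Poly_Mapping.keys \<alpha> \<subseteq> xvars r ns \<and>
     (\<forall>j \<in> {1..r}. group_deg ns \<alpha> j = e j)}"

lemma finite_xvars: "finite (xvars r ns)"
proof (rule finite_subset)
  show "xvars r ns \<subseteq> (SIGMA j:{1..r}. {..ns j})"
    by (auto simp: xvars_def)
qed auto

lemma finite_expts: "finite (expts r ns e)"
proof -
  define V where "V = xvars r ns"
  define B where "B = (\<Sum>j=1..r. e j)"
  have bound: "Poly_Mapping.lookup \<alpha> v \<in> {..B}" if \<alpha>: "\<alpha> \<in> expts r ns e" and vV: "v \<in> V" for \<alpha> v
  proof -
    obtain j l where v: "v = (j, l)" and j: "j \<in> {1..r}" and l: "l \<le> ns j"
      using vV by (auto simp: V_def xvars_def)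
    have "Poly_Mapping.lookup \<alpha> (j, l) \<le> group_deg ns \<alpha> j"
      unfolding group_deg_def using l by (intro member_le_sum) auto
    also have "\<dots> = e j" using \<alpha> j by (auto simp: expts_def)
    also have "\<dots> \<le> B" unfolding B_def using j by (intro member_le_sum) auto
    finally show ?thesis by (simp add: v)
  qed
  have "Poly_Mapping.lookup ` expts r ns e \<subseteq>
      {f. \<forall>v. (v \<in> V \<longrightarrow> f v \<in> {..B}) \<and> (v \<notin> V \<longrightarrow> f v = 0)}"
    using bound by (auto simp: expts_def V_def in_keys_iff)
  moreover have "finite \<dots>"
    by (rule finite_set_of_finite_funs) (auto simp: V_def finite_xvars)
  ultimately have "finite (Poly_Mapping.lookup ` expts r ns e)" by (rule finite_subset)
  moreover have "inj_on Poly_Mapping.lookup (expts r ns e)" by (auto simp: inj_on_def poly_mapping.lookup_inject)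
  ultimately show ?thesis by (rule finite_imageD)
qed

definition ring_on :: "'a::comm_ring_1 set \<Rightarrow> 'a ring" where
  "ring_on S = \<lparr>carrier = S, monoid.mult = (*), one = 1, zero = 0, add = (+)\<rparr>"

definition uvars :: "nat \<Rightarrow> (nat \<Rightarrow> nat) \<Rightarrow> (nat \<Rightarrow> nat \<Rightarrow> nat) \<Rightarrow> (nat \<times> expo) set" where
  "uvars r ns d = {(i, \<alpha>). i \<le> total_dim r ns \<and> \<alpha> \<in> expts r ns (d i)}"

definition coeff_ring ::
    "nat \<Rightarrow> (nat \<Rightarrow> nat) \<Rightarrow> (nat \<Rightarrow> nat \<Rightarrow> nat) \<Rightarrow> 'k::comm_ring_1 coeff ring" where
  "coeff_ring r ns d = ring_on {a. \<forall>t \<in> Poly_Mapping.keys a. Poly_Mapping.keys t \<subseteq> uvars r ns d}"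

definition poly_ring ::
    "nat \<Rightarrow> (nat \<Rightarrow> nat) \<Rightarrow> (nat \<Rightarrow> nat \<Rightarrow> nat) \<Rightarrow> 'k::comm_ring_1 cpoly ring" where
  "poly_ring r ns d = ring_on {p. \<forall>m \<in> Poly_Mapping.keys p.
     Poly_Mapping.keys m \<subseteq> xvars r ns \<and> Poly_Mapping.lookup p m \<in> carrier (coeff_ring r ns d)}"

definition const_poly :: "'k::comm_ring_1 coeff \<Rightarrow> 'k cpoly" where
  "const_poly a = Poly_Mapping.single 0 a"

definition x_var :: "nat \<times> nat \<Rightarrow> 'k::comm_ring_1 cpoly" where
  "x_var v = Poly_Mapping.single (Poly_Mapping.single v 1) 1"

definition u_var :: "nat \<times> expo \<Rightarrow> 'k::comm_ring_1 coeff" where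
  "u_var u = Poly_Mapping.single (Poly_Mapping.single u 1) 1"

definition multihomogeneous ::
    "nat \<Rightarrow> (nat \<Rightarrow> nat) \<Rightarrow> (nat \<Rightarrow> int) \<Rightarrow> 'k::comm_ring_1 cpoly \<Rightarrow> bool" where
  "multihomogeneous r ns e p \<longleftrightarrow>
     (\<forall>m \<in> Poly_Mapping.keys p. \<forall>j \<in> {1..r}. int (group_deg ns m j) = e j)"


section \<open>The generic polynomials and the saturation of their ideal\<close>

definition generic_poly ::
    "nat \<Rightarrow> (nat \<Rightarrow> nat) \<Rightarrow> (nat \<Rightarrow> nat \<Rightarrow> nat) \<Rightarrow> nat \<Rightarrow> 'k::comm_ring_1 cpoly" where
  "generic_poly r ns d i = (\<Sum>\<alpha> \<in> expts r ns (d i). Poly_Mapping.single \<alpha> (u_var (i, \<alpha>)))"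

definition generic_ideal ::
    "nat \<Rightarrow> (nat \<Rightarrow> nat) \<Rightarrow> (nat \<Rightarrow> nat \<Rightarrow> nat) \<Rightarrow> 'k::comm_ring_1 cpoly set" where
  "generic_ideal r ns d = Idl\<^bsub>poly_ring r ns d\<^esub> (generic_poly r ns d ` {0..total_dim r ns})"

definition group_ideal ::
    "nat \<Rightarrow> (nat \<Rightarrow> nat) \<Rightarrow> (nat \<Rightarrow> nat \<Rightarrow> nat) \<Rightarrow> nat \<Rightarrow> 'k::comm_ring_1 cpoly set" where
  "group_ideal r ns d j = Idl\<^bsub>poly_ring r ns d\<^esub> ((\<lambda>l. x_var (j, l)) ` {0..ns j})"

text \<open>Products and powers of ideals are taken in the multiplicative monoid of ideals.\<close>

definition irrelevant_ideal ::
    "nat \<Rightarrow> (nat \<Rightarrow> nat) \<Rightarrow> (nat \<Rightarrow> nat \<Rightarrow> nat) \<Rightarrow> 'k::comm_ring_1 cpoly set" where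
  "irrelevant_ideal r ns d =
     (\<Otimes>\<^bsub>ideals_set (poly_ring r ns d)\<^esub>j\<in>{1..r}. group_ideal r ns d j)"

definition saturation ::
    "nat \<Rightarrow> (nat \<Rightarrow> nat) \<Rightarrow> (nat \<Rightarrow> nat \<Rightarrow> nat) \<Rightarrow> 'k::comm_ring_1 cpoly set" where
  "saturation r ns d = {p \<in> carrier (poly_ring r ns d). \<exists>N::nat.
     \<forall>q \<in> irrelevant_ideal r ns d [^]\<^bsub>ideals_set (poly_ring r ns d)\<^esub> N.
       q * p \<in> generic_ideal r ns d}"

definition quot_class ::
    "nat \<Rightarrow> (nat \<Rightarrow> nat) \<Rightarrow> (nat \<Rightarrow> nat \<Rightarrow> nat) \<Rightarrow> 'k::comm_ring_1 cpoly \<Rightarrow> 'k cpoly set" where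
  "quot_class r ns d p = generic_ideal r ns d +>\<^bsub>poly_ring r ns d\<^esub> p"

definition quot_ring ::
    "nat \<Rightarrow> (nat \<Rightarrow> nat) \<Rightarrow> (nat \<Rightarrow> nat \<Rightarrow> nat) \<Rightarrow> 'k::comm_ring_1 cpoly set ring" where
  "quot_ring r ns d = poly_ring r ns d Quot generic_ideal r ns d"

text \<open>The degree \<open>e\<close> part of \<open>I\<^sup>s\<^sup>a\<^sup>t / I\<close>, as a module over the coefficient ring. The record type
  of modules extends that of rings; the fields \<open>mult\<close> and \<open>one\<close> play no role in it.\<close>

definition sat_quot_part ::
    "nat \<Rightarrow> (nat \<Rightarrow> nat) \<Rightarrow> (nat \<Rightarrow> nat \<Rightarrow> nat) \<Rightarrow> (nat \<Rightarrow> int) \<Rightarrow>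
     ('k::comm_ring_1 coeff, 'k cpoly set) module" where
  "sat_quot_part r ns d e =
     \<lparr>carrier = quot_class r ns d ` {p \<in> saturation r ns d. multihomogeneous r ns e p},
      monoid.mult = monoid.mult (quot_ring r ns d), one = monoid.one (quot_ring r ns d),
      zero = ring.zero (quot_ring r ns d), add = ring.add (quot_ring r ns d),
      module.smult = (\<lambda>a x. quot_class r ns d (const_poly a) \<otimes>\<^bsub>quot_ring r ns d\<^esub> x)\<rparr>"

definition delta :: "nat \<Rightarrow> (nat \<Rightarrow> nat) \<Rightarrow> (nat \<Rightarrow> nat \<Rightarrow> nat) \<Rightarrow> nat \<Rightarrow> int" where
  "delta r ns d j = (\<Sum>i=0..total_dim r ns. int (d i j)) - (int (ns j) + 1)"


section \<open>Multigraded Sylvester forms\<close>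

text \<open>A decomposition of \<open>F\<^sub>i\<close> is given by \<open>G l j\<close>, the cofactor of a power of \<open>x\<^bsub>l,j\<^esub>\<close>.
  The list argument contains the groups that remain to be processed, in order; in the last group
  the sum includes the last variable.\<close>

fun nested_sum ::
    "(nat \<Rightarrow> nat) \<Rightarrow> expo \<Rightarrow> (nat \<Rightarrow> nat \<Rightarrow> 'k::comm_ring_1 cpoly) \<Rightarrow> nat list \<Rightarrow> 'k cpoly" where
  "nested_sum ns \<alpha> G [] = 0"
| "nested_sum ns \<alpha> G [l] =
     (\<Sum>j=0..ns l. x_var (l, j) ^ (Poly_Mapping.lookup \<alpha> (l, j) + 1) * G l j)"
| "nested_sum ns \<alpha> G (l # l' # ls) =
     (\<Sum>j=0..<ns l. x_var (l, j) ^ (Poly_Mapping.lookup \<alpha> (l, j) + 1) * G l j) +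
     x_var (l, ns l) ^ (Poly_Mapping.lookup \<alpha> (l, ns l) + 1) * nested_sum ns \<alpha> G (l' # ls)"

definition sylv_columns :: "nat \<Rightarrow> (nat \<Rightarrow> nat) \<Rightarrow> (nat \<times> nat) list" where
  "sylv_columns r ns = concat (map (\<lambda>l. map (\<lambda>j. (l, j)) [0..<ns l]) [1..<r+1]) @ [(r, ns r)]"

definition sylv_decomposition ::
    "nat \<Rightarrow> (nat \<Rightarrow> nat) \<Rightarrow> (nat \<Rightarrow> nat \<Rightarrow> nat) \<Rightarrow> expo \<Rightarrow> nat \<Rightarrow>
     (nat \<Rightarrow> nat \<Rightarrow> 'k::comm_ring_1 cpoly) \<Rightarrow> bool" where
  "sylv_decomposition r ns d \<alpha> i G \<longleftrightarrow>
     (\<forall>(l, j) \<in> set (sylv_columns r ns).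
        G l j \<in> carrier (poly_ring r ns d) \<and> (\<exists>e. multihomogeneous r ns e (G l j))) \<and>
     generic_poly r ns d i = nested_sum ns \<alpha> G [1..<r+1]"

definition sylv_det ::
    "nat \<Rightarrow> (nat \<Rightarrow> nat) \<Rightarrow> (nat \<Rightarrow> nat \<Rightarrow> nat \<Rightarrow> 'k::comm_ring_1 cpoly) \<Rightarrow> 'k cpoly" where
  "sylv_det r ns G = det (mat (total_dim r ns + 1) (total_dim r ns + 1)
     (\<lambda>(i, c). case sylv_columns r ns ! c of (l, j) \<Rightarrow> G i l j))"

definition sylv_form ::
    "nat \<Rightarrow> (nat \<Rightarrow> nat) \<Rightarrow> expo \<Rightarrow> (nat \<Rightarrow> nat \<Rightarrow> nat \<Rightarrow> 'k::comm_ring_1 cpoly) \<Rightarrow> 'k cpoly" where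
  "sylv_form r ns \<alpha> G =
     (\<Prod>i=1..<r. x_var (i, ns i) ^
        ((Poly_Mapping.lookup \<alpha> (i, ns i) + 1) * (\<Sum>j=i+1..r. ns j))) * sylv_det r ns G"

lemma length_sylv_columns: "length (sylv_columns r ns) = total_dim r ns + 1"
proof -
  have "sum_list (map ns [1..<r+1]) = (\<Sum>j=1..r. ns j)"
    by (simp only: interv_sum_list_conv_sum_set_nat atLeastLessThanSuc_atLeastAtMost set_upt
        Suc_eq_plus1[symmetric])
  then show ?thesis
    by (simp add: sylv_columns_def total_dim_def length_concat o_def del: upt_Suc)
qed

end

theory Submission
  imports Defs "HOL-Library.Function_Algebras" "HOL-Library.Product_Plus"
begin

text \<open>If one variable of every group is inverted, one monomial of \<open>F\<^sub>i\<close> becomes a unit and its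
  coefficient occurs in no other \<open>F\<^sub>j\<close>. Hence the \<open>F\<^sub>i\<close> are indeterminates up to a change of
  variables, and the Koszul complex of \<open>F\<^sub>0, \<dots>, F\<^sub>n\<close> is acyclic on every affine chart. Localizing and
  taking quotients one variable at a time gives long exact sequences; all terms but one vanish for
  degree reasons in multidegree \<open>\<delta> - \<mu>\<close>, so that \<open>I\<^sup>s\<^sup>a\<^sup>t / I\<close> is identified there with the degree
  \<open>- \<mu> - (n\<^sub>1 + 1, \<dots>, n\<^sub>r + 1)\<close> part of the top local cohomology, which is free on the inverse
  monomials \<open>x\<^sup>-\<^sup>1\<^sup>-\<^sup>\<alpha>\<close>. The minors of a decomposition of the \<open>F\<^sub>i\<close> form a morphism from the Koszul
  complex of the monomials of the decomposition to that of the \<open>F\<^sub>i\<close>; following it through the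
  connecting homomorphisms, the Sylvester form of \<open>\<alpha>\<close> goes to \<open>x\<^sup>-\<^sup>1\<^sup>-\<^sup>\<alpha>\<close>.\<close>

section \<open>Supports of polynomials with polynomial coefficients\<close>

text \<open>The obstacle is a mismatch of numbers: there are n + r variables, every moved variable
  raises the Koszul degree by one, and the complex ends in degree n + 1. So the groups before the
  last give up only n_1, ..., n_(r-1) variables, the last group all n_r + 1, and the last variable
  of each earlier group is merely inverted. At the final move in such a group the middle term of the
  exact sequence need not vanish; \<open>rel_bnd\<close> shows that its contribution is polynomial
  in the inverted variable, so that the final criterion is again modulo all variables. The same
  asymmetry is the origin of the prefactor of the Sylvester form: the last variable of group i < r
  occurs in the monomials of all v_i + 1 columns of later groups, and the prefactor compensates v_i
  of them, which leaves the exponent - 1 - \<alpha>. The condition \<mu>_j < d_(i,j) gives the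
  degree bound behind the vanishing: a coefficient at an index set that omits some i has degree
  larger than - (n_j + 1) in group j, so some exponent is nonnegative. Homology modules are never
  formed; classes are compared by relations between chains.\<close>

abbreviation lkp :: "('a \<Rightarrow>\<^sub>0 'b::zero) \<Rightarrow> 'a \<Rightarrow> 'b" where "lkp \<equiv> Poly_Mapping.lookup"

text \<open>A polynomial in the x over A_k is read as one finitely supported function on pairs of an
  x-exponent and a U-exponent. Multidegrees concern the first component, the elimination of a single
  indeterminate U the second.\<close>

definition coef :: "('a \<Rightarrow>\<^sub>0 ('b \<Rightarrow>\<^sub>0 'c::zero)) \<Rightarrow> 'a \<times> 'b \<Rightarrow> 'c" where
  "coef f x = lkp (lkp f (fst x)) (snd x)"

definition supp :: "('a \<Rightarrow>\<^sub>0 ('b \<Rightarrow>\<^sub>0 'c::zero)) \<Rightarrow> ('a \<times> 'b) set" where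
  "supp f = {x. coef f x \<noteq> 0}"

definition mterm :: "'a \<times> 'b \<Rightarrow> 'c::zero \<Rightarrow> 'a \<Rightarrow>\<^sub>0 ('b \<Rightarrow>\<^sub>0 'c)" where
  "mterm x c = Poly_Mapping.single (fst x) (Poly_Mapping.single (snd x) c)"

lemma coef_eqI: "(\<And>x. coef f x = coef g x) \<Longrightarrow> f = g"
proof (rule poly_mapping_eqI, rule poly_mapping_eqI)
  fix m t assume "\<And>x. coef f x = coef g x"
  from this[of "(m, t)"] show "lkp (lkp f m) t = lkp (lkp g m) t" by (simp add: coef_def)
qed

lemma supp_iff: "x \<in> supp f \<longleftrightarrow> coef f x \<noteq> 0"
  by (simp add: supp_def)

lemma coef_zero [simp]: "coef 0 x = 0"
  by (simp add: coef_def)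

lemma supp_zero [simp]: "supp 0 = {}"
  by (simp add: supp_def)

lemma supp_empty_iff: "supp f = {} \<longleftrightarrow> f = 0"
  by (metis coef_eqI coef_zero empty_iff supp_iff supp_zero)

lemma coef_add: "coef (f + g) x = coef f x + coef g x"
  by (simp add: coef_def lookup_add)

lemma coef_uminus: "coef (- f) x = - coef f x"
  for f :: "'a \<Rightarrow>\<^sub>0 ('b \<Rightarrow>\<^sub>0 'c::ab_group_add)"
  by (simp add: coef_def)

lemma coef_diff: "coef (f - g) x = coef f x - coef g x"
  for f :: "'a \<Rightarrow>\<^sub>0 ('b \<Rightarrow>\<^sub>0 'c::ab_group_add)"
  by (simp add: coef_def lookup_minus)

lemma coef_sum: "coef (sum f I) x = (\<Sum>i\<in>I. coef (f i) x)"
  by (simp add: coef_def lookup_sum)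

lemma coef_mterm: "coef (mterm x c) y = (if x = y then c else 0)"
  by (auto simp: coef_def mterm_def lookup_single when_def prod_eq_iff)

lemma finite_supp [simp]: "finite (supp f)"
proof (rule finite_subset)
  show "supp f \<subseteq> (SIGMA m:Poly_Mapping.keys f. Poly_Mapping.keys (lkp f m))"
    by (auto simp: supp_def coef_def in_keys_iff)
qed auto

lemma mterm_expansion: "f = (\<Sum>x\<in>supp f. mterm x (coef f x))"
  by (rule coef_eqI) (simp add: coef_sum coef_mterm supp_iff)

lemma supp_mterm: "supp (mterm x c) \<subseteq> {x}"
  by (auto simp: supp_iff coef_mterm split: if_splits)

lemma supp_add: "supp (f + g) \<subseteq> supp f \<union> supp g"
  by (auto simp: supp_iff coef_add)

lemma supp_uminus [simp]: "supp (- f) = supp f"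
  for f :: "'a \<Rightarrow>\<^sub>0 ('b \<Rightarrow>\<^sub>0 'c::ab_group_add)"
  by (auto simp: supp_iff coef_uminus)

lemma supp_diff: "supp (f - g) \<subseteq> supp f \<union> supp g"
  for f :: "'a \<Rightarrow>\<^sub>0 ('b \<Rightarrow>\<^sub>0 'c::ab_group_add)"
  by (auto simp: supp_iff coef_diff)

lemma supp_sum: "supp (sum f I) \<subseteq> (\<Union>i\<in>I. supp (f i))"
  by (auto simp: supp_iff coef_sum) (meson sum.not_neutral_contains_not_neutral)

lemma supp_addI: "supp f \<subseteq> S \<Longrightarrow> supp g \<subseteq> S \<Longrightarrow> supp (f + g) \<subseteq> S"
  using supp_add by fastforce

lemma supp_diffI: "supp f \<subseteq> S \<Longrightarrow> supp g \<subseteq> S \<Longrightarrow> supp (f - g) \<subseteq> S"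
  for f :: "'a \<Rightarrow>\<^sub>0 ('b \<Rightarrow>\<^sub>0 'c::ab_group_add)"
  using supp_diff by fastforce

lemma supp_sumI: "(\<And>i. i \<in> I \<Longrightarrow> supp (f i) \<subseteq> S) \<Longrightarrow> supp (sum f I) \<subseteq> S"
  using supp_sum by fastforce

text \<open>Truncation by support. It serves to collect the terms containing a given indeterminate,
  to split a chain by the sign of one exponent, and to take homogeneous components.\<close>

definition flt :: "('a \<times> 'b) set \<Rightarrow> ('a \<Rightarrow>\<^sub>0 ('b \<Rightarrow>\<^sub>0 'c::comm_monoid_add)) \<Rightarrow> 'a \<Rightarrow>\<^sub>0 ('b \<Rightarrow>\<^sub>0 'c)" where
  "flt S f = (\<Sum>x\<in>supp f \<inter> S. mterm x (coef f x))"

lemma coef_flt: "coef (flt S f) x = (if x \<in> S then coef f x else 0)"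
  by (auto simp: flt_def coef_sum coef_mterm supp_iff)

lemma supp_flt: "supp (flt S f) = supp f \<inter> S"
  by (auto simp: supp_iff coef_flt split: if_splits)

lemma flt_zero [simp]: "flt S 0 = 0"
  by (simp add: flt_def)

lemma flt_compl: "f = flt S f + flt (- S) f"
  by (rule coef_eqI) (simp add: coef_add coef_flt)

lemma mterm_mult: "mterm x a * mterm y b = mterm (x + y) (a * b)"
  for a :: "'c::semiring_0" and x :: "'a::monoid_add \<times> 'b::monoid_add"
  by (simp add: mterm_def mult_single)

lemma mult_expansion:
  fixes f g :: "'a::comm_monoid_add \<Rightarrow>\<^sub>0 ('b::comm_monoid_add \<Rightarrow>\<^sub>0 'c::comm_semiring_0)"
  shows "f * g = (\<Sum>x\<in>supp f. \<Sum>y\<in>supp g. mterm (x + y) (coef f x * coef g y))"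
proof -
  have "f * g = (\<Sum>x\<in>supp f. mterm x (coef f x)) * (\<Sum>x\<in>supp g. mterm x (coef g x))"
    using mterm_expansion[of f] mterm_expansion[of g] by simp
  then show ?thesis by (simp add: sum_product mterm_mult)
qed

lemma supp_mult:
  fixes f g :: "'a::comm_monoid_add \<Rightarrow>\<^sub>0 ('b::comm_monoid_add \<Rightarrow>\<^sub>0 'c::comm_semiring_0)"
  assumes "z \<in> supp (f * g)"
  obtains x y where "x \<in> supp f" "y \<in> supp g" "z = x + y"
proof -
  have "supp (f * g) \<subseteq> (\<Union>x\<in>supp f. \<Union>y\<in>supp g. {x + y})"
    unfolding mult_expansion by (rule order_trans[OF supp_sum], rule UN_mono[OF order_refl],
      rule order_trans[OF supp_sum], rule UN_mono[OF order_refl], rule supp_mterm)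
  with assms that show thesis by auto
qed

lemma supp_multI:
  fixes f g :: "'a::comm_monoid_add \<Rightarrow>\<^sub>0 ('b::comm_monoid_add \<Rightarrow>\<^sub>0 'c::comm_semiring_0)"
  assumes "\<And>x y. x \<in> supp f \<Longrightarrow> y \<in> supp g \<Longrightarrow> x + y \<in> S"
  shows "supp (f * g) \<subseteq> S"
  using assms by (auto elim!: supp_mult)

lemma coef_mterm_mult:
  fixes f :: "'a::cancel_comm_monoid_add \<Rightarrow>\<^sub>0 ('b::cancel_comm_monoid_add \<Rightarrow>\<^sub>0 'c::comm_semiring_0)"
  shows "coef (mterm x c * f) (x + y) = c * coef f y"
proof -
  have "mterm x c * f = (\<Sum>y\<in>supp f. mterm (x + y) (c * coef f y))"
    by (subst mterm_expansion[of f]) (simp add: sum_distrib_left mterm_mult)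
  also have "coef \<dots> (x + y) = (\<Sum>z\<in>supp f. if z = y then c * coef f z else 0)"
    by (simp add: coef_sum coef_mterm)
  also have "\<dots> = c * coef f y"
    by (auto simp: supp_iff)
  finally show ?thesis .
qed

lemma one_mterm: "(1 :: 'a::zero \<Rightarrow>\<^sub>0 ('b::zero \<Rightarrow>\<^sub>0 'c::zero_neq_one)) = mterm 0 1"
  by (simp add: mterm_def)

lemma mterm_zero [simp]: "mterm x 0 = 0"
  by (simp add: mterm_def)

section \<open>Laurent polynomials\<close>

text \<open>Negative exponents of the variables are allowed, those of the indeterminates of the
  coefficient ring are not.\<close>

type_synonym lexpo = "(nat \<times> nat) \<Rightarrow>\<^sub>0 int"
type_synonym 'k laurent = "lexpo \<Rightarrow>\<^sub>0 'k coeff"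

definition iexp :: "expo \<Rightarrow> lexpo" where
  "iexp m = Poly_Mapping.map int m"

lemma lookup_iexp [simp]: "lkp (iexp m) v = int (lkp m v)"
  by (simp add: iexp_def Poly_Mapping.map.rep_eq when_def)

lemma iexp_add: "iexp (a + b) = iexp a + iexp b"
  by (rule poly_mapping_eqI) (simp add: lookup_add)

lemma iexp_zero [simp]: "iexp 0 = 0"
  by (rule poly_mapping_eqI) simp

lemma inj_iexp: "inj iexp"
  by (rule injI, rule poly_mapping_eqI) (metis lookup_iexp of_nat_eq_iff)

lemma iexp_inject [simp]: "iexp a = iexp b \<longleftrightarrow> a = b"
  using inj_iexp by (auto dest: injD)

lemma keys_iexp [simp]: "Poly_Mapping.keys (iexp a) = Poly_Mapping.keys a"
  by (auto simp: in_keys_iff)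

lemma iexp_surj:
  assumes "\<And>v. 0 \<le> lkp m v"
  obtains m' where "m = iexp m'"
proof
  show "m = iexp (Poly_Mapping.map nat m)"
    using assms by (intro poly_mapping_eqI) (auto simp: Poly_Mapping.map.rep_eq when_def)
qed

definition iexp2 :: "expo \<times> 'b \<Rightarrow> lexpo \<times> 'b" where
  "iexp2 x = (iexp (fst x), snd x)"

lemma iexp2_inject [simp]: "iexp2 a = iexp2 b \<longleftrightarrow> a = b"
  by (auto simp: iexp2_def prod_eq_iff)

lemma iexp2_add: "iexp2 (a + b) = iexp2 a + iexp2 b"
  by (auto simp: iexp2_def iexp_add)

definition emb :: "'k::comm_ring_1 cpoly \<Rightarrow> 'k laurent" where
  "emb f = (\<Sum>x\<in>supp f. mterm (iexp2 x) (coef f x))"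

lemma coef_emb: "coef (emb f) (iexp2 x) = coef f x"
  by (simp add: emb_def coef_sum coef_mterm supp_iff)

lemma supp_emb: "supp (emb f) = iexp2 ` supp f"
proof
  show "supp (emb f) \<subseteq> iexp2 ` supp f"
    unfolding emb_def using supp_mterm by (intro supp_sumI) fastforce
qed (auto simp: supp_iff coef_emb)

lemma coef_emb_not: "y \<notin> range iexp2 \<Longrightarrow> coef (emb f) y = 0"
proof (rule ccontr)
  assume y: "y \<notin> range iexp2" "coef (emb f) y \<noteq> 0"
  then have "y \<in> iexp2 ` supp f" by (simp add: supp_iff flip: supp_emb)
  with y show False by blast
qed

lemma emb_eqI:
  assumes "\<And>x. coef (emb f) (iexp2 x) = coef g (iexp2 x)" "\<And>y. y \<notin> range iexp2 \<Longrightarrow> coef g y = 0"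
  shows "emb f = g"
proof (rule coef_eqI)
  fix y show "coef (emb f) y = coef g y"
  proof (cases "y \<in> range iexp2")
    case True
    then obtain x where "y = iexp2 x" by blast
    then show ?thesis using assms(1) by simp
  qed (simp add: assms(2) coef_emb_not)
qed

lemma emb_zero [simp]: "emb 0 = 0" by (simp add: emb_def)

lemma emb_add: "emb (f + g) = emb f + emb g"
  by (rule emb_eqI) (auto simp: coef_emb coef_add coef_emb_not)

lemma emb_sum: "emb (sum f I) = (\<Sum>i\<in>I. emb (f i))"
  by (induction I rule: infinite_finite_induct) (auto simp: emb_add)

lemma emb_mterm: "emb (mterm x c) = mterm (iexp2 x) c"
proof (rule emb_eqI)
  fix y :: "lexpo \<times> ((nat \<times> expo) \<Rightarrow>\<^sub>0 nat)" assume "y \<notin> range iexp2"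
  then have "iexp2 x \<noteq> y" by blast
  then show "coef (mterm (iexp2 x) c) y = 0" by (simp add: coef_mterm)
qed (simp add: coef_emb coef_mterm)

lemma emb_mult: "emb (f * g) = emb f * emb g"
proof -
  have "emb (f * g) = (\<Sum>x\<in>supp f. \<Sum>y\<in>supp g. mterm (iexp2 x + iexp2 y) (coef f x * coef g y))"
    unfolding mult_expansion[of f g] by (simp add: emb_sum emb_mterm iexp2_add)
  also have "\<dots> = emb f * emb g"
    by (simp add: emb_def sum_product mterm_mult)
  finally show ?thesis .
qed

lemma emb_one [simp]: "emb 1 = 1"
proof -
  have "iexp2 (0 :: expo \<times> ((nat \<times> expo) \<Rightarrow>\<^sub>0 nat)) = 0" by (simp add: iexp2_def zero_prod_def)
  then show ?thesis using emb_mterm[of 0 1] unfolding one_mterm by (rule subst)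
qed

lemma emb_inject: "emb f = emb g \<longleftrightarrow> f = g"
proof
  assume "emb f = emb g"
  then have "coef f x = coef g x" for x by (metis coef_emb)
  then show "f = g" by (rule coef_eqI)
qed simp

lemma emb_hom: "comm_ring_hom emb"
  by unfold_locales (simp_all only: emb_add emb_mult emb_zero emb_one)

lemma emb_surj:
  fixes g :: "'k::comm_ring_1 laurent"
  assumes "\<And>x v. x \<in> supp g \<Longrightarrow> 0 \<le> lkp (fst x) v"
  obtains f :: "'k cpoly" where "g = emb f"
proof -
  have "\<exists>f. mterm x (coef g x) = emb f" if x: "x \<in> supp g" for x
  proof -
    obtain m where "fst x = iexp m" using iexp_surj[of "fst x"] assms[OF x] by blast
    then have "iexp2 (m, snd x) = x" by (simp add: iexp2_def prod_eq_iff)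
    then show ?thesis by (metis emb_mterm)
  qed
  then obtain h where "\<And>x. x \<in> supp g \<Longrightarrow> mterm x (coef g x) = emb (h x)" by metis
  then have "g = emb (\<Sum>x\<in>supp g. h x)"
    by (subst mterm_expansion[of g]) (simp add: emb_sum)
  with that show thesis .
qed

section \<open>The Koszul complex\<close>

text \<open>The value at T is the coefficient of the basis vector e_T of the exterior algebra. The
  functions are total; \<open>Pc\<close> cuts out those living on sets of the right size.\<close>

type_synonym 'k chain = "nat set \<Rightarrow> 'k laurent"

locale multigraded =
  fixes r :: nat and ns :: "nat \<Rightarrow> nat" and d :: "nat \<Rightarrow> nat \<Rightarrow> nat" and \<mu> :: "nat \<Rightarrow> nat"
  assumes r_pos: "1 \<le> r"
    and ns_pos: "j \<in> {1..r} \<Longrightarrow> 1 \<le> ns j"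
    and mu_less: "j \<in> {1..r} \<Longrightarrow> i \<le> total_dim r ns \<Longrightarrow> \<mu> j < d i j"
begin

abbreviation n :: nat where "n \<equiv> total_dim r ns"

definition gdeg :: "lexpo \<Rightarrow> nat \<Rightarrow> int" where
  "gdeg m j = (\<Sum>l=0..ns j. lkp m (j, l))"

lemma gdeg_add: "gdeg (a + b) j = gdeg a j + gdeg b j"
  by (simp add: gdeg_def lookup_add sum.distrib)

lemma gdeg_diff: "gdeg (a - b) j = gdeg a j - gdeg b j"
  by (simp add: gdeg_def lookup_minus sum_subtractf)

lemma gdeg_zero [simp]: "gdeg 0 j = 0"
  by (simp add: gdeg_def)

lemma gdeg_iexp: "gdeg (iexp m) j = int (group_deg ns m j)"
  by (simp add: gdeg_def group_deg_def)

text \<open>A chain of the Koszul complex in multidegree \<open>\<delta> - \<mu>\<close> has coefficient of multidegree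
  \<open>tdeg T\<close> at the basis vector indexed by \<open>T\<close>.\<close>

definition tdeg :: "nat set \<Rightarrow> nat \<Rightarrow> int" where
  "tdeg T j = delta r ns d j - int (\<mu> j) - (\<Sum>i\<in>T. int (d i j))"

definition Reg :: "(nat \<times> nat) set \<Rightarrow> nat set \<Rightarrow> (lexpo \<times> ((nat \<times> expo) \<Rightarrow>\<^sub>0 nat)) set" where
  "Reg A T = {x. Poly_Mapping.keys (fst x) \<subseteq> xvars r ns \<and> Poly_Mapping.keys (snd x) \<subseteq> uvars r ns d \<and>
     (\<forall>v\<in>A. 0 \<le> lkp (fst x) v) \<and> (\<forall>j\<in>{1..r}. gdeg (fst x) j = tdeg T j)}"

definition Up :: "(nat \<times> nat) set \<Rightarrow> (lexpo \<times> ((nat \<times> expo) \<Rightarrow>\<^sub>0 nat)) set" where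
  "Up B = {x. \<exists>v\<in>B. 0 \<le> lkp (fst x) v}"

lemma Reg_mono: "A \<subseteq> A' \<Longrightarrow> Reg A' T \<subseteq> Reg A T"
  by (auto simp: Reg_def)

lemma Up_mono: "B \<subseteq> B' \<Longrightarrow> Up B \<subseteq> Up B'"
  by (auto simp: Up_def)

definition fmon :: "nat \<Rightarrow> expo \<Rightarrow> lexpo \<times> ((nat \<times> expo) \<Rightarrow>\<^sub>0 nat)" where
  "fmon i \<alpha> = (iexp \<alpha>, Poly_Mapping.single (i, \<alpha>) 1)"

definition F :: "nat \<Rightarrow> 'k::comm_ring_1 laurent" where
  "F i = emb (generic_poly r ns d i)"

lemma F_eq: "F i = (\<Sum>\<alpha>\<in>expts r ns (d i). mterm (fmon i \<alpha>) 1)"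
proof -
  have *: "Poly_Mapping.single \<alpha> (u_var (i, \<alpha>)) = mterm (\<alpha>, Poly_Mapping.single (i, \<alpha>) 1) (1::'a)" for \<alpha>
    by (simp add: mterm_def u_var_def)
  show ?thesis
    by (simp add: F_def generic_poly_def * emb_sum emb_mterm iexp2_def fmon_def)
qed

lemma supp_F: "x \<in> supp (F i) \<Longrightarrow> \<exists>\<alpha>\<in>expts r ns (d i). x = fmon i \<alpha>"
proof -
  assume "x \<in> supp (F i)"
  moreover have "supp (F i) \<subseteq> (\<Union>\<alpha>\<in>expts r ns (d i). {fmon i \<alpha>})"
    unfolding F_eq by (rule order_trans[OF supp_sum], rule UN_mono[OF order_refl supp_mterm])
  ultimately show ?thesis by auto
qed

lemma keys_add_subset:
  "Poly_Mapping.keys a \<subseteq> S \<Longrightarrow> Poly_Mapping.keys b \<subseteq> S \<Longrightarrow> Poly_Mapping.keys (a + b) \<subseteq> S"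
  using Poly_Mapping.keys_add[of a b] by blast

lemma tdeg_insert:
  "finite T \<Longrightarrow> i \<notin> T \<Longrightarrow> tdeg T j = tdeg (insert i T) j + int (d i j)"
  by (simp add: tdeg_def)

lemma expts_gdeg: "\<alpha> \<in> expts r ns e \<Longrightarrow> j \<in> {1..r} \<Longrightarrow> gdeg (iexp \<alpha>) j = int (e j)"
  by (simp add: gdeg_iexp expts_def)

lemma Reg_shift:
  assumes "x \<in> Reg A (insert i T)" "finite T" "i \<notin> T" "i \<le> n" "\<alpha> \<in> expts r ns (d i)"
  shows "fmon i \<alpha> + x \<in> Reg A T"
proof -
  have "Poly_Mapping.keys \<alpha> \<subseteq> xvars r ns" using assms(5) by (simp add: expts_def)
  moreover have "Poly_Mapping.keys (Poly_Mapping.single (i, \<alpha>) (1::nat)) \<subseteq> uvars r ns d"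
    using assms(4,5) by (auto simp: uvars_def)
  ultimately have "Poly_Mapping.keys (fst (fmon i \<alpha> + x)) \<subseteq> xvars r ns"
    "Poly_Mapping.keys (snd (fmon i \<alpha> + x)) \<subseteq> uvars r ns d"
    using assms(1) unfolding fmon_def Reg_def fst_add snd_add
    by (auto intro!: keys_add_subset simp del: subset_iff keys_single del: subsetI)
  then show ?thesis
    using assms(1) tdeg_insert[OF assms(2,3)]
    by (simp add: Reg_def fmon_def lookup_add gdeg_add expts_gdeg[OF assms(5)])
qed

lemma Up_shift: "x \<in> Up B \<Longrightarrow> fmon i \<alpha> + x \<in> Up B"
  by (force simp: Up_def fmon_def lookup_add)

text \<open>Counting the larger elements makes the sign 1 when the new index exceeds all of T. This
  suits the induction on the number of polynomials, and it is the sign of appending a unit column on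
  the right in \<open>det_umat_sorted_insert\<close>.\<close>

definition sg :: "nat \<Rightarrow> nat set \<Rightarrow> 'k::comm_ring_1 laurent" where
  "sg i T = (-1) ^ card {t\<in>T. i < t}"

lemma supp_sg_mult [simp]: "supp (sg i T * f) = supp f"
proof -
  have "sg i T = (1::'a laurent) \<or> sg i T = (-1::'a laurent)"
    unfolding sg_def by (cases "even (card {t\<in>T. i < t})") auto
  then show ?thesis by (elim disjE) simp_all
qed

definition D :: "nat \<Rightarrow> 'k::comm_ring_1 chain \<Rightarrow> 'k chain" where
  "D N f T = (if T \<subseteq> {..<N} then \<Sum>i\<in>{..<N} - T. sg i T * (F i * f (insert i T)) else 0)"

definition Pc :: "nat \<Rightarrow> (nat \<times> nat) set \<Rightarrow> nat \<Rightarrow> 'k::comm_ring_1 chain set" where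
  "Pc N A q = {f. (\<forall>T. f T \<noteq> 0 \<longrightarrow> T \<subseteq> {..<N} \<and> card T = q) \<and> (\<forall>T. supp (f T) \<subseteq> Reg A T)}"

definition Oc :: "nat \<Rightarrow> (nat \<times> nat) set \<Rightarrow> (nat \<times> nat) set \<Rightarrow> nat \<Rightarrow> 'k::comm_ring_1 chain set" where
  "Oc N A B q = {f \<in> Pc N A q. \<forall>T. supp (f T) \<subseteq> Up B}"

lemma Pc_zero [simp]: "0 \<in> Pc N A q"
  by (simp add: Pc_def)

lemma Pc_add:
  assumes "f \<in> Pc N A q" "g \<in> Pc N A q" shows "f + g \<in> Pc N A q"
proof -
  have "f T \<noteq> 0 \<or> g T \<noteq> 0" if "(f + g) T \<noteq> 0" for T using that by auto
  moreover have "supp ((f + g) T) \<subseteq> Reg A T" for T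
    using assms supp_addI[of "f T" _ "g T"] by (simp add: Pc_def)
  ultimately show ?thesis using assms unfolding Pc_def by blast
qed

lemma Pc_diff:
  assumes "f \<in> Pc N A q" "g \<in> Pc N A q" shows "f - g \<in> Pc N A q"
proof -
  have "f T \<noteq> 0 \<or> g T \<noteq> 0" if "(f - g) T \<noteq> 0" for T using that by auto
  moreover have "supp ((f - g) T) \<subseteq> Reg A T" for T
    using assms supp_diffI[of "f T" _ "g T"] by (simp add: Pc_def)
  ultimately show ?thesis using assms unfolding Pc_def by blast
qed

lemma Oc_zero [simp]: "0 \<in> Oc N A B q"
  by (simp add: Oc_def)

lemma Oc_add: "f \<in> Oc N A B q \<Longrightarrow> g \<in> Oc N A B q \<Longrightarrow> f + g \<in> Oc N A B q"
  by (auto simp: Oc_def Pc_add supp_addI del: subsetI)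

lemma Oc_diff: "f \<in> Oc N A B q \<Longrightarrow> g \<in> Oc N A B q \<Longrightarrow> f - g \<in> Oc N A B q"
  by (auto simp: Oc_def Pc_diff supp_diffI del: subsetI)

lemma Oc_Pc: "f \<in> Oc N A B q \<Longrightarrow> f \<in> Pc N A q"
  by (simp add: Oc_def)

lemma Pc_mono: "A \<subseteq> A' \<Longrightarrow> f \<in> Pc N A' q \<Longrightarrow> f \<in> Pc N A q"
  using Reg_mono[of A A'] by (fastforce simp: Pc_def)

lemma Oc_mono: "A \<subseteq> A' \<Longrightarrow> B' \<subseteq> B \<Longrightarrow> f \<in> Oc N A' B' q \<Longrightarrow> f \<in> Oc N A B q"
  unfolding Oc_def using Up_mono[of B' B] Pc_mono[of A A' f N q] by blast

lemma Oc_empty: "f \<in> Oc N A {} q \<longleftrightarrow> f = 0"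
proof
  assume "f \<in> Oc N A {} q"
  then show "f = 0" by (simp add: Oc_def Up_def supp_empty_iff fun_eq_iff)
qed simp

lemma Pc_supp: "f \<in> Pc N A q \<Longrightarrow> x \<in> supp (f T) \<Longrightarrow> x \<in> Reg A T"
  by (auto simp: Pc_def)

lemma Pc_card: "f \<in> Pc N A q \<Longrightarrow> f T \<noteq> 0 \<Longrightarrow> T \<subseteq> {..<N} \<and> card T = q"
  by (auto simp: Pc_def)

lemma D_add: "D N (f + g) = D N f + D N g"
  by (rule ext) (simp add: D_def distrib_left sum.distrib)

lemma D_diff: "D N (f - g) = D N f - D N g"
  by (rule ext) (simp add: D_def right_diff_distrib sum_subtractf)

lemma D_zero [simp]: "D N 0 = 0"
  by (rule ext) (simp add: D_def)

lemma sg_insert: "finite T \<Longrightarrow> j \<notin> T \<Longrightarrow> sg i (insert j T) = (if i < j then - sg i T else sg i T)"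
proof -
  assume T: "finite T" "j \<notin> T"
  have "{t \<in> insert j T. i < t} = (if i < j then insert j {t \<in> T. i < t} else {t \<in> T. i < t})" by auto
  then show ?thesis using T by (simp add: sg_def)
qed

lemma sum_pairs_antisym:
  fixes a :: "nat \<Rightarrow> nat \<Rightarrow> 'b::ab_group_add"
  assumes "finite S" "\<And>i j. i \<in> S \<Longrightarrow> j \<in> S \<Longrightarrow> i < j \<Longrightarrow> a j i = - a i j"
  shows "(\<Sum>i\<in>S. \<Sum>j\<in>S - {i}. a i j) = 0"
proof -
  have fin: "finite {j\<in>S. P j}" for P using assms(1) by simp
  have "(\<Sum>i\<in>S. \<Sum>j\<in>S - {i}. a i j) = (\<Sum>i\<in>S. (\<Sum>j\<in>{j\<in>S. i < j}. a i j) + (\<Sum>j\<in>{j\<in>S. j < i}. a i j))"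
  proof (rule sum.cong[OF refl])
    fix i assume "i \<in> S"
    have "S - {i} = {j\<in>S. i < j} \<union> {j\<in>S. j < i}" by auto
    then show "(\<Sum>j\<in>S - {i}. a i j) = (\<Sum>j\<in>{j\<in>S. i < j}. a i j) + (\<Sum>j\<in>{j\<in>S. j < i}. a i j)"
      using fin by (simp add: sum.union_disjoint disjoint_iff)
  qed
  also have "\<dots> = (\<Sum>i\<in>S. \<Sum>j\<in>{j\<in>S. i < j}. a i j) + (\<Sum>i\<in>S. \<Sum>j\<in>{j\<in>S. j < i}. a i j)"
    by (rule sum.distrib)
  also have "(\<Sum>i\<in>S. \<Sum>j\<in>{j\<in>S. j < i}. a i j) = (\<Sum>j\<in>S. \<Sum>i\<in>{i\<in>S. j < i}. a i j)"
    by (rule sum.swap_restrict[OF assms(1) assms(1)])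
  also have "\<dots> = (\<Sum>j\<in>S. \<Sum>i\<in>{i\<in>S. j < i}. - a j i)"
    using assms(2) by (intro sum.cong refl) auto
  finally show ?thesis by (simp add: sum_negf)
qed

lemma D_D [simp]: "D N (D N f) = 0"
proof (rule ext)
  fix T
  show "D N (D N f) T = 0 T"
  proof (cases "T \<subseteq> {..<N}")
    case True
    then have fT: "finite T" using finite_subset by blast
    define a where "a i j = sg i T * (F i * (sg j (insert i T) * (F j * f (insert j (insert i T)))))" for i j
    have "D N (D N f) T = (\<Sum>i\<in>{..<N} - T. \<Sum>j\<in>{..<N} - T - {i}. a i j)"
      using True by (auto simp: D_def a_def sum_distrib_left intro!: sum.cong)
    also have "\<dots> = 0"
    proof (rule sum_pairs_antisym)
      fix i j assume "i \<in> {..<N} - T" "j \<in> {..<N} - T" "i < j"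
      then show "a j i = - a i j"
        using fT by (simp add: a_def sg_insert insert_commute mult_ac)
    qed simp
    finally show ?thesis by simp
  qed (simp add: D_def)
qed

lemma D_supp:
  fixes f :: "'k::comm_ring_1 chain"
  assumes f: "\<And>i \<alpha> y. i \<in> {..<N} - T \<Longrightarrow> \<alpha> \<in> expts r ns (d i) \<Longrightarrow> y \<in> supp (f (insert i T)) \<Longrightarrow>
      fmon i \<alpha> + y \<in> S"
  shows "supp (D N f T) \<subseteq> S"
proof (cases "T \<subseteq> {..<N}")
  case True
  have "supp (\<Sum>i\<in>{..<N} - T. sg i T * (F i * f (insert i T))) \<subseteq> S"
  proof (rule supp_sumI)
    fix i assume i: "i \<in> {..<N} - T"
    have "supp (F i * f (insert i T)) \<subseteq> S"
      by (rule supp_multI) (use f[OF i] supp_F in blast)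
    then show "supp (sg i T * (F i * f (insert i T))) \<subseteq> S" by simp
  qed
  with True show ?thesis by (simp add: D_def)
qed (simp add: D_def)

lemma D_Pc:
  assumes f: "f \<in> Pc N A (Suc q)" and N: "N \<le> Suc n"
  shows "D N f \<in> Pc N A q"
proof -
  have "T \<subseteq> {..<N} \<and> card T = q" if nz: "D N f T \<noteq> 0" for T
  proof -
    have T: "T \<subseteq> {..<N}" using nz by (auto simp: D_def split: if_splits)
    obtain i where i: "i \<in> {..<N} - T" "sg i T * (F i * f (insert i T)) \<noteq> 0"
      using nz by (auto simp: D_def split: if_splits elim!: sum.not_neutral_contains_not_neutral)
    then have "f (insert i T) \<noteq> 0" by auto
    then have "card (insert i T) = Suc q" using Pc_card[OF f] by blast
    then show ?thesis using T i finite_subset[OF T] by simp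
  qed
  moreover have "supp (D N f T) \<subseteq> Reg A T" for T
  proof (cases "T \<subseteq> {..<N}")
    case True
    show ?thesis
      by (rule D_supp) (use True N finite_subset[OF True] in \<open>auto intro!: Reg_shift dest: Pc_supp[OF f]\<close>)
  qed (simp add: D_def)
  ultimately show ?thesis by (simp add: Pc_def)
qed

lemma D_Pc0:
  assumes "f \<in> Pc N A 0" shows "D N f = 0"
proof (rule ext)
  fix T
  have "f (insert i T) = 0" if "T \<subseteq> {..<N}" for i
  proof (rule ccontr)
    assume "f (insert i T) \<noteq> 0"
    from Pc_card[OF assms this] finite_subset[OF that] show False by simp
  qed
  then show "D N f T = 0 T" by (simp add: D_def)
qed

lemma D_Pc': "f \<in> Pc N A q \<Longrightarrow> N \<le> Suc n \<Longrightarrow> D N f \<in> Pc N A (q - 1)"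
  by (cases q) (auto simp: D_Pc0 D_Pc)

lemma D_Oc:
  assumes f: "f \<in> Oc N A B q" and N: "N \<le> Suc n"
  shows "D N f \<in> Oc N A B (q - 1)"
proof -
  have "supp (D N f T) \<subseteq> Up B" for T
    by (rule D_supp) (use f in \<open>auto simp: Oc_def intro!: Up_shift\<close>)
  then show ?thesis using D_Pc'[OF Oc_Pc[OF f] N] by (simp add: Oc_def)
qed

end

context multigraded begin

subsection \<open>Acyclicity where a variable of every group is invertible\<close>

text \<open>The monomial of \<open>F i\<close> that is a unit when the variables \<open>(j, s j)\<close> are inverted; its
  coefficient does not occur in any other polynomial.\<close>

definition sec_expo :: "(nat \<Rightarrow> nat) \<Rightarrow> (nat \<Rightarrow> nat) \<Rightarrow> expo" where
  "sec_expo s e = (\<Sum>j\<in>{1..r}. Poly_Mapping.single (j, s j) (e j))"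

lemma lookup_sec_expo:
  "lkp (sec_expo s e) (j, l) = (if j \<in> {1..r} \<and> l = s j then e j else 0)"
proof -
  have "lkp (sec_expo s e) (j, l) = (\<Sum>i\<in>{1..r}. if i = j then (if l = s j then e j else 0) else 0)"
    unfolding sec_expo_def lookup_sum by (intro sum.cong refl) (auto simp: lookup_single when_def)
  then show ?thesis by simp
qed

lemma sec_expo_expts:
  assumes "\<forall>j\<in>{1..r}. s j \<le> ns j"
  shows "sec_expo s e \<in> expts r ns e"
proof -
  have "Poly_Mapping.keys (sec_expo s e) \<subseteq> xvars r ns"
    using assms by (auto simp: in_keys_iff lookup_sec_expo xvars_def split: if_splits)
  moreover have "group_deg ns (sec_expo s e) j = e j" if "j \<in> {1..r}" for j
  proof -
    have "group_deg ns (sec_expo s e) j = (\<Sum>l=0..ns j. if l = s j then e j else 0)"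
      unfolding group_deg_def lookup_sec_expo using that by (intro sum.cong) auto
    then show ?thesis using assms that by simp
  qed
  ultimately show ?thesis by (simp add: expts_def)
qed

lemma F_split:
  assumes "\<sigma> \<in> expts r ns (d i)"
  obtains H where "F i = mterm (fmon i \<sigma>) 1 + H"
    "\<And>x. x \<in> supp H \<Longrightarrow> \<exists>\<alpha>\<in>expts r ns (d i). \<alpha> \<noteq> \<sigma> \<and> x = fmon i \<alpha>"
proof
  let ?H = "\<Sum>\<alpha>\<in>expts r ns (d i) - {\<sigma>}. mterm (fmon i \<alpha>) 1"
  show "F i = mterm (fmon i \<sigma>) 1 + ?H"
    unfolding F_eq by (rule sum.remove[OF finite_expts assms])
  fix x assume "x \<in> supp ?H"
  moreover have "supp ?H \<subseteq> (\<Union>\<alpha>\<in>expts r ns (d i) - {\<sigma>}. {fmon i \<alpha>})"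
    by (rule order_trans[OF supp_sum], rule UN_mono[OF order_refl supp_mterm])
  ultimately show "\<exists>\<alpha>\<in>expts r ns (d i). \<alpha> \<noteq> \<sigma> \<and> x = fmon i \<alpha>" by auto
qed

lemma keys_diff_nat: "Poly_Mapping.keys (t - u) \<subseteq> Poly_Mapping.keys t"
  for t u :: "'a \<Rightarrow>\<^sub>0 nat"
  by (auto simp: in_keys_iff lookup_minus)

lemma fmon_add_diff:
  assumes "0 < lkp (snd x) (i, \<alpha>)"
  shows "fmon i \<alpha> + (x - fmon i \<alpha>) = x"
proof -
  have "Poly_Mapping.single (i, \<alpha>) 1 + (snd x - Poly_Mapping.single (i, \<alpha>) 1) = snd x"
    using assms by (intro poly_mapping_eqI) (auto simp: lookup_add lookup_minus lookup_single when_def)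
  then show ?thesis by (simp add: prod_eq_iff fmon_def)
qed

text \<open>The monomial can be divided out because \<sigma> has exponent 0 at the variables of A,
  so that nonnegativity there survives; other exponents may become negative.\<close>

lemma Reg_unshift:
  assumes "x \<in> Reg A T" "finite T" "i \<notin> T" "\<sigma> \<in> expts r ns (d i)"
    "\<And>v. v \<in> A \<Longrightarrow> lkp \<sigma> v = 0"
  shows "x - fmon i \<sigma> \<in> Reg A (insert i T)"
proof -
  have "Poly_Mapping.keys \<sigma> \<subseteq> xvars r ns" using assms(4) by (simp add: expts_def)
  then have "Poly_Mapping.keys (fst (x - fmon i \<sigma>)) \<subseteq> xvars r ns"
    using keys_diff[of "fst x" "iexp \<sigma>"] assms(1) by (auto simp: fmon_def Reg_def)
  moreover have "Poly_Mapping.keys (snd (x - fmon i \<sigma>)) \<subseteq> uvars r ns d"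
    using assms(1) keys_diff_nat[of "snd x"] by (simp add: fmon_def Reg_def) blast
  ultimately show ?thesis
    using assms(1,5) tdeg_insert[OF assms(2,3)]
    by (simp add: Reg_def fmon_def lookup_minus gdeg_diff expts_gdeg[OF assms(4)])
qed

text \<open>Up to the monomial x^\<sigma>, by which one may divide, F i is the indeterminate
  U_(i,\<sigma>) plus terms H free of it. Replacing U_(i,\<sigma>) x^\<sigma> by F i - H lowers the
  degree in U_(i,\<sigma>), so the division ends with a remainder free of this
  indeterminate.\<close>

lemma F_division:
  fixes x :: "'k::comm_ring_1 laurent"
  assumes x: "supp x \<subseteq> Reg A T" and T: "finite T" "i \<notin> T" "i \<le> n"
    and \<sigma>: "\<sigma> \<in> expts r ns (d i)" "\<And>v. v \<in> A \<Longrightarrow> lkp \<sigma> v = 0"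
  shows "\<exists>a b. x = a + F i * b \<and> supp a \<subseteq> Reg A T \<and> supp b \<subseteq> Reg A (insert i T) \<and>
    (\<forall>y\<in>supp a. lkp (snd y) (i, \<sigma>) = 0)"
proof -
  define u where "u = (i, \<sigma>)"
  obtain H :: "'k laurent" where H: "F i = mterm (fmon i \<sigma>) 1 + H"
    "\<And>x. x \<in> supp H \<Longrightarrow> \<exists>\<alpha>\<in>expts r ns (d i). \<alpha> \<noteq> \<sigma> \<and> x = fmon i \<alpha>"
    using F_split[OF \<sigma>(1)] by blast
  have "\<exists>a b. x = a + F i * b \<and> supp a \<subseteq> Reg A T \<and> supp b \<subseteq> Reg A (insert i T) \<and>
    (\<forall>y\<in>supp a. lkp (snd y) u = 0)" if "\<forall>y\<in>supp x. lkp (snd y) u \<le> E" for E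
    using that x
  proof (induction E arbitrary: x)
    case 0
    then show ?case by (intro exI[of _ x] exI[of _ 0]) auto
  next
    case (Suc E)
    define S where "S = {y :: lexpo \<times> ((nat \<times> expo) \<Rightarrow>\<^sub>0 nat). 0 < lkp (snd y) u}"
    \<comment> \<open>All terms containing the indeterminate, divided by the distinguished term of F
      i.\<close>
    define b0 where "b0 = (\<Sum>y\<in>supp x \<inter> S. mterm (y - fmon i \<sigma>) (coef x y))"
    have b0: "supp b0 \<subseteq> (\<lambda>y. y - fmon i \<sigma>) ` (supp x \<inter> S)"
      unfolding b0_def using supp_mterm by (intro supp_sumI) fastforce
    have "mterm (fmon i \<sigma>) 1 * b0 = flt S x"
      unfolding b0_def flt_def by (auto simp: sum_distrib_left mterm_mult S_def u_def fmon_add_diff intro!: sum.cong)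
    then have "x - F i * b0 = flt (- S) x - H * b0"
      using flt_compl[of x S] H(1) by (simp add: algebra_simps)
    moreover have "\<forall>y\<in>supp (flt (- S) x). lkp (snd y) u \<le> E"
      by (auto simp: supp_flt S_def)
    moreover have "\<forall>y\<in>supp (H * b0). lkp (snd y) u \<le> E"
    proof
      fix y assume "y \<in> supp (H * b0)"
      then obtain h z where hz: "h \<in> supp H" "z \<in> supp b0" "y = h + z" by (rule supp_mult)
      from H(2)[OF hz(1)] obtain \<alpha> where \<alpha>: "\<alpha> \<noteq> \<sigma>" "h = fmon i \<alpha>" by blast
      from b0 hz(2) obtain w where w: "w \<in> supp x" "z = w - fmon i \<sigma>" by blast
      have "lkp (snd y) u = lkp (snd w) u - 1"
        using \<alpha> w hz by (simp add: fmon_def u_def lookup_add lookup_minus lookup_single)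
      with Suc.prems(1) w(1) show "lkp (snd y) u \<le> E" by fastforce
    qed
    ultimately have 1: "\<forall>y\<in>supp (x - F i * b0). lkp (snd y) u \<le> E"
      using supp_diff[of "flt (- S) x" "H * b0"] by auto
    have 2: "supp b0 \<subseteq> Reg A (insert i T)"
      using b0 Suc.prems(2) Reg_unshift[OF _ T(1,2) \<sigma>] by blast
    have "supp (F i * b0) \<subseteq> Reg A T"
    proof (rule supp_multI)
      fix y z assume "y \<in> supp (F i :: 'k laurent)" "z \<in> supp b0"
      with 2 supp_F[of y i] show "y + z \<in> Reg A T" using Reg_shift[OF _ T] by blast
    qed
    then have "supp (x - F i * b0) \<subseteq> Reg A T"
      using Suc.prems(2) by (intro supp_diffI)
    from Suc.IH[OF 1 this] obtain a b where ab: "x - F i * b0 = a + F i * b" "supp a \<subseteq> Reg A T"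
      "supp b \<subseteq> Reg A (insert i T)" "\<forall>y\<in>supp a. lkp (snd y) u = 0" by blast
    have "x = a + F i * (b + b0)" using ab(1) by (simp add: algebra_simps)
    moreover have "supp (b + b0) \<subseteq> Reg A (insert i T)" using ab(3) 2 by (rule supp_addI)
    ultimately show ?case using ab by blast
  qed
  moreover have "\<exists>E. \<forall>y\<in>supp x. lkp (snd y) u \<le> E"
    using finite_nat_set_iff_bounded_le[of "(\<lambda>y. lkp (snd y) u) ` supp x"] by auto
  ultimately show ?thesis unfolding u_def by blast
qed

text \<open>A leading term argument: among the monomials of y outside \<open>Up B\<close> take one
  of maximal degree in U_(i,\<sigma>). Its product with x^\<sigma> U_(i,\<sigma>) stays outside
  \<open>Up B\<close>, since \<sigma> is 0 on B, and cancels neither against a, which is free of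
  U_(i,\<sigma>), nor against H * y, where the degree is too small.\<close>

lemma F_cancel_mod_Up:
  fixes y :: "'k::comm_ring_1 laurent"
  assumes Fy: "supp (a + F i * y) \<subseteq> Up B"
    and \<sigma>: "\<sigma> \<in> expts r ns (d i)" "\<And>v. v \<in> B \<Longrightarrow> lkp \<sigma> v = 0"
    and a: "\<And>x. x \<in> supp a \<Longrightarrow> lkp (snd x) (i, \<sigma>) = 0"
  shows "supp y \<subseteq> Up B"
proof (rule ccontr)
  assume "\<not> supp y \<subseteq> Up B"
  then have "supp y - Up B \<noteq> {}" by blast
  define u where "u = (i, \<sigma>)"
  define M where "M = Max ((\<lambda>x. lkp (snd x) u) ` (supp y - Up B))"
  have "M \<in> (\<lambda>x. lkp (snd x) u) ` (supp y - Up B)"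
    unfolding M_def using \<open>supp y - Up B \<noteq> {}\<close> by (intro Max_in) auto
  then obtain x where x: "x \<in> supp y" "x \<notin> Up B" "lkp (snd x) u = M" by auto
  have max: "lkp (snd z) u \<le> M" if "z \<in> supp y" "z \<notin> Up B" for z
    unfolding M_def using that by (intro Max_ge) auto
  obtain H :: "'k laurent" where H: "F i = mterm (fmon i \<sigma>) 1 + H"
    "\<And>x. x \<in> supp H \<Longrightarrow> \<exists>\<alpha>\<in>expts r ns (d i). \<alpha> \<noteq> \<sigma> \<and> x = fmon i \<alpha>"
    using F_split[OF \<sigma>(1)] by blast
  let ?z = "fmon i \<sigma> + x"
  have z: "?z \<notin> Up B"
    using x(2) \<sigma>(2) by (auto simp: Up_def fmon_def lookup_add)
  have uz: "lkp (snd ?z) u = Suc M"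
    using x(3) by (simp add: fmon_def u_def lookup_add)
  have "?z \<notin> supp a" using a[of ?z] uz by (auto simp: u_def)
  then have "coef a ?z = 0" by (simp add: supp_iff)
  moreover have "?z \<notin> supp (H * y)"
  proof
    assume "?z \<in> supp (H * y)"
    then obtain h w where hw: "h \<in> supp H" "w \<in> supp y" "?z = h + w" by (rule supp_mult)
    from H(2)[OF hw(1)] obtain \<alpha> where \<alpha>: "\<alpha> \<noteq> \<sigma>" "h = fmon i \<alpha>" by blast
    have "w \<notin> Up B" using Up_shift[of w B i \<alpha>] z hw(3) \<alpha>(2) by metis
    have "lkp (snd (h + w)) u = lkp (snd w) u"
      using \<alpha> by (simp add: fmon_def u_def lookup_add lookup_single)
    with uz hw(3) max[OF hw(2) \<open>w \<notin> Up B\<close>] show False by simp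
  qed
  then have "coef (H * y) ?z = 0" by (simp add: supp_iff)
  ultimately have "coef (a + F i * y) ?z = coef y x"
    unfolding H(1) by (simp add: distrib_right coef_add coef_mterm_mult)
  then have "?z \<in> supp (a + F i * y)" using x(1) by (simp add: supp_iff)
  with Fy z show False by blast
qed

lemma sg_last: "T \<subseteq> {..<N} \<Longrightarrow> sg N T = 1"
proof -
  assume "T \<subseteq> {..<N}"
  then have "{t\<in>T. N < t} = {}" by auto
  then show ?thesis by (simp add: sg_def del: Collect_empty_eq)
qed

lemma D_Suc:
  assumes "T \<subseteq> {..<N}"
  shows "D (Suc N) f T = D N f T + F N * f (insert N T)"
proof -
  have "{..<Suc N} - T = insert N ({..<N} - T)" using assms by auto
  moreover have "T \<subseteq> {..<Suc N}" using assms by auto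
  ultimately show ?thesis using assms by (simp add: D_def sg_last algebra_simps)
qed

text \<open>Induction on the number of polynomials. The indeterminate U_(N,\<sigma>) of the last one
  occurs in no other, so \<open>F_division\<close> makes the coefficients at sets without N free of
  it, at the cost of a boundary. Then \<open>F_cancel_mod_Up\<close> forces the coefficients at sets
  with N into \<open>Up B\<close>, and what is left is a cycle for N polynomials.\<close>

lemma koszul_exact:
  fixes f :: "'k::comm_ring_1 chain"
  assumes s: "\<forall>j\<in>{1..r}. s j \<le> ns j \<and> (j, s j) \<notin> A \<union> B"
  shows "N \<le> Suc n \<Longrightarrow> 1 \<le> q \<Longrightarrow> f \<in> Pc N A q \<Longrightarrow> D N f \<in> Oc N A B (q - 1) \<Longrightarrow>
    \<exists>g\<in>Pc N A (Suc q). f - D N g \<in> Oc N A B q"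
proof (induction N arbitrary: f)
  case 0
  have "f T = 0" for T
  proof (rule ccontr)
    assume "f T \<noteq> 0"
    from Pc_card[OF 0(3) this] 0(2) show False by auto
  qed
  then have "f = 0" by auto
  then show ?case by (intro bexI[of _ 0]) (simp_all only: D_zero diff_zero Oc_zero Pc_zero)
next
  case (Suc N)
  define \<sigma> where "\<sigma> = sec_expo s (d N)"
  have \<sigma>: "\<sigma> \<in> expts r ns (d N)" using s by (auto simp: \<sigma>_def intro: sec_expo_expts)
  have \<sigma>0: "lkp \<sigma> v = 0" if "v \<in> A \<union> B" for v
    using s that by (cases v) (auto simp: \<sigma>_def lookup_sec_expo)
  \<comment> \<open>The last clause keeps zero coefficients zero, so that the pieces stay in a
    single Koszul degree.\<close>
  define Q where "Q T a b \<longleftrightarrow> (T \<subseteq> {..<N} \<longrightarrow> f T = a + F N * b \<and> supp a \<subseteq> Reg A T \<and>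
    supp b \<subseteq> Reg A (insert N T) \<and> (\<forall>y\<in>supp a. lkp (snd y) (N, \<sigma>) = 0) \<and> (f T = 0 \<longrightarrow> a = 0 \<and> b = 0))"
    for T a b
  have "\<exists>a b. Q T a b" for T
  proof (cases "T \<subseteq> {..<N} \<and> f T \<noteq> 0")
    case True
    then have "finite T" "N \<notin> T" using finite_subset by auto
    moreover have "supp (f T) \<subseteq> Reg A T" using Suc.prems(3) by (simp add: Pc_def)
    ultimately show ?thesis
      using F_division[of "f T" A T N \<sigma>] \<sigma> \<sigma>0 Suc.prems(1) True by (simp add: Ball_def Q_def)
  next
    case False
    then have "Q T 0 0" by (auto simp: Q_def)
    then show ?thesis by blast
  qed
  then obtain a b where Q: "\<And>T. Q T (a T) (b T)" by metis
  have ab: "f T = a T + F N * b T \<and> supp (a T) \<subseteq> Reg A T \<and>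
    supp (b T) \<subseteq> Reg A (insert N T) \<and> (\<forall>y\<in>supp (a T). lkp (snd y) (N, \<sigma>) = 0) \<and>
    (f T = 0 \<longrightarrow> a T = 0 \<and> b T = 0)" if "T \<subseteq> {..<N}" for T
    using Q[of T] that unfolding Q_def by (rule mp)
  note ab_eq = ab[THEN conjunct1] and ab_a = ab[THEN conjunct2, THEN conjunct1]
    and ab_b = ab[THEN conjunct2, THEN conjunct2, THEN conjunct1]
    and ab_free = ab[THEN conjunct2, THEN conjunct2, THEN conjunct2, THEN conjunct1]
    and ab_zero = ab[THEN conjunct2, THEN conjunct2, THEN conjunct2, THEN conjunct2]
  \<comment> \<open>The quotient b T is placed at \<open>insert N T\<close>, with sign 1 by
    \<open>sg_last\<close>, so that the boundary of g1 removes F N * b T from f T.\<close>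
  define g1 where "g1 T = (if N \<in> T \<and> T \<subseteq> {..<Suc N} then b (T - {N}) else 0)" for T
  define a' where "a' T = (if T \<subseteq> {..<N} then a T else 0)" for T
  have g1: "g1 \<in> Pc (Suc N) A (Suc q)"
    unfolding Pc_def
  proof (intro CollectI conjI allI impI)
    fix T
    have sub: "T - {N} \<subseteq> {..<N}" if "T \<subseteq> {..<Suc N}" using that by auto
    { assume "g1 T \<noteq> 0"
      then have T: "N \<in> T" "T \<subseteq> {..<Suc N}" "b (T - {N}) \<noteq> 0" by (auto simp: g1_def split: if_splits)
      then have "f (T - {N}) \<noteq> 0" using ab_zero[OF sub] by blast
      then have "card (T - {N}) = q" using Pc_card[OF Suc.prems(3)] by blast
      moreover have "finite T" using T(2) finite_subset by blast
      ultimately show "card T = Suc q" "T \<subseteq> {..<Suc N}"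
        using T card_Suc_Diff1[of T N] by auto }
    show "supp (g1 T) \<subseteq> Reg A T"
    proof (cases "N \<in> T \<and> T \<subseteq> {..<Suc N}")
      case True
      then have "insert N (T - {N}) = T" by blast
      then show ?thesis using ab_b[OF sub] True by (simp add: g1_def)
    qed (auto simp: g1_def)
  qed
  have a': "a' \<in> Pc N A q"
    unfolding Pc_def
  proof (intro CollectI conjI allI impI)
    fix T
    { assume "a' T \<noteq> 0"
      then have T: "T \<subseteq> {..<N}" "a T \<noteq> 0" by (auto simp: a'_def split: if_splits)
      then have "f T \<noteq> 0" using ab_zero by blast
      then show "card T = q" "T \<subseteq> {..<N}" using T Pc_card[OF Suc.prems(3)] by blast+ }
    show "supp (a' T) \<subseteq> Reg A T" using ab_a[of T] by (simp add: a'_def)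
  qed
  define f' where "f' = f - D (Suc N) g1"
  have f'P: "f' \<in> Pc (Suc N) A q"
    unfolding f'_def using Suc.prems g1 by (intro Pc_diff D_Pc) auto
  have f'a: "f' T = a' T" if T: "T \<subseteq> {..<N}" for T
  proof -
    have "D N g1 T = 0"
      unfolding D_def using T by (auto simp: g1_def intro!: sum.neutral)
    moreover have "g1 (insert N T) = b T"
    proof -
      have "insert N T - {N} = T" "insert N T \<subseteq> {..<Suc N}" using T by auto
      then show ?thesis by (simp add: g1_def del: insert_subset)
    qed
    ultimately show ?thesis using T ab_eq[OF T] by (simp add: f'_def D_Suc a'_def)
  qed
  have Df': "D (Suc N) f' \<in> Oc (Suc N) A B (q - 1)"
    using Suc.prems(4) by (simp add: f'_def D_diff)
  have Da': "supp (D N a' T + F N * f' (insert N T)) \<subseteq> Up B" if T: "T \<subseteq> {..<N}" for T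
  proof -
    have "D N f' T = D N a' T"
      unfolding D_def using T by (auto simp: f'a intro!: sum.cong)
    then have "D N a' T + F N * f' (insert N T) = D (Suc N) f' T" using D_Suc[OF T, of f'] by simp
    moreover have "supp (D (Suc N) f' T) \<subseteq> Up B" using Df' by (simp add: Oc_def)
    ultimately show ?thesis by simp
  qed
  \<comment> \<open>The boundary of a' involves only polynomials before F N, which do not contain
    U_(N,\<sigma>); this is the freeness that the cancellation lemma asks for.\<close>
  have y: "supp (f' (insert N T)) \<subseteq> Up B" if T: "T \<subseteq> {..<N}" for T
  proof (rule F_cancel_mod_Up[OF Da'[OF T] \<sigma>])
    show "lkp \<sigma> v = 0" if "v \<in> B" for v using that \<sigma>0 by blast
    fix x assume x: "x \<in> supp (D N a' T)"
    have "supp (D N a' T) \<subseteq> {x. lkp (snd x) (N, \<sigma>) = 0}"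
    proof (rule D_supp)
      fix i \<alpha> y assume i: "i \<in> {..<N} - T" and "y \<in> supp (a' (insert i T))"
      then have "lkp (snd y) (N, \<sigma>) = 0" using ab_free[of "insert i T"] T by (auto simp: a'_def)
      then show "fmon i \<alpha> + y \<in> {x. lkp (snd x) (N, \<sigma>) = 0}"
        using i by (auto simp: fmon_def lookup_add lookup_single)
    qed
    with x show "lkp (snd x) (N, \<sigma>) = 0" by blast
  qed
  have "supp (D N a' T) \<subseteq> Up B" for T
  proof (cases "T \<subseteq> {..<N}")
    case True
    have "supp (F N * f' (insert N T)) \<subseteq> Up B"
      using y[OF True] supp_F[of _ N] Up_shift by (intro supp_multI) blast
    from supp_diffI[OF Da'[OF True] this] show ?thesis by simp
  qed (simp add: D_def)
  then have "D N a' \<in> Oc N A B (q - 1)"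
    using D_Pc'[OF a'] Suc.prems(1) by (simp add: Oc_def)
  from Suc.IH[OF Suc_leD[OF Suc.prems(1)] Suc.prems(2) a' this] obtain g0 where
    g0: "g0 \<in> Pc N A (Suc q)" "a' - D N g0 \<in> Oc N A B q" by blast
  have g0': "g0 \<in> Pc (Suc N) A (Suc q)"
    using g0(1) by (fastforce simp: Pc_def)
  have g0N: "g0 T = 0" if "N \<in> T" for T
    using Pc_card[OF g0(1), of T] that by blast
  have "f' - D (Suc N) g0 \<in> Oc (Suc N) A B q"
    unfolding Oc_def
  proof (intro CollectI conjI allI)
    show "f' - D (Suc N) g0 \<in> Pc (Suc N) A q"
      using f'P g0' Suc.prems(1) by (intro Pc_diff D_Pc) auto
    fix T
    have "T \<subseteq> {..<N} \<or> N \<in> T \<and> T \<subseteq> {..<Suc N} \<or> \<not> T \<subseteq> {..<Suc N}"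
      by (force simp: less_Suc_eq)
    then consider "T \<subseteq> {..<N}" | "N \<in> T" "T \<subseteq> {..<Suc N}" | "\<not> T \<subseteq> {..<Suc N}"
      by blast
    then show "supp ((f' - D (Suc N) g0) T) \<subseteq> Up B"
    proof cases
      case 1
      have "(f' - D (Suc N) g0) T = (a' - D N g0) T"
        by (simp add: f'a[OF 1] D_Suc[OF 1] g0N)
      then show ?thesis using g0(2) by (simp add: Oc_def)
    next
      case 2
      have "D (Suc N) g0 T = 0"
        unfolding D_def using 2 by (auto simp: g0N intro!: sum.neutral)
      moreover have "T - {N} \<subseteq> {..<N}" "insert N (T - {N}) = T" using 2 by auto
      ultimately show ?thesis using y[of "T - {N}"] by simp
    next
      case 3
      then have "f' T = 0" using Pc_card[OF f'P] by blast
      then show ?thesis using 3 by (simp add: D_def)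
    qed
  qed
  moreover have "f' - D (Suc N) g0 = f - D (Suc N) (g1 + g0)"
    by (simp add: f'_def D_add)
  ultimately have "f - D (Suc N) (g1 + g0) \<in> Oc (Suc N) A B q" by (simp only:)
  with Pc_add[OF g1 g0'] show ?case by blast
qed

end

context multigraded begin

subsection \<open>Exact sequences\<close>

text \<open>\<open>\<P> A\<close> consists of the chains that are polynomial in the variables of \<open>A\<close> and Laurent
  polynomial in the others; \<open>\<O> A B\<close> is the subcomplex spanned by the monomials in which some
  variable of \<open>B\<close> has a nonnegative exponent. So \<open>cyc\<close> and \<open>bnd\<close> are the cycles and boundaries of
  the quotient complex \<open>\<P> A / \<O> A B\<close>, whose coefficients are a local cohomology module when
  \<open>A \<union> B\<close> is everything.\<close>

abbreviation \<P> :: "(nat \<times> nat) set \<Rightarrow> nat \<Rightarrow> 'k::comm_ring_1 chain set" where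
  "\<P> \<equiv> Pc (Suc n)"

abbreviation \<O> :: "(nat \<times> nat) set \<Rightarrow> (nat \<times> nat) set \<Rightarrow> nat \<Rightarrow> 'k::comm_ring_1 chain set" where
  "\<O> \<equiv> Oc (Suc n)"

abbreviation bd :: "'k::comm_ring_1 chain \<Rightarrow> 'k chain" where
  "bd \<equiv> D (Suc n)"

definition cyc :: "(nat \<times> nat) set \<Rightarrow> (nat \<times> nat) set \<Rightarrow> nat \<Rightarrow> 'k::comm_ring_1 chain \<Rightarrow> bool" where
  "cyc A B q f \<longleftrightarrow> f \<in> \<P> A q \<and> bd f \<in> \<O> A B (q - 1)"

definition bnd :: "(nat \<times> nat) set \<Rightarrow> (nat \<times> nat) set \<Rightarrow> nat \<Rightarrow> 'k::comm_ring_1 chain \<Rightarrow> bool" where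
  "bnd A B q f \<longleftrightarrow> f \<in> \<P> A q \<and> (\<exists>g\<in>\<P> A (Suc q). f - bd g \<in> \<O> A B q)"

lemmas d_P = D_Pc[OF _ order_refl] and d_O = D_Oc[OF _ order_refl]

lemma cyc_mono: "A \<subseteq> A' \<Longrightarrow> B' \<subseteq> B \<Longrightarrow> cyc A' B' q f \<Longrightarrow> cyc A B q f"
  unfolding cyc_def by (simp only: Pc_mono[of A A'] Oc_mono[of A A' B' B])

lemma bnd_mono: "A \<subseteq> A' \<Longrightarrow> B' \<subseteq> B \<Longrightarrow> bnd A' B' q f \<Longrightarrow> bnd A B q f"
  unfolding bnd_def using Pc_mono[of A A' f] Pc_mono[of A A' _ "Suc n" "Suc q"] Oc_mono[of A A' B' B _ "Suc n" q]
  by blast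

lemma cyc_diff: "cyc A B q f \<Longrightarrow> cyc A B q g \<Longrightarrow> cyc A B q (f - g)"
  unfolding cyc_def by (simp only: D_diff Pc_diff Oc_diff simp_thms)

lemma O_bnd:
  assumes "f \<in> \<O> A B q" shows "bnd A B q f"
  unfolding bnd_def
proof (intro conjI bexI)
  show "f - bd 0 \<in> \<O> A B q" using assms by (simp only: D_zero diff_zero)
qed (use assms Oc_Pc in auto)

text \<open>Splitting by the sign of the exponent of v. With \<open>P_insert_O\<close> this is the
  exactness of the sequence of quotient complexes for (\<open>insert v A\<close>, B), (A, B) and (A,
  \<open>insert v B\<close>).\<close>

lemma O_insert_split:
  assumes f: "f \<in> \<O> A (insert v B) q"
  obtains f1 f2 where "f = f1 + f2" "f1 \<in> \<P> (insert v A) q" "f2 \<in> \<O> A B q"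
proof
  let ?f1 = "\<lambda>T. flt (Up {v}) (f T)" and ?f2 = "\<lambda>T. flt (- Up {v}) (f T)"
  show "f = ?f1 + ?f2" using flt_compl by (intro ext) simp
  have nz: "f T \<noteq> 0" if "flt S (f T) \<noteq> 0" for S T using that by auto
  have up: "Up (insert v B) = Up {v} \<union> Up B" for B by (auto simp: Up_def)
  have fT: "supp (f T) \<subseteq> Reg A T" "supp (f T) \<subseteq> Up {v} \<union> Up B" for T
    using f up[of B] by (simp_all only: Oc_def Pc_def mem_Collect_eq)
  have "Reg A T \<inter> Up {v} = Reg (insert v A) T" for T
    by (auto simp: Reg_def Up_def)
  then have "supp (?f1 T) \<subseteq> Reg (insert v A) T" "supp (?f2 T) \<subseteq> Reg A T" "supp (?f2 T) \<subseteq> Up B" for T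
    unfolding supp_flt using fT[of T] by blast+
  then show "?f1 \<in> \<P> (insert v A) q" "?f2 \<in> \<O> A B q"
    using nz Pc_card[OF Oc_Pc[OF f]] unfolding Oc_def Pc_def by blast+
qed

lemma P_insert_O: "f \<in> \<P> (insert v A) q \<Longrightarrow> f \<in> \<O> A (insert v B) q"
  using Pc_mono[of A "insert v A" f] by (fastforce simp: Oc_def Pc_def Reg_def Up_def)

lemma O_insert: "f \<in> \<O> A B q \<Longrightarrow> f \<in> \<P> A' q \<Longrightarrow> f \<in> \<O> A' B q"
  by (simp add: Oc_def)

lemma diff_diff_swap: "(f::'a::ab_group_add) - (f - g) = g" by simp

text \<open>If f bounds through g once v is inverted, then g is a cycle of the third complex of the
  exact sequence, and f is its image under the connecting homomorphism. The condition on f - bd g is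
  how this relation is expressed from here on.\<close>

lemma step_cyc:
  assumes "f \<in> \<P> (insert v A) q" "g \<in> \<P> A (Suc q)" "f - bd g \<in> \<O> A B q"
  shows "cyc A (insert v B) (Suc q) g"
proof -
  have "f - (f - bd g) \<in> \<O> A (insert v B) q"
    by (rule Oc_diff[OF P_insert_O[OF assms(1)] Oc_mono[OF order_refl subset_insertI assms(3)]])
  then show ?thesis using assms(2) by (simp only: diff_diff_swap cyc_def diff_Suc_1 simp_thms)
qed

text \<open>The connecting homomorphism is well defined: it sends boundaries to boundaries.\<close>

lemma step_bnd_back:
  assumes f: "f \<in> \<P> (insert v A) q" and h: "h \<in> \<P> A (Suc q)" "f - bd h \<in> \<O> A B q"
    and b: "bnd A (insert v B) (Suc q) h"
  shows "bnd (insert v A) B q f"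
proof -
  obtain k where k: "k \<in> \<P> A (Suc (Suc q))" "h - bd k \<in> \<O> A (insert v B) (Suc q)"
    using b by (auto simp: bnd_def)
  obtain q1 q2 where q12: "h - bd k = q1 + q2" "q1 \<in> \<P> (insert v A) (Suc q)" "q2 \<in> \<O> A B (Suc q)"
    using O_insert_split[OF k(2)] by blast
  have "bd h = bd (h - bd k)" by (simp only: D_diff D_D diff_zero)
  also have "\<dots> = bd q1 + bd q2" by (simp only: q12(1) D_add)
  finally have eq: "f - bd q1 = (f - bd h) + bd q2" by (simp only: algebra_simps)
  have "bd q2 \<in> \<O> A B q" using d_O[OF q12(3)] by simp
  with h(2) have "f - bd q1 \<in> \<O> A B q" unfolding eq by (rule Oc_add)
  moreover have "f - bd q1 \<in> \<P> (insert v A) q" using f d_P[OF q12(2)] by (rule Pc_diff)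
  ultimately show ?thesis using f q12(2) O_insert unfolding bnd_def by blast
qed

text \<open>The connecting homomorphism is defined on every cycle: its image is the part of bd h
  that is polynomial in v.\<close>

lemma step_lift:
  assumes h: "cyc A (insert v B) (Suc q) h"
  obtains f where "cyc (insert v A) B q f" "f - bd h \<in> \<O> A B q"
proof -
  have "bd h \<in> \<O> A (insert v B) q" using h by (simp add: cyc_def)
  then obtain f o' where fo: "bd h = f + o'" "f \<in> \<P> (insert v A) q" "o' \<in> \<O> A B q"
    by (rule O_insert_split)
  have "bd (bd h) = bd f + bd o'" by (simp only: fo(1) D_add)
  then have df: "bd f = 0 - bd o'" by (simp only: D_D eq_diff_eq)
  have "bd f \<in> \<O> A B (q - 1)"
    unfolding df using d_O[OF fo(3)] by (intro Oc_diff Oc_zero)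
  moreover have "bd f \<in> \<P> (insert v A) (q - 1)" using D_Pc'[OF fo(2)] by simp
  ultimately have "cyc (insert v A) B q f" using fo(2) O_insert by (simp add: cyc_def)
  moreover have "f - bd h = 0 - o'" by (simp only: fo(1) diff_diff_add[symmetric] diff_self)
  then have "f - bd h \<in> \<O> A B q" using Oc_diff[OF Oc_zero fo(3)] by (simp only:)
  ultimately show thesis by (rule that)
qed

text \<open>Exactness at the third complex: a class killed by the connecting homomorphism comes from
  the middle complex, up to a chain g polynomial in v, which is zero in the third one.\<close>

lemma step_bnd_fwd:
  assumes b: "bnd (insert v A) B q f" and h: "h \<in> \<P> A (Suc q)" "f - bd h \<in> \<O> A B q"
  obtains g where "g \<in> \<P> (insert v A) (Suc q)" "cyc A B (Suc q) (h - g)"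
proof -
  obtain g where g: "g \<in> \<P> (insert v A) (Suc q)" "f - bd g \<in> \<O> (insert v A) B q"
    using b by (auto simp: bnd_def)
  have "bd (h - g) = (f - bd g) - (f - bd h)" by (simp only: D_diff algebra_simps)
  moreover have "f - bd g \<in> \<O> A B q" using g(2) Oc_mono[of A "insert v A" B B] by blast
  ultimately have "bd (h - g) \<in> \<O> A B q" by (simp only: Oc_diff[OF _ h(2)])
  moreover have "g \<in> \<P> A (Suc q)" using g(1) Pc_mono[of A "insert v A"] by blast
  ultimately have "cyc A B (Suc q) (h - g)" using h(1) by (simp add: cyc_def Pc_diff)
  with g(1) show thesis by (rule that)
qed

subsection \<open>Vanishing\<close>

definition grp :: "nat \<Rightarrow> (nat \<times> nat) set" where
  "grp j = {(j, l) | l. l \<le> ns j}"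

lemma grp_eq: "grp j = Pair j ` {0..ns j}"
  by (auto simp: grp_def)

lemma finite_grp [simp]: "finite (grp j)"
  by (simp add: grp_eq)

lemma card_grp: "card (grp j) = Suc (ns j)"
  by (simp add: grp_eq card_image inj_on_def)

lemma grp_disjoint: "v \<in> grp i \<Longrightarrow> v \<in> grp j \<Longrightarrow> i = j"
  by (auto simp: grp_def)

lemma grp_xvars: "j \<in> {1..r} \<Longrightarrow> grp j \<subseteq> xvars r ns"
  by (auto simp: grp_def xvars_def)

definition secv :: "(nat \<Rightarrow> nat) \<Rightarrow> (nat \<times> nat) set" where
  "secv s = (\<lambda>j. (j, s j)) ` {1..r}"

text \<open>In degree 0 only the cycles that die on every affine chart are considered; these are the
  elements of the saturation.\<close>

definition good :: "(nat \<times> nat) set \<Rightarrow> (nat \<times> nat) set \<Rightarrow> nat \<Rightarrow> 'k::comm_ring_1 chain \<Rightarrow> bool" where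
  "good A B q f \<longleftrightarrow> cyc A B q f \<and>
     (q = 0 \<longrightarrow> (\<forall>s. (\<forall>j\<in>{1..r}. s j \<le> ns j) \<longrightarrow> bnd (xvars r ns - secv s) {} 0 f))"

lemma good_Suc [simp]: "good A B (Suc q) f = cyc A B (Suc q) f"
  by (simp add: good_def)

lemma good_mono: "A \<subseteq> A' \<Longrightarrow> B' \<subseteq> B \<Longrightarrow> good A' B' q f \<Longrightarrow> good A B q f"
  unfolding good_def using cyc_mono[of A A' B' B q f] by blast

text \<open>Each group has a variable s j outside A and B, hence invertible. In positive degree this
  is \<open>koszul_exact\<close>; in degree 0 it is the chart condition in \<open>good\<close>,
  restricted to the smaller set A.\<close>

lemma vanish_covered:
  assumes f: "good A B q f" and cov: "\<forall>j\<in>{1..r}. \<not> grp j \<subseteq> A \<union> B" and A: "A \<subseteq> xvars r ns"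
  shows "bnd A B q f"
proof -
  have "\<exists>l. l \<le> ns j \<and> (j, l) \<notin> A \<union> B" if "j \<in> {1..r}" for j
    using cov that by (auto simp: grp_def)
  then obtain s where s: "\<forall>j\<in>{1..r}. s j \<le> ns j \<and> (j, s j) \<notin> A \<union> B" by metis
  show ?thesis
  proof (cases q)
    case 0
    then have "bnd (xvars r ns - secv s) {} 0 f" using f s by (simp add: good_def)
    moreover have "A \<subseteq> xvars r ns - secv s" using A s by (auto simp: secv_def)
    ultimately show ?thesis using 0 bnd_mono by blast
  next
    case (Suc q')
    then show ?thesis using f koszul_exact[OF s, of "Suc n" q f] by (simp add: cyc_def bnd_def)
  qed
qed

lemma tdeg_eq:
  assumes "T \<subseteq> {..<Suc n}"
  shows "tdeg T j = (\<Sum>i\<in>{..<Suc n} - T. int (d i j)) - (int (ns j) + 1) - int (\<mu> j)"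
proof -
  have "{0..n} = {..<Suc n}" by auto
  moreover have "(\<Sum>i\<in>{..<Suc n} - T. int (d i j)) = (\<Sum>i\<in>{..<Suc n}. int (d i j)) - (\<Sum>i\<in>T. int (d i j))"
    using assms by (intro sum_diff) auto
  ultimately show ?thesis by (simp add: tdeg_def delta_def)
qed

text \<open>An index set T with at most n elements omits some i, so the coefficient at T has degree
  at least d i j - \<mu> j - (n_j + 1) > - (n_j + 1) in group j. The n_j + 1 exponents of the group
  cannot all be negative.\<close>

lemma P_subset_O:
  assumes j: "j \<in> {1..r}" "grp j \<subseteq> B" and q: "q \<le> n" and f: "f \<in> \<P> A q"
  shows "f \<in> \<O> A B q"
proof -
  have "x \<in> Up B" if x: "x \<in> supp (f T)" for x T
  proof (rule ccontr)
    assume "x \<notin> Up B"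
    then have neg: "lkp (fst x) (j, l) \<le> - 1" if "l \<le> ns j" for l
      using j(2) that by (force simp: Up_def grp_def)
    have "f T \<noteq> 0" using x by auto
    then have T: "T \<subseteq> {..<Suc n}" "card T = q" using Pc_card[OF f] by auto
    have "T \<noteq> {..<Suc n}" using T(2) q by auto
    then obtain i where i: "i \<in> {..<Suc n} - T" using T(1) by blast
    have "gdeg (fst x) j \<le> (\<Sum>l=0..ns j. - 1)"
      unfolding gdeg_def using neg by (intro sum_mono) auto
    moreover have "int (d i j) \<le> (\<Sum>i\<in>{..<Suc n} - T. int (d i j))"
      using i by (intro member_le_sum) auto
    moreover have "gdeg (fst x) j = tdeg T j" using Pc_supp[OF f x] j(1) by (simp add: Reg_def)
    moreover have "\<mu> j < d i j" using i by (intro mu_less j(1)) auto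
    ultimately show False by (simp add: tdeg_eq[OF T(1)])
  qed
  with f show ?thesis by (auto simp: Oc_def)
qed

text \<open>Beyond degree n only the full index set could occur. There the degree in group j' is
  negative while all its exponents are nonnegative, so the coefficient is zero.\<close>

lemma P_subset_O':
  assumes j: "j \<in> {1..r}" "grp j \<subseteq> B" and j': "j' \<in> {1..r}" "grp j' \<subseteq> A" and f: "f \<in> \<P> A q"
  shows "f \<in> \<O> A B q"
proof (cases "q \<le> n")
  case True
  with j f P_subset_O show ?thesis by blast
next
  case False
  have "x \<in> Up B" if x: "x \<in> supp (f T)" for x T
  proof -
    have "f T \<noteq> 0" using x by auto
    then have T: "T \<subseteq> {..<Suc n}" "card T = q" using Pc_card[OF f] by auto
    then have "T = {..<Suc n}" using False card_subset_eq[of "{..<Suc n}" T] card_mono[of "{..<Suc n}" T] by auto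
    then have "tdeg T j' < 0" using tdeg_eq[of T j'] by simp
    moreover have "gdeg (fst x) j' = tdeg T j'" using Pc_supp[OF f x] j'(1) by (simp add: Reg_def)
    moreover have "0 \<le> gdeg (fst x) j'"
      unfolding gdeg_def using Pc_supp[OF f x] j'(2) by (intro sum_nonneg) (auto simp: Reg_def grp_def)
    ultimately show ?thesis by simp
  qed
  with f show ?thesis by (auto simp: Oc_def)
qed

text \<open>The groups without an invertible variable.\<close>

definition bad :: "(nat \<times> nat) set \<Rightarrow> (nat \<times> nat) set \<Rightarrow> nat set" where
  "bad A B = {j\<in>{1..r}. grp j \<subseteq> A \<union> B}"

text \<open>In a bad group all variables of A but one may have to be moved, each raising the Koszul
  degree by one, before the remaining one is inverted. This bounds the total rise in the induction
  of \<open>vanish\<close>.\<close>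

definition excess :: "(nat \<times> nat) set \<Rightarrow> (nat \<times> nat) set \<Rightarrow> nat" where
  "excess A B = (\<Sum>j\<in>bad A B. card (grp j \<inter> A) - 1)"

lemma finite_bad [simp]: "finite (bad A B)"
  by (simp add: bad_def)

text \<open>Induction on the number of polynomial variables, with v from a bad group. After
  inverting v the group is no longer bad and f bounds through some g. This g is a cycle one degree
  higher with v moved: either the whole group is then moved and everything is zero by degree, or the
  excess has dropped by one and the induction hypothesis applies.\<close>

lemma vanish:
  fixes f :: "'k::comm_ring_1 chain"
  shows "A \<subseteq> xvars r ns \<Longrightarrow> A \<inter> B = {} \<Longrightarrow> \<forall>j\<in>{1..r}. \<not> grp j \<subseteq> B \<Longrightarrow> good A B q f \<Longrightarrow>
    bad A B = {} \<or> q + excess A B < n \<Longrightarrow> bnd A B q f"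
proof (induction "card A" arbitrary: A B q f rule: less_induct)
  case less
  have finA: "finite A" using less.prems(1) finite_xvars finite_subset by blast
  show ?case
  proof (cases "bad A B = {}")
    case True
    then show ?thesis using vanish_covered[OF less.prems(4) _ less.prems(1)] by (auto simp: bad_def)
  next
    case False
    then obtain j0 where j0: "j0 \<in> bad A B" by blast
    then have j0': "j0 \<in> {1..r}" "grp j0 \<subseteq> A \<union> B" by (auto simp: bad_def)
    then obtain v where v: "v \<in> grp j0" "v \<in> A" using less.prems(3) by blast
    define A' where "A' = A - {v}"
    have A: "A = insert v A'" "v \<notin> A'" using v by (auto simp: A'_def)
    have lt: "card A' < card A" using finA A by simp
    have vB: "v \<notin> B" using v less.prems(2) by blast
    have q: "q + excess A B < n" using less.prems(5) False by blast
    have other: "grp j \<inter> A' = grp j \<inter> A" if "j \<noteq> j0" for j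
      using grp_disjoint[of v j j0] that v(1) by (auto simp: A'_def)
    have bad': "bad A' B = bad A B - {j0}"
    proof (intro equalityI subsetI)
      fix j assume "j \<in> bad A' B"
      then have j: "j \<in> {1..r}" "grp j \<subseteq> A' \<union> B" by (auto simp: bad_def)
      moreover have "j \<noteq> j0" using j(2) v(1) vB A(2) by blast
      ultimately show "j \<in> bad A B - {j0}" using A(1) by (auto simp: bad_def)
    next
      fix j assume "j \<in> bad A B - {j0}"
      then have j: "j \<in> {1..r}" "grp j \<subseteq> A \<union> B" "j \<noteq> j0" by (auto simp: bad_def)
      moreover have "v \<notin> grp j" using grp_disjoint[OF v(1)] j(3) by blast
      ultimately show "j \<in> bad A' B" unfolding bad_def A'_def by blast
    qed
    have exc: "excess A B = (card (grp j0 \<inter> A) - 1) + excess A' B"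
    proof -
      have "(\<Sum>j\<in>bad A B - {j0}. card (grp j \<inter> A) - 1) = (\<Sum>j\<in>bad A B - {j0}. card (grp j \<inter> A') - 1)"
        using other by (intro sum.cong) auto
      then show ?thesis unfolding excess_def bad' by (simp only: sum.remove[OF finite_bad j0])
    qed
    \<comment> \<open>Here v is inverted.\<close>
    have "bnd A' B q f"
    proof (rule less.hyps[OF lt])
      show "good A' B q f" using less.prems(4) good_mono[of A' A B B] A by blast
      show "A' \<subseteq> xvars r ns" "A' \<inter> B = {}" using less.prems(1,2) A by blast+
      show "bad A' B = {} \<or> q + excess A' B < n" using q exc by simp
    qed (rule less.prems(3))
    then obtain g where g: "g \<in> \<P> A' (Suc q)" "f - bd g \<in> \<O> A' B q" by (auto simp: bnd_def)
    have fP: "f \<in> \<P> (insert v A') q" using less.prems(4) A by (simp add: good_def cyc_def)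
    have cg: "cyc A' (insert v B) (Suc q) g" using step_cyc[OF fP g] .
    \<comment> \<open>Here v is moved.\<close>
    have "bnd A' (insert v B) (Suc q) g"
    proof (cases "grp j0 \<inter> A' = {}")
      case True
      then have "grp j0 \<subseteq> insert v B" using j0'(2) A by blast
      from P_subset_O[OF j0'(1) this _ g(1)] q show ?thesis by (intro O_bnd) simp
    next
      case False
      have un: "A' \<union> insert v B = A \<union> B" using A by blast
      then have badN: "bad A' (insert v B) = bad A B" by (simp add: bad_def)
      have "card (grp j0 \<inter> A) = Suc (card (grp j0 \<inter> A'))"
      proof -
        have "grp j0 \<inter> A = insert v (grp j0 \<inter> A')" using A v by blast
        then show ?thesis using A(2) by simp
      qed
      moreover have "card (grp j0 \<inter> A') \<noteq> 0" using False by simp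
      moreover have "excess A' (insert v B) = (card (grp j0 \<inter> A') - 1) + excess A' B"
        unfolding excess_def badN bad' by (rule sum.remove[OF finite_bad j0])
      ultimately have "Suc q + excess A' (insert v B) < n" using exc q by arith
      moreover have "\<not> grp j \<subseteq> insert v B" if j: "j \<in> {1..r}" for j
      proof (cases "j = j0")
        case True
        then obtain w where "w \<in> grp j" "w \<in> A'" using False by blast
        then have "w \<notin> insert v B" using A less.prems(2) by blast
        then show ?thesis using \<open>w \<in> grp j\<close> by blast
      next
        case False
        then have "v \<notin> grp j" using grp_disjoint[OF v(1)] by blast
        then show ?thesis using less.prems(3) j by blast
      qed
      moreover have "A' \<subseteq> xvars r ns" "A' \<inter> insert v B = {}"
        using less.prems(1,2) A by blast+
      ultimately show ?thesis using cg by (intro less.hyps[OF lt]) simp_all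
    qed
    from step_bnd_back[OF fP g this] show ?thesis using A by simp
  qed
qed

end

lemma diff_diff_cancel_left: "f - b - (f - g) = g - b"
  for f :: "'a::ab_group_add"
  by (simp add: algebra_simps)

lemma diff_eq_diff_diff_add: "h - k = (h - g - k) + g"
  for h :: "'a::ab_group_add"
  by (simp add: algebra_simps)

context multigraded begin

subsection \<open>Dimension shifting\<close>

text \<open>\<open>path A B vs q f e\<close> relates \<open>f\<close> to its image \<open>e\<close> under the composition of the connecting
  homomorphisms that move the variables \<open>vs\<close>, one after the other, from the first to the second
  set.\<close>

fun path :: "(nat \<times> nat) set \<Rightarrow> (nat \<times> nat) set \<Rightarrow> (nat \<times> nat) list \<Rightarrow> nat \<Rightarrow>
    'k::comm_ring_1 chain \<Rightarrow> 'k chain \<Rightarrow> bool" where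
  "path A B [] q f e \<longleftrightarrow> f = e"
| "path A B (v # vs) q f e \<longleftrightarrow> (\<exists>h\<in>\<P> (A \<union> set vs) (Suc q). f - bd h \<in> \<O> (A \<union> set vs) B q \<and>
     path A (insert v B) vs (Suc q) h e)"

lemma path_mono: "A' \<subseteq> A \<Longrightarrow> B \<subseteq> B' \<Longrightarrow> path A B vs q f e \<Longrightarrow> path A' B' vs q f e"
proof (induction vs arbitrary: B B' q f)
  case (Cons v vs)
  from Cons.prems(3) obtain h where h: "h \<in> \<P> (A \<union> set vs) (Suc q)" "f - bd h \<in> \<O> (A \<union> set vs) B q"
    "path A (insert v B) vs (Suc q) h e" by auto
  have sub: "A' \<union> set vs \<subseteq> A \<union> set vs" using Cons.prems(1) by blast
  have "path A' (insert v B') vs (Suc q) h e"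
    using Cons.prems h(3) by (intro Cons.IH[of "insert v B" "insert v B'"]) auto
  with Pc_mono[OF sub h(1)] Oc_mono[OF sub Cons.prems(2) h(2)] show ?case
    unfolding path.simps by blast
qed simp

lemma path_diff:
  "path A B vs q f e \<Longrightarrow> path A B vs q f' e' \<Longrightarrow> path A B vs q (f - f') (e - e')"
proof (induction vs arbitrary: B q f f')
  case (Cons v vs)
  from Cons.prems obtain h h' where h: "h \<in> \<P> (A \<union> set vs) (Suc q)" "f - bd h \<in> \<O> (A \<union> set vs) B q"
      "path A (insert v B) vs (Suc q) h e"
    and h': "h' \<in> \<P> (A \<union> set vs) (Suc q)" "f' - bd h' \<in> \<O> (A \<union> set vs) B q"
      "path A (insert v B) vs (Suc q) h' e'" unfolding path.simps by blast
  have eq: "f - f' - bd (h - h') = (f - bd h) - (f' - bd h')" by (simp only: D_diff algebra_simps)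
  have "f - f' - bd (h - h') \<in> \<O> (A \<union> set vs) B q" unfolding eq by (rule Oc_diff[OF h(2) h'(2)])
  with Pc_diff[OF h(1) h'(1)] Cons.IH[OF h(3) h'(3)] show ?case unfolding path.simps by blast
qed simp

text \<open>The starting chain matters only modulo the subcomplex, provided that there is at least
  one step; the empty path is equality of chains.\<close>

lemma path_start:
  assumes vs: "vs \<noteq> []" and p: "path A B vs q f e" and f: "f - f' \<in> \<O> (A \<union> set vs) B q"
  shows "path A B vs q f' e"
proof -
  from vs obtain v us where v: "vs = v # us" by (cases vs) auto
  from p obtain h where h: "h \<in> \<P> (A \<union> set us) (Suc q)" "f - bd h \<in> \<O> (A \<union> set us) B q"
    "path A (insert v B) us (Suc q) h e" unfolding v path.simps by blast
  have "f - f' \<in> \<O> (A \<union> set us) B q"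
    using f Oc_mono[of "A \<union> set us" "A \<union> set vs" B B] v by auto
  from Oc_diff[OF h(2) this] have "f - bd h - (f - f') \<in> \<O> (A \<union> set us) B q" .
  then have "f' - bd h \<in> \<O> (A \<union> set us) B q" by (simp only: diff_diff_cancel_left)
  with h show ?thesis unfolding v path.simps by blast
qed

lemma path_append:
  "path A B (us @ vs) q f e \<longleftrightarrow>
    (\<exists>h. path (A \<union> set vs) B us q f h \<and> path A (B \<union> set us) vs (q + length us) h e)"
proof (induction us arbitrary: B q f)
  case (Cons u us)
  have eq: "A \<union> set (us @ vs) = A \<union> set vs \<union> set us" "insert u B \<union> set us = B \<union> set (u # us)"
    "Suc q + length us = q + length (u # us)" by auto
  show ?case unfolding append_Cons path.simps eq Cons.IH by blast
qed simp

lemma path_cyc: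
  "cyc (A \<union> set vs) B q f \<Longrightarrow> path A B vs q f e \<Longrightarrow> cyc A (B \<union> set vs) (q + length vs) e"
proof (induction vs arbitrary: B q f)
  case (Cons v vs)
  from Cons.prems(2) obtain h where h: "h \<in> \<P> (A \<union> set vs) (Suc q)" "f - bd h \<in> \<O> (A \<union> set vs) B q"
    "path A (insert v B) vs (Suc q) h e" unfolding path.simps by blast
  have "f \<in> \<P> (insert v (A \<union> set vs)) q" using Cons.prems(1) by (simp add: cyc_def)
  from Cons.IH[OF step_cyc[OF this h(1,2)] h(3)] show ?case by simp
qed simp

text \<open>A path read from its end is a composition of connecting homomorphisms, so going
  backwards needs no vanishing.\<close>

lemma path_lift:
  "cyc A (B \<union> set vs) (q + length vs) e \<Longrightarrow> \<exists>f. cyc (A \<union> set vs) B q f \<and> path A B vs q f e"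
proof (induction vs arbitrary: B q)
  case (Cons v vs)
  have eq: "insert v B \<union> set vs = B \<union> set (v # vs)" "Suc q + length vs = q + length (v # vs)"
    "insert v (A \<union> set vs) = A \<union> set (v # vs)" by auto
  from Cons.IH[of "insert v B" "Suc q"] Cons.prems obtain h where
    h: "cyc (A \<union> set vs) (insert v B) (Suc q) h" "path A (insert v B) vs (Suc q) h e"
    unfolding eq by blast
  obtain f where f: "cyc (insert v (A \<union> set vs)) B q f" "f - bd h \<in> \<O> (A \<union> set vs) B q"
    using step_lift[OF h(1)] by blast
  moreover have "h \<in> \<P> (A \<union> set vs) (Suc q)" using h(1) by (simp add: cyc_def)
  ultimately show ?case using h(2) unfolding eq path.simps by blast
qed auto

lemma path_bnd_back:
  "f \<in> \<P> (A \<union> set vs) q \<Longrightarrow> path A B vs q f e \<Longrightarrow> bnd A (B \<union> set vs) (q + length vs) e \<Longrightarrow>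
    bnd (A \<union> set vs) B q f"
proof (induction vs arbitrary: B q f)
  case (Cons v vs)
  have eq: "insert v B \<union> set vs = B \<union> set (v # vs)" "Suc q + length vs = q + length (v # vs)"
    "insert v (A \<union> set vs) = A \<union> set (v # vs)" by auto
  from Cons.prems(2) obtain h where h: "h \<in> \<P> (A \<union> set vs) (Suc q)" "f - bd h \<in> \<O> (A \<union> set vs) B q"
    "path A (insert v B) vs (Suc q) h e" unfolding path.simps by blast
  have "bnd (A \<union> set vs) (insert v B) (Suc q) h"
    using Cons.IH[OF h(1,3)] Cons.prems(3) unfolding eq .
  from step_bnd_back[OF _ h(1,2) this] Cons.prems(1) show ?case unfolding eq by blast
qed simp

text \<open>Going forward needs surjectivity of every connecting homomorphism. The second hypothesis
  is the vanishing of the middle term, where v is inverted, in the degree of the current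
  chain.\<close>

lemma path_total:
  fixes f :: "'k::comm_ring_1 chain"
  assumes "good (A \<union> set vs) B q f"
    and "\<And>us v ws (f :: 'k chain). vs = us @ v # ws \<Longrightarrow>
      good (A \<union> set ws) (B \<union> set us) (q + length us) f \<Longrightarrow> bnd (A \<union> set ws) (B \<union> set us) (q + length us) f"
  shows "\<exists>e. path A B vs q f e"
  using assms
proof (induction vs arbitrary: B q f)
  case (Cons v vs)
  have eq: "insert v (A \<union> set vs) = A \<union> set (v # vs)" by auto
  have fP: "f \<in> \<P> (insert v (A \<union> set vs)) q" using Cons.prems(1) by (simp add: good_def cyc_def)
  have "good (A \<union> set vs) B q f" using Cons.prems(1) by (rule good_mono[rotated 2]) auto
  then have "bnd (A \<union> set vs) B q f" using Cons.prems(2)[of "[]" v vs f] by simp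
  then obtain h where h: "h \<in> \<P> (A \<union> set vs) (Suc q)" "f - bd h \<in> \<O> (A \<union> set vs) B q"
    unfolding bnd_def by blast
  have "\<exists>e. path A (insert v B) vs (Suc q) h e"
  proof (rule Cons.IH)
    show "good (A \<union> set vs) (insert v B) (Suc q) h" using step_cyc[OF fP h] by simp
    fix us w ws and g :: "'k chain"
    assume "vs = us @ w # ws" "good (A \<union> set ws) (insert v B \<union> set us) (Suc q + length us) g"
    then show "bnd (A \<union> set ws) (insert v B \<union> set us) (Suc q + length us) g"
      using Cons.prems(2)[of "v # us" w ws g] by simp
  qed
  with h show ?case unfolding path.simps by blast
next
  case Nil
  show ?case by (rule exI[of _ f]) simp
qed

text \<open>Injectivity of every connecting homomorphism, which needs the vanishing of the middle
  term one degree higher than in \<open>path_total\<close>.\<close>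

lemma path_bnd_fwd:
  fixes f :: "'k::comm_ring_1 chain"
  assumes "bnd (A \<union> set vs) B q f" "path A B vs q f e"
    and "\<And>us v ws (f :: 'k chain). vs = us @ v # ws \<Longrightarrow>
      cyc (A \<union> set ws) (B \<union> set us) (Suc (q + length us)) f \<Longrightarrow>
      bnd (A \<union> set ws) (B \<union> set us) (Suc (q + length us)) f"
  shows "bnd A (B \<union> set vs) (q + length vs) e"
  using assms
proof (induction vs arbitrary: B q f)
  case (Cons v vs)
  have eq: "insert v B \<union> set vs = B \<union> set (v # vs)" "Suc q + length vs = q + length (v # vs)"
    "insert v (A \<union> set vs) = A \<union> set (v # vs)" by auto
  from Cons.prems(2) obtain h where h: "h \<in> \<P> (A \<union> set vs) (Suc q)" "f - bd h \<in> \<O> (A \<union> set vs) B q"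
    "path A (insert v B) vs (Suc q) h e" unfolding path.simps by blast
  obtain g where g: "g \<in> \<P> (insert v (A \<union> set vs)) (Suc q)" "cyc (A \<union> set vs) B (Suc q) (h - g)"
    using step_bnd_fwd[of v "A \<union> set vs" B q f h] h(1,2) Cons.prems(1) unfolding eq by blast
  have "bnd (A \<union> set vs) B (Suc q) (h - g)"
    using Cons.prems(3)[of "[]" v vs] g(2) by simp
  then have "bnd (A \<union> set vs) (insert v B) (Suc q) (h - g)"
    by (rule bnd_mono[OF order_refl subset_insertI])
  then obtain k where k: "k \<in> \<P> (A \<union> set vs) (Suc (Suc q))" "h - g - bd k \<in> \<O> (A \<union> set vs) (insert v B) (Suc q)"
    unfolding bnd_def by blast
  have "h - bd k \<in> \<O> (A \<union> set vs) (insert v B) (Suc q)"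
    by (subst diff_eq_diff_diff_add[of _ _ g]) (rule Oc_add[OF k(2) P_insert_O[OF g(1)]])
  then have "bnd (A \<union> set vs) (insert v B) (Suc q) h" using h(1) k(1) unfolding bnd_def by blast
  then show ?case unfolding eq(1,2)[symmetric]
  proof (rule Cons.IH[OF _ h(3)])
    fix us w ws and g :: "'k chain"
    assume "vs = us @ w # ws" "cyc (A \<union> set ws) (insert v B \<union> set us) (Suc (Suc q + length us)) g"
    then show "bnd (A \<union> set ws) (insert v B \<union> set us) (Suc (Suc q + length us)) g"
      using Cons.prems(3)[of "v # us" w ws g] by simp
  qed
qed simp

subsection \<open>Processing the groups of variables\<close>

definition low :: "nat \<Rightarrow> (nat \<times> nat) set" where
  "low a = (\<Union>j\<in>{1..<a}. grp j)"

definition rest :: "nat \<Rightarrow> (nat \<times> nat) set" where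
  "rest a = (\<Union>j\<in>{a..r}. grp j)"

definition qs :: "nat \<Rightarrow> nat" where
  "qs a = (\<Sum>l=1..<a. ns l)"

definition gvs :: "nat \<Rightarrow> (nat \<times> nat) list" where
  "gvs g = map (Pair g) [0..<ns g]"

lemma length_gvs [simp]: "length (gvs g) = ns g"
  by (simp add: gvs_def)

lemma set_gvs: "grp g = insert (g, ns g) (set (gvs g))"
  by (auto simp: gvs_def grp_def)

lemma gvs_last: "(g, ns g) \<notin> set (gvs g)"
  by (auto simp: gvs_def)

lemma distinct_gvs [simp]: "distinct (gvs g)"
  by (simp add: gvs_def distinct_map inj_on_def)

lemma rest_Suc: "a \<le> r \<Longrightarrow> rest a = grp a \<union> rest (Suc a)"
proof -
  assume "a \<le> r"
  then have "{a..r} = insert a {Suc a..r}" by auto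
  then show ?thesis by (simp add: rest_def)
qed

lemma rest_top [simp]: "rest (Suc r) = {}"
  by (simp add: rest_def)

lemma qs_Suc: "1 \<le> a \<Longrightarrow> qs (Suc a) = qs a + ns a"
  by (simp add: qs_def)

lemma qs_top: "qs (Suc r) = n"
  by (simp add: qs_def total_dim_def atLeastLessThanSuc_atLeastAtMost)

lemma qs_1 [simp]: "qs (Suc 0) = 0"
  by (simp add: qs_def)

text \<open>In the last group all the variables are moved. In the other groups the last variable
  becomes invertible.\<close>

primrec rel :: "nat \<Rightarrow> (nat \<times> nat) set \<Rightarrow> (nat \<times> nat) set \<Rightarrow> 'k::comm_ring_1 chain \<Rightarrow> 'k chain \<Rightarrow> bool" where
  "rel 0 A B f e \<longleftrightarrow> path A B (gvs r @ [(r, ns r)]) (qs r) f e"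
| "rel (Suc k) A B f e \<longleftrightarrow> (\<exists>f'.
     path (insert (r - Suc k, ns (r - Suc k)) (A \<union> rest (r - k))) B (gvs (r - Suc k)) (qs (r - Suc k)) f f' \<and>
     rel k A (B \<union> set (gvs (r - Suc k))) f' e)"

lemma rel_mono: "A' \<subseteq> A \<Longrightarrow> B \<subseteq> B' \<Longrightarrow> rel k A B f e \<Longrightarrow> rel k A' B' f e"
proof (induction k arbitrary: B B' f)
  case 0
  then show ?case using path_mono[of A' A B B'] by simp
next
  case (Suc k)
  define a where "a = r - Suc k"
  from Suc.prems(3) obtain f' where f': "path (insert (a, ns a) (A \<union> rest (r - k))) B (gvs a) (qs a) f f'"
    "rel k A (B \<union> set (gvs a)) f' e" unfolding rel.simps a_def by blast
  have "path (insert (a, ns a) (A' \<union> rest (r - k))) B' (gvs a) (qs a) f f'"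
    using Suc.prems(1) by (intro path_mono[OF _ Suc.prems(2) f'(1)]) blast
  moreover have "rel k A' (B' \<union> set (gvs a)) f' e"
    using Suc.prems by (intro Suc.IH[OF _ _ f'(2)]) blast+
  ultimately show ?case unfolding rel.simps a_def by blast
qed

lemma rel_diff: "rel k A B f e \<Longrightarrow> rel k A B f' e' \<Longrightarrow> rel k A B (f - f') (e - e')"
proof (induction k arbitrary: B f f')
  case 0
  then show ?case unfolding rel.simps by (rule path_diff)
next
  case (Suc k)
  then show ?case unfolding rel.simps using path_diff by blast
qed

text \<open>The situation when the groups before a have been processed: each of them has a variable
  in neither set, that is, an invertible one.\<close>

definition adm :: "nat \<Rightarrow> (nat \<times> nat) set \<Rightarrow> (nat \<times> nat) set \<Rightarrow> bool" where
  "adm a A B \<longleftrightarrow> A \<union> B \<subseteq> low a \<and> A \<inter> B = {} \<and> (\<forall>j\<in>{1..<a}. \<not> grp j \<subseteq> A \<union> B)"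

lemma low_disjoint: "a \<le> j \<Longrightarrow> v \<in> low a \<Longrightarrow> v \<notin> grp j"
  by (auto simp: low_def grp_def)

lemma rest_disjoint: "j < a \<Longrightarrow> v \<in> rest a \<Longrightarrow> v \<notin> grp j"
  by (auto simp: rest_def grp_def)

lemma low_rest_disjoint: "v \<in> low a \<Longrightarrow> v \<notin> rest a"
  by (auto simp: low_def rest_def grp_def)

lemma low_Suc: "1 \<le> a \<Longrightarrow> low (Suc a) = low a \<union> grp a"
  by (auto simp: low_def less_Suc_eq)

lemma low_xvars: "a \<le> Suc r \<Longrightarrow> low a \<subseteq> xvars r ns"
  unfolding low_def by (intro UN_least grp_xvars) simp

lemma rest_xvars: "1 \<le> a \<Longrightarrow> rest a \<subseteq> xvars r ns"
  unfolding rest_def by (intro UN_least grp_xvars) simp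

lemma adm_Suc:
  assumes adm: "adm a A B" and a: "1 \<le> a" and S: "S \<subseteq> grp a" "W \<subseteq> grp a" "S \<inter> W = {}" "S \<union> W \<noteq> grp a"
  shows "adm (Suc a) (A \<union> W) (B \<union> S)"
  unfolding adm_def
proof (intro conjI ballI)
  show "(A \<union> W) \<union> (B \<union> S) \<subseteq> low (Suc a)"
    using adm S low_Suc[OF a] by (auto simp: adm_def)
  have "A \<inter> grp a = {}" "B \<inter> grp a = {}"
    using adm low_disjoint[of a a] by (auto simp: adm_def)
  then show "(A \<union> W) \<inter> (B \<union> S) = {}" using adm S unfolding adm_def by blast
  fix j assume j: "j \<in> {1..<Suc a}"
  show "\<not> grp j \<subseteq> (A \<union> W) \<union> (B \<union> S)"
  proof (cases "j = a")
    case True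
    then show ?thesis using S \<open>A \<inter> grp a = {}\<close> \<open>B \<inter> grp a = {}\<close> by blast
  next
    case False
    then have "grp j \<inter> grp a = {}" using grp_disjoint by blast
    moreover have "\<not> grp j \<subseteq> A \<union> B" using adm j False by (auto simp: adm_def)
    ultimately show ?thesis using S by blast
  qed
qed

text \<open>Exactly the groups after a are bad, and they lie entirely in the polynomial part. Their
  excess is therefore n_(a+1) + ... + n_r = n - \<open>qs (Suc a)\<close>, and there is none if a =
  r.\<close>

lemma vanish_adm:
  assumes adm: "adm (Suc a) A B" and a: "1 \<le> a" "a \<le> r"
    and f: "good (A \<union> rest (Suc a)) B q f" and q: "a = r \<or> q < qs (Suc a)"
  shows "bnd (A \<union> rest (Suc a)) B q f"
proof (rule vanish[OF _ _ _ f])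
  let ?A = "A \<union> rest (Suc a)"
  have AB: "A \<subseteq> low (Suc a)" "B \<subseteq> low (Suc a)" "A \<inter> B = {}" using adm by (auto simp: adm_def)
  show "?A \<subseteq> xvars r ns" using AB low_xvars[of "Suc a"] rest_xvars[of "Suc a"] a by auto
  show "?A \<inter> B = {}" using AB low_rest_disjoint by blast
  have small: "\<not> grp j \<subseteq> ?A \<union> B" if "j \<in> {1..a}" for j
  proof -
    have "\<not> grp j \<subseteq> A \<union> B" using adm that by (auto simp: adm_def)
    moreover have "grp j \<inter> rest (Suc a) = {}" using rest_disjoint[of j "Suc a"] that by auto
    ultimately show ?thesis by blast
  qed
  have big: "grp j \<subseteq> ?A" "grp j \<inter> B = {}" "grp j \<inter> ?A = grp j" if "j \<in> {a<..r}" for j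
  proof -
    show *: "grp j \<subseteq> ?A" using that by (auto simp: rest_def)
    then show "grp j \<inter> ?A = grp j" by blast
    show "grp j \<inter> B = {}" using AB(2) low_disjoint[of "Suc a" j] that by auto
  qed
  show "\<forall>j\<in>{1..r}. \<not> grp j \<subseteq> B"
  proof
    fix j assume j: "j \<in> {1..r}"
    have "grp j \<noteq> {}" by (auto simp: grp_def)
    then show "\<not> grp j \<subseteq> B" using small[of j] big(2)[of j] j by (cases "j \<le> a") auto
  qed
  have bad: "bad ?A B = {a<..r}"
  proof (intro equalityI subsetI)
    fix j assume "j \<in> bad ?A B"
    then show "j \<in> {a<..r}" using small[of j] by (cases "j \<le> a") (auto simp: bad_def)
  next
    fix j assume "j \<in> {a<..r}"
    then show "j \<in> bad ?A B" using big(1)[of j] by (auto simp: bad_def)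
  qed
  have "excess ?A B = (\<Sum>j\<in>{a<..r}. ns j)"
    unfolding excess_def bad by (intro sum.cong refl) (simp add: big card_grp)
  moreover have "n = qs (Suc a) + (\<Sum>j\<in>{a<..r}. ns j)"
  proof -
    have "{1..r} = {1..<Suc a} \<union> {a<..r}" using a by auto
    then show ?thesis unfolding qs_def total_dim_def
      by (simp only:) (rule sum.union_disjoint, auto)
  qed
  ultimately show "bad ?A B = {} \<or> q + excess ?A B < n"
    using q bad by auto
qed

end

section \<open>Existence, lifting and the boundary criterion for the relation
  \<open>rel\<close>\<close>

context multigraded begin

lemma gvs_nonempty: "g \<in> {1..r} \<Longrightarrow> gvs g \<noteq> []"
  using ns_pos[of g] by (simp add: gvs_def)

lemma set_gvs_last: "set (gvs g @ [(g, ns g)]) = grp g"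
  by (simp add: set_gvs)

lemma rest_r: "rest r = grp r"
  using rest_Suc[of r] by simp

lemma rel_start:
  assumes k: "k < r" and p: "rel k A B f e" and f: "f - f' \<in> \<O> (A \<union> rest (r - k)) B (qs (r - k))"
  shows "rel k A B f' e"
proof (cases k)
  case 0
  have "path A B (gvs r @ [(r, ns r)]) (qs r) f' e"
  proof (rule path_start)
    show "path A B (gvs r @ [(r, ns r)]) (qs r) f e" using p 0 by simp
    show "f - f' \<in> \<O> (A \<union> set (gvs r @ [(r, ns r)])) B (qs r)"
      using f 0 unfolding set_gvs_last by (simp only: rest_r diff_zero)
  qed simp
  then show ?thesis using 0 by simp
next
  case (Suc k')
  define a where "a = r - Suc k'"
  have a: "a \<in> {1..r}" "r - k' = Suc a" "r - k = a" using k Suc by (auto simp: a_def)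
  from p obtain g where g: "path (insert (a, ns a) (A \<union> rest (Suc a))) B (gvs a) (qs a) f g"
    "rel k' A (B \<union> set (gvs a)) g e" unfolding Suc rel.simps a_def[symmetric] a(2) by blast
  have eq: "insert (a, ns a) (A \<union> rest (Suc a)) \<union> set (gvs a) = A \<union> rest a"
    using a(1) rest_Suc[of a] set_gvs[of a] by auto
  have "path (insert (a, ns a) (A \<union> rest (Suc a))) B (gvs a) (qs a) f' g"
    using f unfolding a(3) by (intro path_start[OF gvs_nonempty[OF a(1)] g(1)]) (simp only: eq)
  with g(2) show ?thesis unfolding Suc rel.simps a_def[symmetric] a(2) by blast
qed

lemma adm_gvs:
  assumes "adm a A B" "1 \<le> a"
  shows "adm (Suc a) A (B \<union> set (gvs a))"
proof -
  have "adm (Suc a) (A \<union> {}) (B \<union> set (gvs a))"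
    using set_gvs[of a] gvs_last[of a] by (intro adm_Suc[OF assms]) auto
  then show ?thesis by simp
qed

text \<open>The variable v being moved is in neither set, so even the last group has an invertible
  variable. No group is bad, and vanishing holds in every degree.\<close>

lemma rel_0_vanish:
  assumes adm: "adm r A B" and vs: "gvs r @ [(r, ns r)] = us @ v # ws"
    and f: "good (A \<union> set ws) (B \<union> set us) q f"
  shows "bnd (A \<union> set ws) (B \<union> set us) q f"
proof -
  have dist: "distinct (us @ v # ws)" unfolding vs[symmetric] using gvs_last by simp
  have set: "set us \<union> insert v (set ws) = grp r"
    using arg_cong[OF vs, of set] unfolding set_gvs_last by simp
  have "adm (Suc r) (A \<union> set ws) (B \<union> set us)"
    using r_pos dist set by (intro adm_Suc[OF adm]) auto
  from vanish_adm[OF this r_pos order_refl] f show ?thesis by simp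
qed

text \<open>The later groups are still bad, which limits the degree. The bound suffices for
  existence at every move, but misses by one what injectivity of the last move of the group would
  need; \<open>rel_bnd\<close> deals with that move separately.\<close>

lemma rel_Suc_vanish:
  assumes adm: "adm a A B" and a: "1 \<le> a" "a < r" and vs: "gvs a = us @ v # ws"
    and f: "good (insert (a, ns a) (A \<union> rest (Suc a)) \<union> set ws) (B \<union> set us) q f"
    and q: "q < qs (Suc a)"
  shows "bnd (insert (a, ns a) (A \<union> rest (Suc a)) \<union> set ws) (B \<union> set us) q f"
proof -
  have dist: "distinct (us @ v # ws)" unfolding vs[symmetric] by simp
  have set: "set us \<union> insert v (set ws) = set (gvs a)" unfolding vs by simp
  have admW: "adm (Suc a) (A \<union> insert (a, ns a) (set ws)) (B \<union> set us)"
  proof (intro adm_Suc[OF adm a(1)])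
    have "v \<in> grp a" "v \<notin> set us \<union> insert (a, ns a) (set ws)"
      using dist set set_gvs[of a] gvs_last[of a] by auto
    then show "set us \<union> insert (a, ns a) (set ws) \<noteq> grp a" by blast
  qed (use dist set set_gvs[of a] gvs_last[of a] in auto)
  have eq: "insert (a, ns a) (A \<union> rest (Suc a)) \<union> set ws =
      (A \<union> insert (a, ns a) (set ws)) \<union> rest (Suc a)" by auto
  show ?thesis using f q a unfolding eq by (intro vanish_adm[OF admW]) simp_all
qed

lemma rel_cyc_step:
  assumes a: "a \<in> {1..r}" and f: "cyc (A \<union> rest a) B (qs a) f"
    and p: "path (insert (a, ns a) (A \<union> rest (Suc a))) B (gvs a) (qs a) f g"
  shows "cyc (insert (a, ns a) (A \<union> rest (Suc a))) (B \<union> set (gvs a)) (qs (Suc a)) g"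
proof -
  have "insert (a, ns a) (A \<union> rest (Suc a)) \<union> set (gvs a) = A \<union> rest a"
    using a rest_Suc[of a] set_gvs[of a] by auto
  with f have "cyc (insert (a, ns a) (A \<union> rest (Suc a)) \<union> set (gvs a)) B (qs a) f" by simp
  from path_cyc[OF this p] show ?thesis using a qs_Suc[of a] by simp
qed

lemma rel_P:
  "k < r \<Longrightarrow> cyc (A \<union> rest (r - k)) B (qs (r - k)) f \<Longrightarrow> rel k A B f e \<Longrightarrow> e \<in> \<P> A (Suc n)"
proof (induction k arbitrary: B f)
  case 0
  have "qs r + length (gvs r @ [(r, ns r)]) = Suc n"
    using qs_Suc[OF r_pos] qs_top by simp
  moreover have "cyc (A \<union> set (gvs r @ [(r, ns r)])) B (qs r) f"
    unfolding set_gvs_last using 0 rest_r by simp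
  ultimately show ?case
    using path_cyc[of A "gvs r @ [(r, ns r)]" B "qs r" f e] 0 by (simp add: cyc_def)
next
  case (Suc k)
  define a where "a = r - Suc k"
  have a: "a \<in> {1..r}" "r - k = Suc a" using Suc.prems by (auto simp: a_def)
  from Suc.prems(3) obtain g where g: "path (insert (a, ns a) (A \<union> rest (Suc a))) B (gvs a) (qs a) f g"
    "rel k A (B \<union> set (gvs a)) g e" unfolding rel.simps a_def[symmetric] a(2) by blast
  have "cyc (A \<union> rest (Suc a)) (B \<union> set (gvs a)) (qs (Suc a)) g"
    using Suc.prems(2) unfolding a_def[symmetric]
    by (intro cyc_mono[OF _ order_refl rel_cyc_step[OF a(1) _ g(1)]]) auto
  from Suc.IH[OF _ _ g(2)] this Suc.prems(1) show ?case by (simp add: a(2))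
qed

lemma rel_total:
  fixes f :: "'k::comm_ring_1 chain"
  shows "k < r \<Longrightarrow> adm (r - k) A B \<Longrightarrow> good (A \<union> rest (r - k)) B (qs (r - k)) f \<Longrightarrow> \<exists>e. rel k A B f e"
proof (induction k arbitrary: B f)
  case 0
  have "\<exists>e. path A B (gvs r @ [(r, ns r)]) (qs r) f e"
  proof (rule path_total)
    show "good (A \<union> set (gvs r @ [(r, ns r)])) B (qs r) f"
      unfolding set_gvs_last using 0 rest_r by simp
    have "adm r A B" using 0 by simp
    then show "bnd (A \<union> set ws) (B \<union> set us) (qs r + length us) g"
      if "gvs r @ [(r, ns r)] = us @ v # ws" "good (A \<union> set ws) (B \<union> set us) (qs r + length us) g"
      for us v ws and g :: "'k chain" using that by (rule rel_0_vanish)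
  qed
  then show ?case by simp
next
  case (Suc k)
  define a where "a = r - Suc k"
  have a: "a \<in> {1..r}" "r - k = Suc a" "1 \<le> a" "a < r" using Suc.prems by (auto simp: a_def)
  have adm: "adm a A B" using Suc.prems(2) by (simp add: a_def)
  have f: "good (A \<union> rest a) B (qs a) f" using Suc.prems(3) by (simp add: a_def)
  have eq: "insert (a, ns a) (A \<union> rest (Suc a)) \<union> set (gvs a) = A \<union> rest a"
    using a(1) rest_Suc[of a] set_gvs[of a] by auto
  have "\<exists>g. path (insert (a, ns a) (A \<union> rest (Suc a))) B (gvs a) (qs a) f g"
  proof (rule path_total)
    show "good (insert (a, ns a) (A \<union> rest (Suc a)) \<union> set (gvs a)) B (qs a) f"
      unfolding eq by (rule f)
    fix us v ws and g :: "'k chain"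
    assume vs: "gvs a = us @ v # ws"
      and g: "good (insert (a, ns a) (A \<union> rest (Suc a)) \<union> set ws) (B \<union> set us) (qs a + length us) g"
    have "length us < ns a" using arg_cong[OF vs, of length] by simp
    then show "bnd (insert (a, ns a) (A \<union> rest (Suc a)) \<union> set ws) (B \<union> set us) (qs a + length us) g"
      using qs_Suc[OF a(3)] by (intro rel_Suc_vanish[OF adm a(3,4) vs g]) simp
  qed
  then obtain g where g: "path (insert (a, ns a) (A \<union> rest (Suc a))) B (gvs a) (qs a) f g" by blast
  have "cyc (insert (a, ns a) (A \<union> rest (Suc a))) (B \<union> set (gvs a)) (qs (Suc a)) g"
    using f by (intro rel_cyc_step[OF a(1) _ g]) (simp add: good_def)
  then have "cyc (A \<union> rest (Suc a)) (B \<union> set (gvs a)) (qs (Suc a)) g"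
    by (rule cyc_mono[OF _ order_refl, rotated]) auto
  \<comment> \<open>In positive degree \<open>good\<close> asks for nothing beyond a cycle, so the
    chart condition is used only for the first group.\<close>
  moreover have "qs (Suc a) \<noteq> 0" using qs_Suc[OF a(3)] ns_pos[OF a(1)] by simp
  ultimately have "good (A \<union> rest (Suc a)) (B \<union> set (gvs a)) (qs (Suc a)) g"
    by (simp add: good_def)
  from Suc.IH[of "B \<union> set (gvs a)" g] this adm_gvs[OF adm a(3)] Suc.prems(1)
  obtain e where "rel k A (B \<union> set (gvs a)) g e" unfolding a(2) by auto
  with g show ?case unfolding rel.simps a_def[symmetric] a(2) by blast
qed

text \<open>When all variables of group a except w are moved and group a + 1 is still polynomial,
  inverting w changes nothing: the third complex of the corresponding sequence is zero by
  degree.\<close>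

lemma insert_split:
  assumes a: "1 \<le> a" "a < r" and B: "grp a \<subseteq> insert w B" and A: "rest (Suc a) \<subseteq> A" and f: "f \<in> \<P> A q"
  obtains f1 f2 where "f = f1 + f2" "f1 \<in> \<P> (insert w A) q" "f2 \<in> \<O> A B q"
proof -
  have "grp (Suc a) \<subseteq> A" using A a rest_Suc[of "Suc a"] by auto
  then have "f \<in> \<O> A (insert w B) q" using P_subset_O'[of a _ "Suc a"] a B f by auto
  then show thesis using O_insert_split that by blast
qed

text \<open>Connecting homomorphisms are followed from the end to the start. Between two groups the
  chain, which allows negative powers of the inverted variable, is replaced by one polynomial in it
  with the help of \<open>insert_split\<close>; \<open>rel_start\<close> permits the change.\<close>

lemma rel_lift:
  fixes e :: "'k::comm_ring_1 chain"
  shows "k < r \<Longrightarrow> adm (r - k) A B \<Longrightarrow> e \<in> \<P> A (Suc n) \<Longrightarrow>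
    \<exists>f. cyc (A \<union> rest (r - k)) B (qs (r - k)) f \<and> rel k A B f e"
proof (induction k arbitrary: B)
  case 0
  have q: "qs r + length (gvs r @ [(r, ns r)]) = Suc n"
    using qs_Suc[OF r_pos] qs_top by simp
  \<comment> \<open>In degree n everything is zero modulo a whole moved group, so every top chain is
    a cycle.\<close>
  have "bd e \<in> \<O> A (B \<union> grp r) n"
    using r_pos d_P[OF 0(3)] by (intro P_subset_O[of r]) auto
  then have "cyc A (B \<union> set (gvs r @ [(r, ns r)])) (qs r + length (gvs r @ [(r, ns r)])) e"
    unfolding q set_gvs_last cyc_def using 0(3) by simp
  from path_lift[OF this] show ?case unfolding set_gvs_last using rest_r by simp
next
  case (Suc k)
  define a where "a = r - Suc k"
  have a: "a \<in> {1..r}" "r - k = Suc a" "1 \<le> a" "a < r" using Suc.prems by (auto simp: a_def)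
  have adm: "adm a A B" using Suc.prems(2) by (simp add: a_def)
  define B' where "B' = B \<union> set (gvs a)"
  from Suc.IH[of B'] Suc.prems(1,3) adm_gvs[OF adm a(3)] obtain f' where
    f': "cyc (A \<union> rest (Suc a)) B' (qs (Suc a)) f'" "rel k A B' f' e" unfolding a(2) B'_def by auto
  have "grp a \<subseteq> insert (a, ns a) B'" using set_gvs[of a] by (auto simp: B'_def)
  then obtain f1 f2 where f12: "f' = f1 + f2" "f1 \<in> \<P> (insert (a, ns a) (A \<union> rest (Suc a))) (qs (Suc a))"
    "f2 \<in> \<O> (A \<union> rest (Suc a)) B' (qs (Suc a))"
    using insert_split[OF a(3,4), of "(a, ns a)" B' "A \<union> rest (Suc a)" f'] f'(1) unfolding cyc_def by blast
  have "rel k A B' f1 e"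
    using f12(1,3) Suc.prems(1) by (intro rel_start[OF _ f'(2)]) (auto simp: a(2))
  have "bd f' = bd f1 + bd f2" by (simp only: f12(1) D_add)
  then have eq: "bd f1 = bd f' - bd f2" by (simp only: eq_diff_eq)
  have "bd f1 \<in> \<O> (A \<union> rest (Suc a)) B' (qs (Suc a) - 1)"
    unfolding eq using f'(1) d_O[OF f12(3)] unfolding cyc_def by (intro Oc_diff) blast+
  from O_insert[OF this D_Pc'[OF f12(2)]]
  have "cyc (insert (a, ns a) (A \<union> rest (Suc a))) (B \<union> set (gvs a)) (qs a + length (gvs a)) f1"
    using f12(2) qs_Suc[OF a(3)] unfolding cyc_def B'_def by simp
  from path_lift[OF this] obtain f where
    f: "cyc (insert (a, ns a) (A \<union> rest (Suc a)) \<union> set (gvs a)) B (qs a) f"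
    "path (insert (a, ns a) (A \<union> rest (Suc a))) B (gvs a) (qs a) f f1" by blast
  have "insert (a, ns a) (A \<union> rest (Suc a)) \<union> set (gvs a) = A \<union> rest a"
    using a(1) rest_Suc[of a] set_gvs[of a] by auto
  with f \<open>rel k A B' f1 e\<close> show ?case
    unfolding rel.simps a_def[symmetric] a(2) B'_def by auto
qed

text \<open>There are no chains in degree n + 2.\<close>

lemma bnd_cyc_top:
  assumes "bnd A B (Suc n) e" shows "e \<in> \<O> A B (Suc n)"
proof -
  obtain g where g: "g \<in> \<P> A (Suc (Suc n))" "e - bd g \<in> \<O> A B (Suc n)"
    using assms by (auto simp: bnd_def)
  have "g T = 0" for T
  proof (rule ccontr)
    assume "g T \<noteq> 0"
    from Pc_card[OF g(1) this] card_mono[of "{..<Suc n}" T] show False by simp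
  qed
  then have "g = 0" by auto
  with g(2) show ?thesis by (simp only: D_zero diff_zero)
qed

text \<open>Induction over the groups. In group a all moves but the last lose nothing, by vanishing.
  At the last move, of v, the middle term belongs to the pair (\<open>insert w A\<close>,
  \<open>Bm\<close>), where w is the variable to be inverted. This is again a situation for
  \<open>rel\<close>, and by \<open>rel_total\<close> and \<open>rel_lift\<close> the cycles of the
  middle term correspond to top chains polynomial in w. So f bounds iff e satisfies the induction
  hypothesis up to such a chain, which is what adding w to the second set expresses.\<close>

lemma rel_bnd:
  fixes f :: "'k::comm_ring_1 chain"
  shows "k < r \<Longrightarrow> adm (r - k) A B \<Longrightarrow> cyc (A \<union> rest (r - k)) B (qs (r - k)) f \<Longrightarrow> rel k A B f e \<Longrightarrow>
    bnd (A \<union> rest (r - k)) B (qs (r - k)) f \<longleftrightarrow> e \<in> \<O> A (B \<union> rest (r - k)) (Suc n)"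
proof (induction k arbitrary: A B f e)
  case 0
  let ?vs = "gvs r @ [(r, ns r)]"
  have q: "qs r + length ?vs = Suc n"
    using qs_Suc[OF r_pos] qs_top by simp
  have fe: "path A B ?vs (qs r) f e" using 0(4) by simp
  have fc: "cyc (A \<union> set ?vs) B (qs r) f" using 0(3) unfolding set_gvs_last by (simp add: rest_r)
  have adm: "adm r A B" using 0(2) by simp
  have "bnd (A \<union> set ?vs) B (qs r) f \<longleftrightarrow> e \<in> \<O> A (B \<union> set ?vs) (Suc n)"
  proof
    assume b: "bnd (A \<union> set ?vs) B (qs r) f"
    have "bnd A (B \<union> set ?vs) (qs r + length ?vs) e"
    proof (rule path_bnd_fwd[OF b fe])
      fix us v ws and g :: "'k chain"
      assume "?vs = us @ v # ws" "cyc (A \<union> set ws) (B \<union> set us) (Suc (qs r + length us)) g"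
      then show "bnd (A \<union> set ws) (B \<union> set us) (Suc (qs r + length us)) g"
        by (intro rel_0_vanish[OF adm]) simp_all
    qed
    then show "e \<in> \<O> A (B \<union> set ?vs) (Suc n)" unfolding q by (rule bnd_cyc_top)
  next
    assume "e \<in> \<O> A (B \<union> set ?vs) (Suc n)"
    then have "bnd A (B \<union> set ?vs) (qs r + length ?vs) e" unfolding q by (rule O_bnd)
    with fe fc show "bnd (A \<union> set ?vs) B (qs r) f"
      unfolding cyc_def by (intro path_bnd_back) blast+
  qed
  then show ?case unfolding set_gvs_last by (simp add: rest_r)
next
  case (Suc k)
  define a where "a = r - Suc k"
  have a: "a \<in> {1..r}" "r - k = Suc a" "1 \<le> a" "a < r" using Suc.prems by (auto simp: a_def)
  have adm: "adm a A B" using Suc.prems(2) by (simp add: a_def)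
  define w where "w = (a, ns a)"
  define X where "X = insert w (A \<union> rest (Suc a))"
  obtain vl v where vl: "gvs a = vl @ [v]"
    using gvs_nonempty[OF a(1)] by (metis append_butlast_last_id)
  have lvl: "ns a = Suc (length vl)" using arg_cong[OF vl, of length] by simp
  define q1 where "q1 = qs a + length vl"
  have q1: "qs (Suc a) = Suc q1" using qs_Suc[OF a(3)] lvl by (simp add: q1_def)
  define Bm B' where "Bm = B \<union> set vl" and "B' = B \<union> set (gvs a)"
  have B': "B' = insert v Bm" by (simp add: B'_def Bm_def vl)
  have grp_a: "grp a = insert w (insert v (set vl))" using set_gvs[of a] by (simp add: vl w_def)
  have dist: "w \<notin> insert v (set vl)" "v \<notin> set vl"
    using gvs_last[of a] distinct_gvs[of a] by (auto simp: vl w_def)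
  have Xvl: "insert v X \<union> set vl = A \<union> rest a" "X = insert w A \<union> rest (Suc a)" "A \<union> rest (Suc a) \<subseteq> X"
    using rest_Suc[of a] a(4) grp_a by (auto simp: X_def)
  have admB': "adm (Suc a) A B'" unfolding B'_def by (rule adm_gvs[OF adm a(3)])
  have admBm: "adm (Suc a) (insert w A) Bm"
  proof -
    have "adm (Suc a) (A \<union> {w}) (B \<union> set vl)"
      using dist grp_a by (intro adm_Suc[OF adm a(3)]) auto
    then show ?thesis by (simp add: Bm_def)
  qed
  have fc: "cyc (insert v X \<union> set vl) B (qs a) f" using Suc.prems(3) unfolding Xvl(1) a_def .
  from Suc.prems(4) obtain f' where p: "path X B (gvs a) (qs a) f f'" and f'e: "rel k A B' f' e"
    unfolding rel.simps a_def[symmetric] a(2) B'_def X_def w_def by blast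
  from p obtain h0 where h0: "path (insert v X) B vl (qs a) f h0" and p': "path X Bm [v] q1 h0 f'"
    unfolding vl path_append Bm_def q1_def by auto
  have f': "f' \<in> \<P> X (Suc q1)" "h0 - bd f' \<in> \<O> X Bm q1" using p' by auto
  have h0c: "cyc (insert v X) Bm q1 h0"
    using path_cyc[OF fc h0] by (simp only: Bm_def q1_def)
  have h0P: "h0 \<in> \<P> (insert v X) q1" using h0c by (simp add: cyc_def)
  have f'c: "cyc X B' (Suc q1) f'" unfolding B' by (rule step_cyc[OF h0P f'])
  have f'c': "cyc (A \<union> rest (Suc a)) B' (Suc q1) f'" by (rule cyc_mono[OF Xvl(3) order_refl f'c])
  have kr: "k < r" using Suc.prems(1) by simp
  have sub: "A \<subseteq> insert w A" "Bm \<subseteq> B'" unfolding B' by auto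
  have IH: "cyc (A \<union> rest (Suc a)) B' (Suc q1) y \<Longrightarrow> rel k A B' y z \<Longrightarrow>
      bnd (A \<union> rest (Suc a)) B' (Suc q1) y \<longleftrightarrow> z \<in> \<O> A (B' \<union> rest (Suc a)) (Suc n)" for y z :: "'k chain"
    using Suc.IH[OF kr, of A B' y z] admB' unfolding a(2) q1 by blast
  have end_eq: "B \<union> rest a = insert w (B' \<union> rest (Suc a))"
    using rest_Suc[of a] a(4) grp_a unfolding B' Bm_def by auto
  have wB': "grp a \<subseteq> insert w B'" using grp_a unfolding B' Bm_def by auto
  have "bnd (insert v X \<union> set vl) B (qs a) f \<longleftrightarrow> e \<in> \<O> A (insert w (B' \<union> rest (Suc a))) (Suc n)"
  proof
    assume b: "bnd (insert v X \<union> set vl) B (qs a) f"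
    have "bnd (insert v X) (B \<union> set vl) (qs a + length vl) h0"
    proof (rule path_bnd_fwd[OF b h0])
      fix us u ws and g :: "'k chain"
      assume vs: "vl = us @ u # ws" and
        g: "cyc (insert v X \<union> set ws) (B \<union> set us) (Suc (qs a + length us)) g"
      have vs': "gvs a = us @ u # (ws @ [v])" by (simp add: vl vs)
      have eq: "insert v X \<union> set ws = insert (a, ns a) (A \<union> rest (Suc a)) \<union> set (ws @ [v])"
        by (auto simp: X_def w_def)
      show "bnd (insert v X \<union> set ws) (B \<union> set us) (Suc (qs a + length us)) g"
        unfolding eq
      proof (rule rel_Suc_vanish[OF adm a(3,4) vs'])
        show "Suc (qs a + length us) < qs (Suc a)" unfolding q1 q1_def using vs by simp
      qed (use g in \<open>simp only: eq good_Suc\<close>)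
    qed
    then have "bnd (insert v X) Bm q1 h0" by (simp only: Bm_def q1_def)
    from step_bnd_fwd[OF this f'] obtain g where
      g: "g \<in> \<P> (insert v X) (Suc q1)" "cyc X Bm (Suc q1) (f' - g)" by blast
    \<comment> \<open>The difference f' - g comes from the middle term and has an image ek
      polynomial in w; the remaining g is polynomial in v and zero in the complex with v
      moved.\<close>
    have "good (insert w A \<union> rest (r - k)) Bm (qs (r - k)) (f' - g)"
      unfolding a(2) q1 good_Suc Xvl(2)[symmetric] by (rule g(2))
    from rel_total[OF kr _ this] admBm obtain ek where ek: "rel k (insert w A) Bm (f' - g) ek"
      unfolding a(2) by blast
    have ekP: "ek \<in> \<P> (insert w A) (Suc n)"
      using rel_P[OF kr _ ek] g(2) unfolding a(2) q1 Xvl(2)[symmetric] by blast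
    have "rel k A B' (f' - (f' - g)) (e - ek)"
      by (rule rel_diff[OF f'e rel_mono[OF sub ek]])
    then have relg: "rel k A B' g (e - ek)" by (simp only: diff_diff_swap)
    have "g \<in> \<O> X B' (Suc q1)" unfolding B' by (rule P_insert_O[OF g(1)])
    then have gO: "g \<in> \<O> (A \<union> rest (Suc a)) B' (Suc q1)" by (rule Oc_mono[OF Xvl(3) order_refl])
    have "cyc (A \<union> rest (Suc a)) B' (Suc q1) (f' - (f' - g))"
      by (rule cyc_diff[OF f'c' cyc_mono[OF Xvl(3) sub(2) g(2)]])
    then have "cyc (A \<union> rest (Suc a)) B' (Suc q1) g" by (simp only: diff_diff_swap)
    from IH[OF this relg] O_bnd[OF gO] have "e - ek \<in> \<O> A (B' \<union> rest (Suc a)) (Suc n)" by blast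
    then have "e - ek \<in> \<O> A (insert w (B' \<union> rest (Suc a))) (Suc n)"
      by (rule Oc_mono[OF order_refl subset_insertI])
    from Oc_add[OF this P_insert_O[OF ekP]] show "e \<in> \<O> A (insert w (B' \<union> rest (Suc a))) (Suc n)"
      by (simp only: diff_add_cancel)
  next
    assume "e \<in> \<O> A (insert w (B' \<union> rest (Suc a))) (Suc n)"
    then obtain e2 e1 where e12: "e = e2 + e1" "e2 \<in> \<P> (insert w A) (Suc n)"
      "e1 \<in> \<O> A (B' \<union> rest (Suc a)) (Suc n)" by (rule O_insert_split)
    \<comment> \<open>The part of e polynomial in w lifts to a cycle of the middle term. Subtracting
      this cycle from f' does not change bd f' modulo \<open>\<O> X Bm\<close>.\<close>
    from rel_lift[OF kr _ e12(2), of Bm] admBm obtain k0 where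
      k0: "cyc X Bm (Suc q1) k0" "rel k (insert w A) Bm k0 e2"
      unfolding a(2) q1 Xvl(2)[symmetric] by blast
    define y where "y = f' - k0"
    have "rel k A B' y (e - e2)" unfolding y_def by (rule rel_diff[OF f'e rel_mono[OF sub k0(2)]])
    then have "rel k A B' y e1" by (simp only: e12(1) add_diff_cancel_left')
    moreover have yc: "cyc X B' (Suc q1) y"
      unfolding y_def by (rule cyc_diff[OF f'c cyc_mono[OF order_refl sub(2) k0(1)]])
    then have "cyc (A \<union> rest (Suc a)) B' (Suc q1) y" by (rule cyc_mono[OF Xvl(3) order_refl])
    ultimately have "bnd (A \<union> rest (Suc a)) B' (Suc q1) y" using IH e12(3) by blast
    then obtain g where g: "g \<in> \<P> (A \<union> rest (Suc a)) (Suc (Suc q1))"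
      "y - bd g \<in> \<O> (A \<union> rest (Suc a)) B' (Suc q1)" by (auto simp: bnd_def)
    \<comment> \<open>Back from w invertible to w polynomial: the obstruction g is zero by degree,
      because \<open>insert w B'\<close> contains group a and group a + 1 is still
      polynomial.\<close>
    have "g \<in> \<O> (A \<union> rest (Suc a)) (insert w B') (Suc (Suc q1))"
      using P_subset_O'[OF a(1) wB' _ _ g(1), of "Suc a"] rest_Suc[of "Suc a"] a(4) by auto
    from step_bnd_back[OF _ g O_bnd[OF this]] yc have "bnd X B' (Suc q1) y"
      unfolding X_def[symmetric] cyc_def by blast
    moreover have "h0 - bd y = (h0 - bd f') + bd k0" unfolding y_def D_diff by (simp add: algebra_simps)
    moreover have "bd k0 \<in> \<O> X Bm q1" using k0(1) by (simp add: cyc_def)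
    ultimately have "bnd X (insert v Bm) (Suc q1) y" "h0 - bd y \<in> \<O> X Bm q1"
      using Oc_add[OF f'(2)] unfolding B' by (simp_all only:)
    from step_bnd_back[OF h0P _ this(2,1)] yc have "bnd (insert v X) Bm q1 h0"
      unfolding cyc_def by blast
    then have "bnd (insert v X) (B \<union> set vl) (qs a + length vl) h0" by (simp only: Bm_def q1_def)
    moreover have "f \<in> \<P> (insert v X \<union> set vl) (qs a)" using fc by (simp only: cyc_def)
    ultimately show "bnd (insert v X \<union> set vl) B (qs a) f" using path_bnd_back[OF _ h0] by blast
  qed
  then show ?case unfolding Xvl(1) a_def[symmetric] end_eq .
qed

end

section \<open>Determinants with prescribed unit columns\<close>

text \<open>For distinct entries of ts below N, and no more than N of them, the determinant is up to
  sign the minor of g without the rows ts and without the first columns. Unit columns avoid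
  submatrices and the renumbering of their indices.\<close>

definition umat :: "nat \<Rightarrow> nat list \<Rightarrow> (nat \<Rightarrow> nat \<Rightarrow> 'a::comm_ring_1) \<Rightarrow> 'a mat" where
  "umat N ts g = mat N N (\<lambda>(i, c). if c < length ts then (if i = ts ! c then 1 else 0) else g i c)"

text \<open>The first free column is replaced by w, so that the determinant can be expanded linearly
  in w.\<close>

definition rmat :: "nat \<Rightarrow> nat list \<Rightarrow> (nat \<Rightarrow> 'a) \<Rightarrow> (nat \<Rightarrow> nat \<Rightarrow> 'a::comm_ring_1) \<Rightarrow> 'a mat" where
  "rmat N ts w g = mat N N (\<lambda>(i, c). if c < length ts then (if i = ts ! c then 1 else 0)
     else if c = length ts then w i else g i c)"

lemma umat_carrier [simp]: "umat N ts g \<in> carrier_mat N N"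
  by (simp add: umat_def)

lemma rmat_carrier [simp]: "rmat N ts w g \<in> carrier_mat N N"
  by (simp add: rmat_def)

text \<open>Laplace expansion along the column w: its cofactors do not depend on w, and unit vectors
  in place of w identify them with the determinants of \<open>umat\<close>.\<close>

lemma det_rmat:
  assumes k: "length ts < N"
  shows "det (rmat N ts w g) = (\<Sum>i<N. w i * det (umat N (ts @ [i]) g))"
proof -
  let ?k = "length ts"
  have del: "mat_delete (rmat N ts w g) i ?k = mat_delete (rmat N ts w' g) i ?k" for i w w'
    by (rule eq_matI) (auto simp: mat_delete_def rmat_def)
  have cof: "cofactor (rmat N ts w g) i ?k = cofactor (rmat N ts w' g) i ?k" for i w w'
    unfolding cofactor_def del[of w i w'] ..
  have expand: "det (rmat N ts v g) = (\<Sum>i<N. v i * cofactor (rmat N ts w g) i ?k)" for v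
  proof -
    have "det (rmat N ts v g) = (\<Sum>i<N. rmat N ts v g $$ (i, ?k) * cofactor (rmat N ts v g) i ?k)"
      by (rule laplace_expansion_column[OF rmat_carrier k])
    also have "\<dots> = (\<Sum>i<N. v i * cofactor (rmat N ts w g) i ?k)"
      using k by (intro sum.cong refl) (simp add: cof[of v _ w], simp add: rmat_def)
    finally show ?thesis .
  qed
  have unit: "umat N (ts @ [i]) g = rmat N ts (\<lambda>i'. if i' = i then 1 else 0) g" for i
    by (rule eq_matI) (auto simp: umat_def rmat_def nth_append less_Suc_eq)
  have "det (umat N (ts @ [i]) g) = cofactor (rmat N ts w g) i ?k" if "i < N" for i
    unfolding unit expand using that by (simp add: if_distrib[of "\<lambda>x. x * _"] cong: if_cong)
  then show ?thesis unfolding expand[of w] by (intro sum.cong refl) simp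
qed

lemma det_umat_identical:
  assumes "length ts \<le> N" "a < b" "b < length ts" "ts ! a = ts ! b"
  shows "det (umat N ts g) = 0"
proof (rule det_identical_columns[OF umat_carrier])
  show "a \<noteq> b" "a < N" "b < N" using assms by auto
  then show "col (umat N ts g) a = col (umat N ts g) b"
    using assms by (intro eq_vecI) (auto simp: umat_def)
qed

text \<open>This exhibits the minors of \<open>g\<close> as a morphism from the Koszul complex of \<open>Y\<close> to that
  of \<open>w\<close>.\<close>

lemma koszul_minors:
  assumes k: "length ts < N" and w: "\<And>i. i < N \<Longrightarrow> w i = (\<Sum>c<N. Y c * g i c)"
  shows "(\<Sum>i<N. w i * det (umat N (ts @ [i]) g)) =
    Y (length ts) * det (umat N ts g) + (\<Sum>c<length ts. Y c * det (rmat N ts (\<lambda>i. g i c) g))"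
proof -
  let ?k = "length ts"
  have "(\<Sum>i<N. w i * det (umat N (ts @ [i]) g)) = (\<Sum>i<N. \<Sum>c<N. Y c * (g i c * det (umat N (ts @ [i]) g)))"
    using w by (intro sum.cong refl) (simp add: sum_distrib_right mult.assoc)
  also have "\<dots> = (\<Sum>c<N. Y c * (\<Sum>i<N. g i c * det (umat N (ts @ [i]) g)))"
    by (subst sum.swap) (simp add: sum_distrib_left)
  also have "\<dots> = (\<Sum>c<N. Y c * det (rmat N ts (\<lambda>i. g i c) g))"
    by (simp only: det_rmat[OF k])
  also have "\<dots> = (\<Sum>c<Suc ?k. Y c * det (rmat N ts (\<lambda>i. g i c) g))"
  proof (rule sum.mono_neutral_right)
    show "\<forall>c\<in>{..<N} - {..<Suc ?k}. Y c * det (rmat N ts (\<lambda>i. g i c) g) = 0"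
    proof
      fix c assume c: "c \<in> {..<N} - {..<Suc ?k}"
      have "det (rmat N ts (\<lambda>i. g i c) g) = 0"
      proof (rule det_identical_columns[OF rmat_carrier])
        show "?k \<noteq> c" "?k < N" "c < N" using c by auto
        then show "col (rmat N ts (\<lambda>i. g i c) g) ?k = col (rmat N ts (\<lambda>i. g i c) g) c"
          using c by (intro eq_vecI) (auto simp: rmat_def)
      qed
      then show "Y c * det (rmat N ts (\<lambda>i. g i c) g) = 0" by simp
    qed
  qed (use k in auto)
  also have "rmat N ts (\<lambda>i. g i ?k) g = umat N ts g"
    by (rule eq_matI) (auto simp: umat_def rmat_def)
  then have "(\<Sum>c<Suc ?k. Y c * det (rmat N ts (\<lambda>i. g i c) g)) =
      Y ?k * det (umat N ts g) + (\<Sum>c<?k. Y c * det (rmat N ts (\<lambda>i. g i c) g))" by simp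
  finally show ?thesis .
qed

lemma det_umat_swap:
  assumes "length xs + length ys + 2 \<le> N"
  shows "det (umat N (xs @ a # b # ys) g) = - det (umat N (xs @ b # a # ys) g)"
proof -
  let ?k = "length xs"
  have "umat N (xs @ a # b # ys) g = swapcols ?k (Suc ?k) (umat N (xs @ b # a # ys) g)"
    using assms by (intro eq_matI) (auto simp: umat_def nth_append nth_Cons' Suc_diff_le)
  also have "det \<dots> = - det (umat N (xs @ b # a # ys) g)"
    using assms by (intro det_swapcols[OF _ _ _ umat_carrier]) auto
  finally show ?thesis .
qed

lemma det_umat_move:
  "length xs + length zs < N \<Longrightarrow>
    det (umat N (xs @ zs @ [a]) g) = (-1) ^ length zs * det (umat N (xs @ a # zs) g)"
proof (induction zs arbitrary: xs)
  case (Cons z zs)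
  have "det (umat N (xs @ (z # zs) @ [a]) g) = det (umat N ((xs @ [z]) @ zs @ [a]) g)" by simp
  also have "\<dots> = (-1) ^ length zs * det (umat N ((xs @ [z]) @ a # zs) g)"
    using Cons.prems by (intro Cons.IH) simp
  also have "det (umat N ((xs @ [z]) @ a # zs) g) = - det (umat N (xs @ a # z # zs) g)"
    using det_umat_swap[of xs zs N z a g] Cons.prems by simp
  finally show ?case by simp
qed simp

text \<open>Moving the appended index to its sorted position passes exactly the larger elements of
  T; this is the sign \<open>sg\<close> of the Koszul differential.\<close>

lemma det_umat_sorted_insert:
  assumes T: "T \<subseteq> {..<N}" and i: "i < N" "i \<notin> T"
  shows "det (umat N (sorted_list_of_set T @ [i]) g) =
    (-1) ^ card {t\<in>T. i < t} * det (umat N (sorted_list_of_set (insert i T)) g)"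
proof -
  have fin: "finite T" using T finite_subset by blast
  let ?L = "sorted_list_of_set {t\<in>T. t < i}" and ?R = "sorted_list_of_set {t\<in>T. i < t}"
  have fLR: "finite {t\<in>T. t < i}" "finite {t\<in>T. i < t}" using fin by auto
  have split: "{t\<in>T. t < i} \<union> {t\<in>T. i < t} = T"
  proof -
    have "t < i \<or> i < t" if "t \<in> T" for t using that i(2) by (cases t i rule: linorder_cases) auto
    then show ?thesis by blast
  qed
  have 1: "sorted_list_of_set T = ?L @ ?R"
  proof (rule sorted_distinct_set_unique)
    show "set (sorted_list_of_set T) = set (?L @ ?R)" using fin fLR split by simp
  qed (use fin fLR in \<open>auto simp: sorted_append\<close>)
  have 2: "sorted_list_of_set (insert i T) = ?L @ i # ?R"
  proof (rule sorted_distinct_set_unique)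
    have "set (sorted_list_of_set (insert i T)) = insert i T"
      using fin by (intro set_sorted_list_of_set) simp
    also have "\<dots> = set (?L @ i # ?R)" using fLR split by auto
    finally show "set (sorted_list_of_set (insert i T)) = set (?L @ i # ?R)" .
  qed (use fin fLR in \<open>auto simp: sorted_append sorted_insort distinct_insort\<close>)
  have "card (insert i T) \<le> card {..<N}" using T i(1) by (intro card_mono) auto
  then have "length (sorted_list_of_set T) < N" using fin i by simp
  then have "length ?L + length ?R < N" unfolding 1 by simp
  then show ?thesis unfolding 1 2 append_assoc by (subst det_umat_move) auto
qed

lemma det_umat_all: "det (umat N [0..<N] g) = 1"
proof -
  have "umat N [0..<N] g = 1\<^sub>m N" by (rule eq_matI) (auto simp: umat_def)
  then show ?thesis by simp
qed

lemma det_umat_Nil: "umat N [] g = mat N N (\<lambda>(i, c). g i c)"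
  by (rule eq_matI) (auto simp: umat_def)

section \<open>Multidegrees of determinants\<close>

context multigraded begin

definition Hom :: "(nat \<Rightarrow> int) \<Rightarrow> (lexpo \<times> ((nat \<times> expo) \<Rightarrow>\<^sub>0 nat)) set" where
  "Hom e = {x. Poly_Mapping.keys (fst x) \<subseteq> xvars r ns \<and> Poly_Mapping.keys (snd x) \<subseteq> uvars r ns d \<and>
     (\<forall>v. 0 \<le> lkp (fst x) v) \<and> (\<forall>j\<in>{1..r}. gdeg (fst x) j = e j)}"

lemma Hom_add: "x \<in> Hom e \<Longrightarrow> y \<in> Hom e' \<Longrightarrow> x + y \<in> Hom (\<lambda>j. e j + e' j)"
  unfolding Hom_def by (simp add: keys_add_subset lookup_add gdeg_add)

lemma Hom_one: "supp (1 :: 'k::comm_ring_1 laurent) \<subseteq> Hom (\<lambda>j. 0)"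
proof -
  have "supp (mterm 0 1 :: 'k laurent) \<subseteq> {0}" by (rule supp_mterm)
  then show ?thesis unfolding one_mterm by (auto simp: Hom_def)
qed

lemma Hom_mult:
  fixes f g :: "'k::comm_ring_1 laurent"
  shows "supp f \<subseteq> Hom e \<Longrightarrow> supp g \<subseteq> Hom e' \<Longrightarrow> supp (f * g) \<subseteq> Hom (\<lambda>j. e j + e' j)"
  by (rule supp_multI) (use Hom_add in blast)

lemma Hom_prod:
  fixes f :: "'i \<Rightarrow> 'k::comm_ring_1 laurent"
  shows "(\<And>i. i \<in> I \<Longrightarrow> supp (f i) \<subseteq> Hom (e i)) \<Longrightarrow> supp (prod f I) \<subseteq> Hom (\<lambda>j. \<Sum>i\<in>I. e i j)"
proof (induction I rule: infinite_finite_induct)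
  case (insert i I)
  have "supp (f i * prod f I) \<subseteq> Hom (\<lambda>j. e i j + (\<Sum>i\<in>I. e i j))"
    using insert by (intro Hom_mult) auto
  then show ?case using insert.hyps by simp
qed (use Hom_one in auto)

text \<open>If the degree of an entry is a row term minus a column term, all products in the Leibniz
  formula have the same degree.\<close>

lemma Hom_det:
  fixes M :: "'k::comm_ring_1 laurent mat"
  assumes M: "M \<in> carrier_mat N N"
    and e: "\<And>i c. i < N \<Longrightarrow> c < N \<Longrightarrow> supp (M $$ (i, c)) \<subseteq> Hom (\<lambda>j. R i j - C c j)"
  shows "supp (det M) \<subseteq> Hom (\<lambda>j. (\<Sum>i<N. R i j) - (\<Sum>c<N. C c j))"
  unfolding det_def'[OF M]
proof (rule supp_sumI)
  fix p assume "p \<in> {p. p permutes {0..<N}}"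
  then have p: "p permutes {0..<N}" by simp
  have "supp (\<Prod>i = 0..<N. M $$ (i, p i)) \<subseteq> Hom (\<lambda>j. \<Sum>i = 0..<N. R i j - C (p i) j)"
    using p by (intro Hom_prod e) (auto dest: permutes_in_image)
  moreover have "(\<Sum>i = 0..<N. R i j - C (p i) j) = (\<Sum>i<N. R i j) - (\<Sum>c<N. C c j)" for j
  proof -
    have "(\<Sum>i = 0..<N. C (p i) j) = (\<Sum>c = 0..<N. C c j)"
      by (rule sum.permute[OF p, symmetric, unfolded o_def])
    then show ?thesis by (simp add: sum_subtractf atLeast0LessThan)
  qed
  moreover have "supp (signof p * x) = supp x" for x :: "'k laurent"
    by (simp add: sign_def)
  ultimately show "supp (signof p * (\<Prod>i = 0..<N. M $$ (i, p i))) \<subseteq>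
      Hom (\<lambda>j. (\<Sum>i<N. R i j) - (\<Sum>c<N. C c j))" by simp
qed

end

section \<open>Sylvester forms\<close>

definition xm :: "expo \<Rightarrow> 'k::comm_ring_1 cpoly" where
  "xm e = Poly_Mapping.single e 1"

lemma xm_mult: "xm a * xm b = xm (a + b)"
  by (simp add: xm_def mult_single)

lemma xm_zero [simp]: "xm 0 = 1"
  by (simp add: xm_def)

lemma xm_prod: "(\<Prod>i\<in>I. xm (e i)) = xm (\<Sum>i\<in>I. e i)"
  by (induction I rule: infinite_finite_induct) (auto simp: xm_mult)

lemma x_var_power: "x_var v ^ k = xm (Poly_Mapping.single v k)"
proof (induction k)
  case (Suc k)
  have "x_var v = (xm (Poly_Mapping.single v 1) :: 'a cpoly)" by (simp add: xm_def x_var_def)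
  then show ?case using Suc by (simp add: xm_mult flip: single_add)
qed simp

lemma xm_mterm: "xm e = mterm (e, 0) 1"
  by (simp add: xm_def mterm_def)

lemma emb_xm: "emb (xm e) = mterm (iexp e, 0) 1"
  by (simp add: xm_mterm emb_mterm iexp2_def)

section \<open>The columns of the Sylvester matrix and the monomials of the decomposition\<close>

context multigraded begin

abbreviation cl :: "(nat \<times> nat) list" where "cl \<equiv> sylv_columns r ns"

lemma cl_eq: "cl = concat (map gvs [1..<Suc r]) @ [(r, ns r)]"
proof -
  have "gvs = (\<lambda>g. map (Pair g) [0..<ns g])" by (rule ext) (rule gvs_def)
  then show ?thesis by (simp add: sylv_columns_def del: upt_Suc)
qed

lemma gvs_iff: "v \<in> set (gvs g) \<longleftrightarrow> fst v = g \<and> snd v < ns g"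
  by (cases v) (auto simp: gvs_def)

lemma length_cl [simp]: "length cl = Suc n"
  by (simp add: length_sylv_columns)

lemma length_concat_gvs: "length (concat (map gvs [1..<a])) = qs a"
  by (simp add: length_concat o_def qs_def interv_sum_list_conv_sum_set_nat del: upt_Suc)

lemma cl_split:
  assumes "1 \<le> a" "a \<le> r"
  shows "cl = concat (map gvs [1..<a]) @ gvs a @ concat (map gvs [Suc a..<Suc r]) @ [(r, ns r)]"
proof -
  have "[1..<Suc r] = [1..<a] @ [a..<Suc r]"
    using upt_add_eq_append[of 1 a "Suc r - a"] assms by simp
  also have "[a..<Suc r] = a # [Suc a..<Suc r]" using assms by (intro upt_conv_Cons) simp
  finally show ?thesis by (simp add: cl_eq del: upt_Suc)
qed

lemma cl_nth: "1 \<le> a \<Longrightarrow> a \<le> r \<Longrightarrow> i < ns a \<Longrightarrow> cl ! (qs a + i) = (a, i)"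
  by (subst cl_split, assumption, assumption)
    (simp add: nth_append length_concat_gvs[unfolded One_nat_def] del: upt_Suc, simp add: gvs_def)

lemma cl_last: "cl ! n = (r, ns r)"
proof -
  have "length (concat (map gvs [1..<Suc r])) = n" by (simp only: length_concat_gvs qs_top)
  then show ?thesis unfolding cl_eq by (simp add: nth_append del: upt_Suc)
qed

lemma set_cl: "v \<in> set cl \<longleftrightarrow> fst v \<in> {1..r} \<and> (snd v < ns (fst v) \<or> v = (r, ns r))"
  using r_pos by (cases v) (auto simp: cl_eq gvs_iff simp del: upt_Suc)

lemma distinct_cl: "distinct cl"
proof -
  have "distinct (concat (map gvs [1..<a]))" for a
  proof (induction a)
    case (Suc a)
    then show ?case by (cases "1 \<le> a") (auto simp: gvs_def distinct_map inj_on_def)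
  qed simp
  then show ?thesis by (auto simp: cl_eq gvs_def simp del: upt_Suc)
qed

lemma sum_cl: "(\<Sum>c<Suc n. f (cl ! c)) = (\<Sum>v\<in>set cl. f v)"
proof -
  have "bij_betw ((!) cl) {..<Suc n} (set cl)"
    using bij_betw_nth[OF distinct_cl, of "{..<Suc n}"] by simp
  then show ?thesis by (rule sum.reindex_bij_betw)
qed

lemma cl_xvars: "set cl \<subseteq> xvars r ns"
proof
  fix v assume "v \<in> set cl"
  then show "v \<in> xvars r ns" unfolding set_cl by (cases v) (auto simp: xvars_def)
qed

text \<open>The monomial multiplying the cofactor of column \<open>v\<close> in the decomposition of \<open>F i\<close>.\<close>

definition yexp :: "expo \<Rightarrow> nat \<times> nat \<Rightarrow> expo" where
  "yexp \<alpha> v = (\<Sum>l=1..<fst v. Poly_Mapping.single (l, ns l) (lkp \<alpha> (l, ns l) + 1)) +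
     Poly_Mapping.single v (lkp \<alpha> v + 1)"

lemma lookup_sum_last:
  "lkp (\<Sum>l=1..<a. Poly_Mapping.single (l, ns l) (h l)) v =
    (if fst v \<in> {1..<a} \<and> snd v = ns (fst v) then h (fst v) else (0::nat))"
proof -
  have "lkp (\<Sum>l=1..<a. Poly_Mapping.single (l, ns l) (h l)) v =
      (\<Sum>l=1..<a. if l = fst v then (if snd v = ns (fst v) then h (fst v) else 0) else 0)"
    unfolding lookup_sum by (intro sum.cong refl) (cases v, auto simp: lookup_single when_def)
  then show ?thesis by simp
qed

lemma lookup_yexp:
  "lkp (yexp \<alpha> u) v = (if fst v \<in> {1..<fst u} \<and> snd v = ns (fst v) then lkp \<alpha> v + 1 else 0) +
     (if u = v then lkp \<alpha> v + 1 else 0)"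
  unfolding yexp_def lookup_add lookup_sum_last by (cases v) (auto simp: lookup_single when_def)

text \<open>Besides its own variable, a column monomial contains only last variables of strictly
  earlier groups, and those are not column variables.\<close>

lemma yexp_diag: "u \<in> set cl \<Longrightarrow> v \<in> set cl \<Longrightarrow> lkp (yexp \<alpha> u) v = (if u = v then lkp \<alpha> v + 1 else 0)"
  unfolding lookup_yexp by (cases v) (auto simp: set_cl)

lemma keys_yexp: "v \<in> set cl \<Longrightarrow> Poly_Mapping.keys (yexp \<alpha> v) \<subseteq> xvars r ns"
proof
  fix u assume v: "v \<in> set cl" "u \<in> Poly_Mapping.keys (yexp \<alpha> v)"
  then have "u = v \<or> fst u \<in> {1..<fst v} \<and> snd u = ns (fst u)"
    by (auto simp: in_keys_iff lookup_yexp split: if_splits)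
  with v(1) cl_xvars show "u \<in> xvars r ns"
    by (cases u) (auto simp: xvars_def set_cl)
qed

text \<open>Downward induction on a: the powers in front of the bracket opened at group a are
  multiplied into it, which turns the nested decomposition into a plain sum over the
  columns.\<close>

lemma nested_sum_eq:
  assumes "a \<le> r" "1 \<le> a"
  shows "xm (\<Sum>l=1..<a. Poly_Mapping.single (l, ns l) (lkp \<alpha> (l, ns l) + 1)) * nested_sum ns \<alpha> G [a..<Suc r] =
    (\<Sum>v\<in>{v\<in>set cl. a \<le> fst v}. xm (yexp \<alpha> v) * G (fst v) (snd v))"
  using assms
proof (induction a rule: inc_induct)
  case base
  have "{v\<in>set cl. r \<le> fst v} = Pair r ` {0..ns r}"
    using r_pos by (force simp: set_cl)
  then have "(\<Sum>v\<in>{v\<in>set cl. r \<le> fst v}. xm (yexp \<alpha> v) * G (fst v) (snd v)) =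
      (\<Sum>j=0..ns r. xm (yexp \<alpha> (r, j)) * G r j)"
    by (simp add: sum.reindex inj_on_def)
  then show ?case
    by (simp add: x_var_power sum_distrib_left xm_mult yexp_def del: power_Suc flip: mult.assoc)
next
  case (step a)
  let ?pre = "\<lambda>a. xm (\<Sum>l=1..<a. Poly_Mapping.single (l, ns l) (lkp \<alpha> (l, ns l) + 1)) :: 'a cpoly"
  have upt: "[a..<Suc r] = a # Suc a # [Suc (Suc a)..<Suc r]" "[Suc a..<Suc r] = Suc a # [Suc (Suc a)..<Suc r]"
    using step.hyps by (simp_all add: upt_conv_Cons del: upt_Suc)
  have pre: "?pre (Suc a) = ?pre a * xm (Poly_Mapping.single (a, ns a) (lkp \<alpha> (a, ns a) + 1))"
    using step.prems by (simp add: xm_mult)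
  have "{v\<in>set cl. a \<le> fst v} = Pair a ` {0..<ns a} \<union> {v\<in>set cl. Suc a \<le> fst v}"
  proof (intro equalityI subsetI)
    fix v assume v: "v \<in> {v\<in>set cl. a \<le> fst v}"
    show "v \<in> Pair a ` {0..<ns a} \<union> {v\<in>set cl. Suc a \<le> fst v}"
    proof (cases "fst v = a")
      case True
      then have "snd v < ns a" using v step.hyps by (auto simp: set_cl)
      then show ?thesis using True by (cases v) auto
    qed (use v in auto)
  next
    fix v assume "v \<in> Pair a ` {0..<ns a} \<union> {v\<in>set cl. Suc a \<le> fst v}"
    then show "v \<in> {v\<in>set cl. a \<le> fst v}" using step.hyps step.prems by (auto simp: set_cl)
  qed
  then have "(\<Sum>v\<in>{v\<in>set cl. a \<le> fst v}. xm (yexp \<alpha> v) * G (fst v) (snd v)) =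
      (\<Sum>v\<in>Pair a ` {0..<ns a}. xm (yexp \<alpha> v) * G (fst v) (snd v)) +
      (\<Sum>v\<in>{v\<in>set cl. Suc a \<le> fst v}. xm (yexp \<alpha> v) * G (fst v) (snd v))"
    by (simp only:) (rule sum.union_disjoint, auto)
  also have "(\<Sum>v\<in>Pair a ` {0..<ns a}. xm (yexp \<alpha> v) * G (fst v) (snd v)) =
      ?pre a * (\<Sum>j=0..<ns a. x_var (a, j) ^ (lkp \<alpha> (a, j) + 1) * G a j)"
    by (simp add: sum.reindex inj_on_def x_var_power sum_distrib_left xm_mult yexp_def del: power_Suc flip: mult.assoc)
  also have "(\<Sum>v\<in>{v\<in>set cl. Suc a \<le> fst v}. xm (yexp \<alpha> v) * G (fst v) (snd v)) =
      ?pre (Suc a) * nested_sum ns \<alpha> G [Suc a..<Suc r]"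
    using step.IH step.prems by simp
  finally show ?case
    unfolding pre upt by (simp add: x_var_power algebra_simps del: power_Suc)
qed

end

section \<open>A decomposition for a fixed \<alpha> and the degrees of its cofactors\<close>

locale sylvester = multigraded +
  fixes \<alpha> :: expo and G :: "nat \<Rightarrow> nat \<Rightarrow> nat \<Rightarrow> 'k::comm_ring_1 cpoly"
  assumes alpha: "\<alpha> \<in> expts r ns \<mu>"
    and decomp: "i \<le> n \<Longrightarrow> sylv_decomposition r ns d \<alpha> i (G i)"
begin

lemma generic_decomp:
  assumes "i \<le> n"
  shows "generic_poly r ns d i = (\<Sum>v\<in>set cl. xm (yexp \<alpha> v) * G i (fst v) (snd v))"
proof -
  have "{v\<in>set cl. 1 \<le> fst v} = set cl" by (auto simp: set_cl)
  then show ?thesis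
    using nested_sum_eq[of 1 \<alpha> "G i"] r_pos decomp[OF assms]
    by (simp add: sylv_decomposition_def del: upt_Suc)
qed

lemma alpha_less:
  assumes "i \<le> n" "v \<in> xvars r ns" shows "lkp \<alpha> v < d i (fst v)"
proof -
  obtain j l where v: "v = (j, l)" "j \<in> {1..r}" "l \<le> ns j" using assms(2) by (auto simp: xvars_def)
  have "lkp \<alpha> (j, l) \<le> group_deg ns \<alpha> j"
    unfolding group_deg_def using v by (intro member_le_sum) auto
  also have "\<dots> = \<mu> j" using alpha v by (auto simp: expts_def)
  also have "\<dots> < d i j" by (rule mu_less[OF v(2) assms(1)])
  finally show ?thesis by (simp add: v)
qed

text \<open>The cofactors have the expected degree: the monomial of \<open>F i\<close> that is pure in every group
  and divisible by \<open>yexp \<alpha> v\<close> is divisible by no other \<open>yexp \<alpha> u\<close>, so that the cofactor at \<open>v\<close>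
  contains its quotient by \<open>yexp \<alpha> v\<close>.\<close>

lemma G_degree:
  assumes i: "i \<le> n" and v: "v \<in> set cl" and m: "m \<in> Poly_Mapping.keys (G i (fst v) (snd v))" and j: "j \<in> {1..r}"
  shows "int (group_deg ns m j) = int (d i j) - gdeg (iexp (yexp \<alpha> v)) j"
proof -
  define s where "s l = (if l < fst v then ns l else if l = fst v then snd v else 0)" for l
  define \<sigma> where "\<sigma> = sec_expo s (d i)"
  have s: "\<forall>l\<in>{1..r}. s l \<le> ns l"
    using v unfolding set_cl by (cases v) (auto simp: s_def)
  have \<sigma>: "\<sigma> \<in> expts r ns (d i)" unfolding \<sigma>_def by (rule sec_expo_expts[OF s])
  have lk: "lkp \<sigma> u = (if fst u \<in> {1..r} \<and> snd u = s (fst u) then d i (fst u) else 0)" for u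
    unfolding \<sigma>_def using lookup_sec_expo[of s "d i" "fst u" "snd u"] by simp
  have uniq: "u = v" if u: "u \<in> set cl" and le: "\<sigma> = yexp \<alpha> u + m'" for u m'
  proof (rule ccontr)
    assume "u \<noteq> v"
    have pos: "0 < lkp (yexp \<alpha> u) w \<Longrightarrow> 0 < lkp \<sigma> w" for w unfolding le by (simp add: lookup_add)
    show False
    proof (cases "fst v < fst u")
      case True
      then have "0 < lkp (yexp \<alpha> u) (fst v, ns (fst v))" using v by (auto simp: lookup_yexp set_cl)
      from pos[OF this] have "snd v = ns (fst v)" by (auto simp: lk s_def split: if_splits)
      moreover have "fst v < r" using True u by (auto simp: set_cl)
      ultimately show False using v by (cases v) (auto simp: set_cl)
    next
      case False
      have "0 < lkp (yexp \<alpha> u) u" by (simp add: lookup_yexp)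
      from pos[OF this] have su: "snd u = s (fst u)" by (auto simp: lk split: if_splits)
      show False
      proof (cases "fst u = fst v")
        case True
        then show False using su \<open>u \<noteq> v\<close> by (auto simp: s_def prod_eq_iff)
      next
        case neq: False
        then have "snd u = ns (fst u)" "fst u < r" using su False v by (auto simp: s_def set_cl)
        then show False using u by (cases u) (auto simp: set_cl)
      qed
    qed
  qed
  have "lkp (generic_poly r ns d i :: 'k cpoly) \<sigma> = u_var (i, \<sigma>)"
  proof -
    have "lkp (generic_poly r ns d i :: 'k cpoly) \<sigma> = (\<Sum>\<beta>\<in>expts r ns (d i). if \<beta> = \<sigma> then u_var (i, \<sigma>) else 0)"
      unfolding generic_poly_def lookup_sum by (intro sum.cong refl) (auto simp: lookup_single when_def)
    then show ?thesis using \<sigma> finite_expts by simp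
  qed
  also have "u_var (i, \<sigma>) \<noteq> (0 :: 'k coeff)"
  proof
    assume "u_var (i, \<sigma>) = (0 :: 'k coeff)"
    then have "lkp (u_var (i, \<sigma>) :: 'k coeff) (Poly_Mapping.single (i, \<sigma>) 1) = 0" by simp
    then show False by (simp add: u_var_def)
  qed
  finally have "(\<Sum>u\<in>set cl. lkp (xm (yexp \<alpha> u) * G i (fst u) (snd u)) \<sigma>) \<noteq> 0"
    unfolding generic_decomp[OF i] lookup_sum .
  then obtain u where u: "u \<in> set cl" "lkp (xm (yexp \<alpha> u) * G i (fst u) (snd u)) \<sigma> \<noteq> 0"
    by (meson sum.not_neutral_contains_not_neutral)
  from u(2) have "\<sigma> \<in> Poly_Mapping.keys (xm (yexp \<alpha> u) * G i (fst u) (snd u))" by (simp add: in_keys_iff)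
  then obtain a m' where am: "a \<in> Poly_Mapping.keys (xm (yexp \<alpha> u) :: 'k cpoly)"
    "m' \<in> Poly_Mapping.keys (G i (fst u) (snd u))" "\<sigma> = a + m'"
    using keys_mult[of "xm (yexp \<alpha> u)" "G i (fst u) (snd u)"] by blast
  then have a: "a = yexp \<alpha> u" by (auto simp: xm_def split: if_splits)
  have "u = v" using uniq[OF u(1)] am(3) a by blast
  \<comment> \<open>A decomposition only promises some degree e for the cofactor; the exponent m'
    just found determines it.\<close>
  obtain e where e: "multihomogeneous r ns e (G i (fst v) (snd v))"
    using decomp[OF i] v by (auto simp: sylv_decomposition_def)
  have "int (group_deg ns m j) = e j" "int (group_deg ns m' j) = e j"
    using e m am(2) j \<open>u = v\<close> by (auto simp: multihomogeneous_def)
  moreover have "gdeg (iexp \<sigma>) j = gdeg (iexp (yexp \<alpha> v)) j + gdeg (iexp m') j"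
    using am(3) a \<open>u = v\<close> by (simp add: iexp_add gdeg_add)
  moreover have "gdeg (iexp \<sigma>) j = int (d i j)" by (rule expts_gdeg[OF \<sigma> j])
  ultimately show ?thesis by (simp add: gdeg_iexp)
qed

definition g :: "nat \<Rightarrow> nat \<Rightarrow> 'k laurent" where
  "g i c = emb (G i (fst (cl ! c)) (snd (cl ! c)))"

definition Y :: "nat \<Rightarrow> 'k laurent" where
  "Y c = mterm (iexp (yexp \<alpha> (cl ! c)), 0) 1"

lemma F_decomp: "i < Suc n \<Longrightarrow> F i = (\<Sum>c<Suc n. Y c * g i c)"
  unfolding F_def Y_def g_def sum_cl[of "\<lambda>v. mterm (iexp (yexp \<alpha> v), 0) 1 * emb (G i (fst v) (snd v))"]
  by (simp add: generic_decomp emb_sum emb_mult emb_xm)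

lemma carrier_supp:
  assumes "p \<in> carrier (poly_ring r ns d)" "x \<in> supp p"
  shows "Poly_Mapping.keys (fst x) \<subseteq> xvars r ns" "Poly_Mapping.keys (snd x) \<subseteq> uvars r ns d"
proof -
  have "snd x \<in> Poly_Mapping.keys (lkp p (fst x))" "fst x \<in> Poly_Mapping.keys p"
    using assms(2) by (auto simp: supp_iff coef_def in_keys_iff)
  then show "Poly_Mapping.keys (fst x) \<subseteq> xvars r ns" "Poly_Mapping.keys (snd x) \<subseteq> uvars r ns d"
    using assms(1) by (auto simp: poly_ring_def coeff_ring_def ring_on_def)
qed

lemma supp_g:
  assumes "i < Suc n" "c < Suc n"
  shows "supp (g i c) \<subseteq> Hom (\<lambda>j. int (d i j) - gdeg (iexp (yexp \<alpha> (cl ! c))) j)"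
proof
  let ?v = "cl ! c"
  fix x assume "x \<in> supp (g i c)"
  then obtain y where y: "y \<in> supp (G i (fst ?v) (snd ?v))" "x = iexp2 y"
    unfolding g_def supp_emb by blast
  have v: "?v \<in> set cl" using assms(2) by simp
  have "G i (fst ?v) (snd ?v) \<in> carrier (poly_ring r ns d)"
    using decomp[of i] v assms(1) by (auto simp: sylv_decomposition_def)
  from carrier_supp[OF this y(1)] have k: "Poly_Mapping.keys (fst y) \<subseteq> xvars r ns"
    "Poly_Mapping.keys (snd y) \<subseteq> uvars r ns d" .
  have "fst y \<in> Poly_Mapping.keys (G i (fst ?v) (snd ?v))"
    using y(1) by (auto simp: supp_iff coef_def in_keys_iff)
  from G_degree[OF _ v this] assms(1) k show "x \<in> Hom (\<lambda>j. int (d i j) - gdeg (iexp (yexp \<alpha> ?v)) j)"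
    by (simp add: Hom_def y(2) iexp2_def gdeg_iexp)
qed

end

lemma diff_add_self: "a - (a + s) = - s"
  for a :: "'a::ab_group_add"
  by simp

lemma sum_lessThan_split: "k \<le> N \<Longrightarrow> (\<Sum>c<N. f c) = (\<Sum>c<k. f c) + (\<Sum>c\<in>{k..<N}. f c)"
  for f :: "nat \<Rightarrow> 'a::comm_monoid_add"
  using sum.atLeastLessThan_concat[of 0 k N f] by (simp add: atLeast0LessThan)

section \<open>The zigzag of minors\<close>

context sylvester begin

definition pref :: expo where
  "pref = (\<Sum>i=1..<r. Poly_Mapping.single (i, ns i) ((lkp \<alpha> (i, ns i) + 1) * (\<Sum>j=i+1..r. ns j)))"

text \<open>Level k of the zigzag turns k columns into unit columns and divides the prefactor by the
  monomials of the columns 0, ..., k - 1; this is the exponent left in front of the minor.\<close>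

definition X :: "nat \<Rightarrow> lexpo" where
  "X k = iexp pref - (\<Sum>c<k. iexp (yexp \<alpha> (cl ! c)))"

lemma X_Suc: "X k = X (Suc k) + iexp (yexp \<alpha> (cl ! k))"
  by (simp add: X_def)

lemma lookup_pref:
  "lkp pref v = (if fst v \<in> {1..<r} \<and> snd v = ns (fst v) then (lkp \<alpha> v + 1) * (\<Sum>j=fst v+1..r. ns j) else 0)"
  unfolding pref_def lookup_sum_last[of "\<lambda>i. (lkp \<alpha> (i, ns i) + 1) * (\<Sum>j=i+1..r. ns j)" r v]
  by (cases v) auto

lemma lookup_X: "lkp (X k) v = int (lkp pref v) - (\<Sum>c<k. int (lkp (yexp \<alpha> (cl ! c)) v))"
  by (simp add: X_def lookup_minus lookup_sum)

text \<open>A column whose group does not come after that of v, and whose variable is not v, has a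
  monomial free of v, so nothing is subtracted from the prefactor at v.\<close>

lemma X_nonneg:
  assumes "\<And>c. c < k \<Longrightarrow> cl ! c \<noteq> v \<and> fst (cl ! c) \<le> fst v"
  shows "0 \<le> lkp (X k) v"
proof -
  have "(\<Sum>c<k. int (lkp (yexp \<alpha> (cl ! c)) v)) = 0"
  proof (intro sum.neutral ballI)
    fix c assume "c \<in> {..<k}"
    with assms[of c] show "int (lkp (yexp \<alpha> (cl ! c)) v) = 0" by (auto simp: lookup_yexp)
  qed
  then show ?thesis by (simp add: lookup_X)
qed

text \<open>A column variable occurs only in its own monomial, and the prefactor is free of it. The
  last variable of a group before the last occurs in the monomials of all columns of later groups;
  their number is one more than the multiplicity v_i in the prefactor, so exactly one power \<alpha>
  + 1 remains uncompensated.\<close>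

lemma X_end:
  assumes v: "v \<in> xvars r ns"
  shows "lkp (X (Suc n)) v = - 1 - int (lkp \<alpha> v)"
proof -
  have sum: "(\<Sum>c<Suc n. int (lkp (yexp \<alpha> (cl ! c)) v)) = (\<Sum>u\<in>set cl. int (lkp (yexp \<alpha> u) v))"
    by (rule sum_cl)
  show ?thesis
  proof (cases "v \<in> set cl")
    case True
    have "(\<Sum>u\<in>set cl. int (lkp (yexp \<alpha> u) v)) = (\<Sum>u\<in>set cl. if u = v then int (lkp \<alpha> v) + 1 else 0)"
      using True by (intro sum.cong refl) (simp add: yexp_diag)
    moreover have "lkp pref v = 0"
      using True unfolding set_cl by (cases v) (auto simp: lookup_pref)
    ultimately show ?thesis unfolding lookup_X sum using True by simp
  next
    case False
    then have "fst v \<in> {1..<r} \<and> snd v = ns (fst v)"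
      using v unfolding set_cl xvars_def by (cases v) (auto simp: le_less)
    then have w: "fst v \<in> {1..<r}" "snd v = ns (fst v)" by blast+
    let ?S = "{u\<in>set cl. fst v < fst u}"
    have lk: "int (lkp (yexp \<alpha> u) v) = (if fst v < fst u then int (lkp \<alpha> v) + 1 else 0)" if "u \<in> set cl" for u
      using that False w by (auto simp: lookup_yexp)
    have "(\<Sum>u\<in>set cl. int (lkp (yexp \<alpha> u) v)) = (\<Sum>u\<in>set cl. if fst v < fst u then int (lkp \<alpha> v) + 1 else 0)"
      by (rule sum.cong[OF refl lk])
    also have "\<dots> = (\<Sum>u\<in>?S. int (lkp \<alpha> v) + 1)"
      by (rule sum.inter_filter[symmetric]) simp
    also have "\<dots> = int (card ?S) * (int (lkp \<alpha> v) + 1)" by simp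
    \<comment> \<open>The additional column is that of (r, ns r).\<close>
    also have "card ?S = Suc (\<Sum>j=fst v+1..r. ns j)"
    proof -
      have "?S = insert (r, ns r) (SIGMA j:{fst v+1..r}. {..<ns j})"
        using w by (auto simp: set_cl)
      then show ?thesis by simp
    qed
    finally show ?thesis unfolding lookup_X sum lookup_pref using w by (simp add: algebra_simps)
  qed
qed

lemma keys_X: "k \<le> Suc n \<Longrightarrow> Poly_Mapping.keys (X k) \<subseteq> xvars r ns"
proof
  fix v assume k: "k \<le> Suc n" and v: "v \<in> Poly_Mapping.keys (X k)"
  show "v \<in> xvars r ns"
  proof (rule ccontr)
    assume nv: "v \<notin> xvars r ns"
    have "lkp (yexp \<alpha> (cl ! c)) v = 0" if "c < k" for c
      using keys_yexp[of "cl ! c" \<alpha>] nv that k by (auto simp: in_keys_iff)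
    moreover have "lkp pref v = 0"
      using nv by (cases v) (auto simp: lookup_pref xvars_def)
    ultimately show False using v by (simp add: in_keys_iff lookup_X)
  qed
qed

lemma gdeg_sum: "gdeg (\<Sum>i\<in>I. f i) j = (\<Sum>i\<in>I. gdeg (f i) j)"
  by (induction I rule: infinite_finite_induct) (auto simp: gdeg_add)

lemma gdeg_X_end:
  assumes j: "j \<in> {1..r}"
  shows "gdeg (X (Suc n)) j = - (int (ns j) + 1) - int (\<mu> j)"
proof -
  have "gdeg (X (Suc n)) j = (\<Sum>l=0..ns j. - 1 - int (lkp \<alpha> (j, l)))"
    unfolding gdeg_def using j by (intro sum.cong refl X_end) (auto simp: xvars_def)
  also have "\<dots> = - (int (ns j) + 1) - int (group_deg ns \<alpha> j)"
    by (simp add: sum_subtractf group_deg_def)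
  also have "group_deg ns \<alpha> j = \<mu> j" using alpha j by (simp add: expts_def)
  finally show ?thesis .
qed

text \<open>The chain at level \<open>k\<close> of the zigzag from the Sylvester form to the inverse of the monomial
  \<open>x\<^sup>1\<^sup>+\<^sup>\<alpha>\<close>.\<close>

definition sc :: "nat \<Rightarrow> 'k chain" where
  "sc k T = (if T \<subseteq> {..<Suc n} \<and> card T = k
     then mterm (X k, 0) 1 * det (umat (Suc n) (sorted_list_of_set T) g) else 0)"

lemma Hom_zero: "supp (0 :: 'k laurent) \<subseteq> Hom e"
  by simp

text \<open>The degree of the minor is that of the remaining rows minus that of the remaining
  columns.\<close>

lemma det_umat_Hom:
  assumes T: "T \<subseteq> {..<Suc n}" "card T = k"
  shows "supp (det (umat (Suc n) (sorted_list_of_set T) g)) \<subseteq>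
    Hom (\<lambda>j. (\<Sum>i\<in>{..<Suc n} - T. int (d i j)) - (\<Sum>c\<in>{k..<Suc n}. gdeg (iexp (yexp \<alpha> (cl ! c))) j))"
proof -
  let ?ts = "sorted_list_of_set T"
  have fin: "finite T" using T finite_subset by blast
  have len: "length ?ts = k" using T(2) by simp
  have kn: "k \<le> Suc n" using card_mono[OF _ T(1)] T(2) by simp
  \<comment> \<open>A unit column gets the degree of the row containing its entry 1, so that this
    entry has degree 0, as \<open>Hom_det\<close> requires.\<close>
  define C where "C c j = (if c < k then int (d (?ts ! c) j) else gdeg (iexp (yexp \<alpha> (cl ! c))) j)" for c j
  have "supp (det (umat (Suc n) ?ts g)) \<subseteq> Hom (\<lambda>j. (\<Sum>i<Suc n. int (d i j)) - (\<Sum>c<Suc n. C c j))"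
  proof (rule Hom_det[OF umat_carrier])
    fix i c assume ic: "i < Suc n" "c < Suc n"
    show "supp (umat (Suc n) ?ts g $$ (i, c)) \<subseteq> Hom (\<lambda>j. int (d i j) - C c j)"
    proof (cases "c < k")
      case True
      then show ?thesis using ic Hom_one[where 'k='k] Hom_zero by (simp add: umat_def T(2) C_def)
    next
      case False
      then show ?thesis using ic supp_g[OF ic] by (simp add: umat_def T(2) C_def)
    qed
  qed
  moreover have "(\<Sum>i<Suc n. int (d i j)) - (\<Sum>c<Suc n. C c j) =
      (\<Sum>i\<in>{..<Suc n} - T. int (d i j)) - (\<Sum>c\<in>{k..<Suc n}. gdeg (iexp (yexp \<alpha> (cl ! c))) j)" for j
  proof -
    have "(\<Sum>c<Suc n. C c j) = (\<Sum>c<k. C c j) + (\<Sum>c\<in>{k..<Suc n}. C c j)"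
      by (rule sum_lessThan_split[OF kn])
    moreover have "(\<Sum>c<k. C c j) = (\<Sum>c<k. int (d (?ts ! c) j))"
      by (intro sum.cong) (auto simp: C_def)
    moreover have "\<dots> = (\<Sum>i\<in>T. int (d i j))"
    proof -
      have "bij_betw ((!) ?ts) {..<k} T"
        using bij_betw_nth[of ?ts "{..<k}" T] fin len by simp
      then show ?thesis by (rule sum.reindex_bij_betw)
    qed
    moreover have "(\<Sum>c\<in>{k..<Suc n}. C c j) = (\<Sum>c\<in>{k..<Suc n}. gdeg (iexp (yexp \<alpha> (cl ! c))) j)"
      by (intro sum.cong) (auto simp: C_def)
    moreover have "(\<Sum>i\<in>{..<Suc n} - T. int (d i j)) = (\<Sum>i<Suc n. int (d i j)) - (\<Sum>i\<in>T. int (d i j))"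
      using T(1) by (intro sum_diff) auto
    ultimately show ?thesis by simp
  qed
  ultimately show ?thesis by simp
qed

lemma sc_P:
  assumes k: "k \<le> Suc n" and A: "\<And>v. v \<in> A \<Longrightarrow> 0 \<le> lkp (X k) v"
  shows "sc k \<in> \<P> A k"
  unfolding Pc_def
proof (intro CollectI conjI allI impI)
  fix T
  { assume "sc k T \<noteq> 0"
    then show "T \<subseteq> {..<Suc n}" "card T = k" by (auto simp: sc_def split: if_splits) }
  show "supp (sc k T) \<subseteq> Reg A T"
  proof (cases "T \<subseteq> {..<Suc n} \<and> card T = k")
    case True
    have "supp (mterm (X k, 0) 1 * det (umat (Suc n) (sorted_list_of_set T) g)) \<subseteq> Reg A T"
    proof (rule supp_multI)
      fix x y assume "x \<in> supp (mterm (X k, 0) 1 :: 'k laurent)"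
        and "y \<in> supp (det (umat (Suc n) (sorted_list_of_set T) g))"
      then have x: "x = (X k, 0)" and y: "y \<in> Hom (\<lambda>j. (\<Sum>i\<in>{..<Suc n} - T. int (d i j)) -
          (\<Sum>c\<in>{k..<Suc n}. gdeg (iexp (yexp \<alpha> (cl ! c))) j))"
        using supp_mterm det_umat_Hom[of T k] True by blast+
      have deg: "gdeg (X k + fst y) j = tdeg T j" if j: "j \<in> {1..r}" for j
      proof -
        \<comment> \<open>The minor lacks the degrees of the remaining column monomials; subtracting
          them from \<open>X k\<close> gives \<open>X (Suc n)\<close>, whose degree is
          known.\<close>
        have "(\<Sum>c<Suc n. gdeg (iexp (yexp \<alpha> (cl ! c))) j) =
            (\<Sum>c<k. gdeg (iexp (yexp \<alpha> (cl ! c))) j) + (\<Sum>c\<in>{k..<Suc n}. gdeg (iexp (yexp \<alpha> (cl ! c))) j)"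
          by (rule sum_lessThan_split[OF k])
        then have "gdeg (X k + fst y) j = gdeg (X (Suc n)) j + (\<Sum>i\<in>{..<Suc n} - T. int (d i j))"
          using y j by (simp add: Hom_def gdeg_add X_def gdeg_diff gdeg_sum del: sum.lessThan_Suc)
        then show ?thesis using True by (simp add: gdeg_X_end[OF j] tdeg_eq)
      qed
      have "0 \<le> lkp (X k + fst y) v" if "v \<in> A" for v
      proof -
        have "0 \<le> lkp (fst y) v" using y unfolding Hom_def by blast
        then show ?thesis using A[OF that] by (simp add: lookup_add)
      qed
      then show "x + y \<in> Reg A T"
        using y keys_X[OF k] deg unfolding x Reg_def Hom_def by (simp add: keys_add_subset)
    qed
    with True show ?thesis by (simp add: sc_def)
  qed (auto simp: sc_def)
qed

text \<open>For the error terms of the zigzag only the signs of the exponents matter, so their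
  degrees are not tracked.\<close>

lemma supp_rmat:
  assumes "T \<subseteq> {..<Suc n}" "card T = k" "k < Suc n" "c < Suc n"
    and x: "x \<in> supp (det (rmat (Suc n) (sorted_list_of_set T) (\<lambda>i. g i c) g))"
  shows "0 \<le> lkp (fst x) v"
proof -
  let ?M = "rmat (Suc n) (sorted_list_of_set T) (\<lambda>i. g i c) g"
  define P where "P = {x :: lexpo \<times> ((nat \<times> expo) \<Rightarrow>\<^sub>0 nat). \<forall>v. 0 \<le> lkp (fst x) v}"
  have HP: "Hom e \<subseteq> P" for e by (auto simp: Hom_def P_def)
  have g: "supp (g i c) \<subseteq> P" if "i < Suc n" "c < Suc n" for i c
    using order_trans[OF supp_g[OF that] HP] .
  have one: "supp (1 :: 'k laurent) \<subseteq> P" using order_trans[OF Hom_one HP] .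
  have mult: "supp (f * h) \<subseteq> P" if "supp f \<subseteq> P" "supp h \<subseteq> P" for f h :: "'k laurent"
  proof (rule supp_multI)
    fix x y assume "x \<in> supp f" "y \<in> supp h"
    with that have "x \<in> P" "y \<in> P" by blast+
    then show "x + y \<in> P" by (simp add: P_def lookup_add)
  qed
  have prod: "supp (prod f I) \<subseteq> P" if "\<And>i. i \<in> I \<Longrightarrow> supp (f i) \<subseteq> P" for f :: "nat \<Rightarrow> 'k laurent" and I
    using that by (induction I rule: infinite_finite_induct) (auto simp: one mult)
  have "supp (det ?M) \<subseteq> P"
    unfolding det_def'[OF rmat_carrier]
  proof (rule supp_sumI)
    fix p assume "p \<in> {p. p permutes {0..<Suc n}}"
    then have p: "p permutes {0..<Suc n}" by simp
    have "supp (\<Prod>i = 0..<Suc n. ?M $$ (i, p i)) \<subseteq> P"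
    proof (rule prod)
      fix i assume "i \<in> {0..<Suc n}"
      then have "i < Suc n" "p i < Suc n" using permutes_in_image[OF p, of i] by auto
      then show "supp (?M $$ (i, p i)) \<subseteq> P"
        using g assms(4) one by (simp add: rmat_def)
    qed
    moreover have "supp (signof p * x) = supp x" for x :: "'k laurent" by (simp add: sign_def)
    ultimately show "supp (signof p * (\<Prod>i = 0..<Suc n. ?M $$ (i, p i))) \<subseteq> P" by simp
  qed
  with x show ?thesis unfolding P_def by blast
qed

text \<open>By \<open>koszul_minors\<close> the boundary of level k + 1 is level k plus error terms
  for the columns c < k. Such a term is multiplied by the monomial of column c, which undoes the
  division by it; hence its exponent at the variable of column c is nonnegative, and this variable
  lies in B.\<close>

lemma sc_step:
  assumes k: "k < Suc n" and A: "\<And>v. v \<in> A \<Longrightarrow> 0 \<le> lkp (X (Suc k)) v"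
    and B: "\<And>c. c < k \<Longrightarrow> cl ! c \<in> B"
  shows "sc k - bd (sc (Suc k)) \<in> \<O> A B k"
proof -
  have A': "0 \<le> lkp (X k) v" if "v \<in> A" for v
    using A[OF that] by (simp add: X_Suc[of k] lookup_add)
  have P: "sc k - bd (sc (Suc k)) \<in> \<P> A k"
    using k A A' by (intro Pc_diff d_P sc_P) auto
  have "supp ((sc k - bd (sc (Suc k))) T) \<subseteq> Up B" for T
  proof (cases "T \<subseteq> {..<Suc n} \<and> card T = k")
    case False
    then have "(sc k - bd (sc (Suc k))) T = 0" using Pc_card[OF P] by blast
    then show ?thesis by (simp only: supp_zero empty_subsetI)
  next
    case True
    then have T: "T \<subseteq> {..<Suc n}" "card T = k" by auto
    have fin: "finite T" using T finite_subset by blast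
    let ?ts = "sorted_list_of_set T" and ?m = "mterm (X (Suc k), 0) 1 :: 'k laurent"
    let ?R = "\<lambda>c. det (rmat (Suc n) ?ts (\<lambda>i. g i c) g)"
    have len: "length ?ts = k" using T(2) by simp
    have "bd (sc (Suc k)) T = (\<Sum>i\<in>{..<Suc n} - T. sg i T * (F i * sc (Suc k) (insert i T)))"
      using T(1) by (simp only: D_def if_True)
    also have "\<dots> = (\<Sum>i\<in>{..<Suc n} - T. ?m * (F i * det (umat (Suc n) (?ts @ [i]) g)))"
    proof (rule sum.cong[OF refl])
      fix i assume i: "i \<in> {..<Suc n} - T"
      have "sc (Suc k) (insert i T) = ?m * det (umat (Suc n) (sorted_list_of_set (insert i T)) g)"
        using T i fin by (simp only: sc_def) auto
      moreover have "det (umat (Suc n) (?ts @ [i]) g) = sg i T * det (umat (Suc n) (sorted_list_of_set (insert i T)) g)"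
        using det_umat_sorted_insert[OF T(1), of i g] i by (simp only: sg_def) auto
      ultimately show "sg i T * (F i * sc (Suc k) (insert i T)) = ?m * (F i * det (umat (Suc n) (?ts @ [i]) g))"
        by (simp only: mult_ac)
    qed
    \<comment> \<open>The sum may run over all i, since i in T would repeat a unit column.\<close>
    also have "\<dots> = (\<Sum>i<Suc n. ?m * (F i * det (umat (Suc n) (?ts @ [i]) g)))"
    proof (rule sum.mono_neutral_left)
      show "\<forall>i\<in>{..<Suc n} - ({..<Suc n} - T). ?m * (F i * det (umat (Suc n) (?ts @ [i]) g)) = 0"
      proof
        fix i assume "i \<in> {..<Suc n} - ({..<Suc n} - T)"
        then have "i \<in> set ?ts" using fin by simp
        then obtain a where a: "a < k" "?ts ! a = i" unfolding in_set_conv_nth len by blast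
        have "det (umat (Suc n) (?ts @ [i]) g) = 0"
          using a k by (intro det_umat_identical[of _ _ a k]) (auto simp: T(2) nth_append)
        then show "?m * (F i * det (umat (Suc n) (?ts @ [i]) g)) = 0" by simp
      qed
    qed auto
    also have "\<dots> = ?m * (\<Sum>i<Suc n. F i * det (umat (Suc n) (?ts @ [i]) g))"
      by (rule sum_distrib_left[symmetric])
    also have "(\<Sum>i<Suc n. F i * det (umat (Suc n) (?ts @ [i]) g)) =
        Y k * det (umat (Suc n) ?ts g) + (\<Sum>c<k. Y c * ?R c)"
      using koszul_minors[of ?ts "Suc n" F Y g] F_decomp k unfolding len by blast
    also have "?m * (Y k * det (umat (Suc n) ?ts g) + (\<Sum>c<k. Y c * ?R c)) =
        sc k T + (\<Sum>c<k. ?m * (Y c * ?R c))"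
    proof -
      have "?m * Y k = mterm (X k, 0) 1"
        by (simp add: Y_def mterm_mult X_Suc[of k])
      then have "?m * (Y k * det (umat (Suc n) ?ts g)) = sc k T"
        using T by (simp add: sc_def flip: mult.assoc)
      then show ?thesis by (simp only: distrib_left sum_distrib_left)
    qed
    finally have bd: "bd (sc (Suc k)) T = sc k T + (\<Sum>c<k. ?m * (Y c * ?R c))" .
    have "(sc k - bd (sc (Suc k))) T = - (\<Sum>c<k. ?m * (Y c * ?R c))"
      unfolding minus_apply bd by (rule diff_add_self)
    moreover have "supp (\<Sum>c<k. ?m * (Y c * ?R c)) \<subseteq> Up B"
    proof (rule supp_sumI)
      fix c assume "c \<in> {..<k}"
      then have c: "c < k" by simp
      have cls: "cl ! c' \<in> set cl" if "c' < Suc n" for c' using that by simp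
      \<comment> \<open>Only column c contributes to the exponent of its own variable, so
        multiplying by its monomial restores the exponent of the prefactor.\<close>
      have zero: "lkp (X (Suc k)) (cl ! c) + int (lkp (yexp \<alpha> (cl ! c)) (cl ! c)) = int (lkp pref (cl ! c))"
      proof -
        have "(\<Sum>c'<Suc k. int (lkp (yexp \<alpha> (cl ! c')) (cl ! c))) =
            (\<Sum>c'<Suc k. if c' = c then int (lkp \<alpha> (cl ! c)) + 1 else 0)"
        proof (rule sum.cong[OF refl])
          fix c' assume "c' \<in> {..<Suc k}"
          then have "c' < Suc n" "c < Suc n" using c k by auto
          then show "int (lkp (yexp \<alpha> (cl ! c')) (cl ! c)) = (if c' = c then int (lkp \<alpha> (cl ! c)) + 1 else 0)"
            using yexp_diag[OF cls cls, of c' c \<alpha>] nth_eq_iff_index_eq[OF distinct_cl, of c' c] by simp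
        qed
        then show ?thesis
          using yexp_diag[OF cls cls, of c c \<alpha>] c k by (simp add: lookup_X del: sum.lessThan_Suc)
      qed
      show "supp (?m * (Y c * ?R c)) \<subseteq> Up B"
        unfolding mult.assoc[symmetric]
      proof (rule supp_multI)
        fix x y assume x: "x \<in> supp (?m * Y c)" and y: "y \<in> supp (?R c)"
        have "x = (X (Suc k), 0) + (iexp (yexp \<alpha> (cl ! c)), 0)"
          using x supp_mterm unfolding Y_def mterm_mult by blast
        then have "lkp (fst (x + y)) (cl ! c) = int (lkp pref (cl ! c)) + lkp (fst y) (cl ! c)"
          using zero by (simp add: lookup_add)
        moreover have "0 \<le> lkp (fst y) (cl ! c)"
          using supp_rmat[OF T k _ y] c k by simp
        ultimately show "x + y \<in> Up B" using B[OF c] unfolding Up_def by force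
      qed
    qed
    ultimately show ?thesis by (simp only: supp_uminus)
  qed
  with P show ?thesis by (simp add: Oc_def)
qed

end

section \<open>Order of the columns, the top degree, and scalar multiplication of chains\<close>

context multigraded begin

lemma take_cl:
  assumes "1 \<le> a" "a \<le> Suc r"
  shows "take (qs a) cl = concat (map gvs [1..<a])"
proof (cases "a = Suc r")
  case True
  then show ?thesis unfolding cl_eq using length_concat_gvs[of "Suc r"] by (simp del: upt_Suc)
next
  case False
  then show ?thesis using length_concat_gvs[of a] cl_split[of a] assms by (simp del: upt_Suc)
qed

lemma fst_cl_le:
  assumes "1 \<le> a" "a \<le> r" "c < qs (Suc a)"
  shows "fst (cl ! c) \<le> a"
proof -
  have "c < length (take (qs (Suc a)) cl)"
    using assms take_cl[of "Suc a"] length_concat_gvs[of "Suc a"] by simp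
  then have "cl ! c \<in> set (take (qs (Suc a)) cl)" by (metis nth_mem nth_take length_take min_less_iff_conj)
  then show ?thesis using take_cl[of "Suc a"] assms by (auto simp: gvs_iff simp del: upt_Suc)
qed

lemma set_take_cl_Suc:
  assumes "1 \<le> a" "a \<le> r"
  shows "set (take (qs (Suc a)) cl) = set (take (qs a) cl) \<union> set (gvs a)"
  using take_cl[of a] take_cl[of "Suc a"] assms by simp

lemma qs_le: "a \<le> r \<Longrightarrow> 1 \<le> a \<Longrightarrow> qs (Suc a) \<le> n"
  unfolding qs_def total_dim_def by (intro sum_mono2) auto

text \<open>The exponents \<open>- 1 - \<beta>\<close> of the top local cohomology.\<close>

definition negx :: "expo \<Rightarrow> lexpo" where
  "negx \<beta> = - iexp \<beta> - (\<Sum>v\<in>xvars r ns. Poly_Mapping.single v 1)"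

lemma lookup_negx: "lkp (negx \<beta>) v = - int (lkp \<beta> v) - (if v \<in> xvars r ns then 1 else 0)"
proof -
  have "(\<Sum>u\<in>xvars r ns. lkp (Poly_Mapping.single u (1::int)) v) = (\<Sum>u\<in>xvars r ns. if u = v then 1 else 0)"
    by (intro sum.cong refl) (simp add: lookup_single when_def)
  then show ?thesis using finite_xvars by (simp add: negx_def lookup_minus lookup_sum)
qed

text \<open>In top degree only the full index set carries a coefficient, of degree - (n_j + 1) -
  \<mu> j in group j. A monomial outside \<open>Up\<close> has all exponents negative, hence is
  x^(-1-\<beta>) with \<beta> of degree \<mu> j in group j; these monomials are all that
  survives.\<close>

lemma top_zero_iff:
  assumes e: "e \<in> \<P> {} (Suc n)"
  shows "e \<in> \<O> {} (xvars r ns) (Suc n) \<longleftrightarrow> (\<forall>\<beta>\<in>expts r ns \<mu>. lkp (e {..<Suc n}) (negx \<beta>) = 0)"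
proof
  assume O: "e \<in> \<O> {} (xvars r ns) (Suc n)"
  show "\<forall>\<beta>\<in>expts r ns \<mu>. lkp (e {..<Suc n}) (negx \<beta>) = 0"
  proof (intro ballI poly_mapping_eqI)
    fix \<beta> t
    have "(negx \<beta>, t) \<notin> Up (xvars r ns)" by (auto simp: Up_def lookup_negx)
    then have "(negx \<beta>, t) \<notin> supp (e {..<Suc n})" using O unfolding Oc_def by blast
    then show "lkp (lkp (e {..<Suc n}) (negx \<beta>)) t = lkp 0 t" by (simp add: supp_iff coef_def)
  qed
next
  assume z: "\<forall>\<beta>\<in>expts r ns \<mu>. lkp (e {..<Suc n}) (negx \<beta>) = 0"
  have "supp (e T) \<subseteq> Up (xvars r ns)" for T
  proof
    fix x assume x: "x \<in> supp (e T)"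
    then have "e T \<noteq> 0" by auto
    then have "T \<subseteq> {..<Suc n} \<and> card T = Suc n" using Pc_card[OF e] by blast
    then have T: "T = {..<Suc n}" using card_subset_eq[of "{..<Suc n}" T] by simp
    show "x \<in> Up (xvars r ns)"
    proof (rule ccontr)
      assume nUp: "x \<notin> Up (xvars r ns)"
      then have neg: "lkp (fst x) v < 0" if "v \<in> xvars r ns" for v using that by (force simp: Up_def)
      have xR: "x \<in> Reg {} T" using Pc_supp[OF e x] .
      then have kx: "Poly_Mapping.keys (fst x) \<subseteq> xvars r ns" by (simp add: Reg_def)
      define b where "b v = (if v \<in> xvars r ns then nat (- 1 - lkp (fst x) v) else 0)" for v
      define \<beta> where "\<beta> = Abs_poly_mapping b"
      have "finite {v. b v \<noteq> 0}"
        by (rule finite_subset[OF _ finite_xvars]) (auto simp: b_def split: if_splits)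
      then have lk: "lkp \<beta> = b" unfolding \<beta>_def by (rule lookup_Abs_poly_mapping)
      have negb: "negx \<beta> = fst x"
      proof (rule poly_mapping_eqI)
        fix v show "lkp (negx \<beta>) v = lkp (fst x) v"
          using neg[of v] kx by (cases "v \<in> xvars r ns") (auto simp: lookup_negx lk b_def in_keys_iff)
      qed
      have "group_deg ns \<beta> j = \<mu> j" if j: "j \<in> {1..r}" for j
      proof -
        have "gdeg (fst x) j = tdeg T j" using xR j by (simp add: Reg_def)
        then have "gdeg (fst x) j = - (int (ns j) + 1) - int (\<mu> j)" using tdeg_eq[of T j] T by simp
        moreover have "gdeg (fst x) j = (\<Sum>l=0..ns j. - int (lkp \<beta> (j, l)) - 1)"
          unfolding gdeg_def negb[symmetric] using j by (intro sum.cong refl) (simp add: lookup_negx xvars_def)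
        then have "gdeg (fst x) j = - int (group_deg ns \<beta> j) - (int (ns j) + 1)"
          by (simp add: group_deg_def sum_subtractf sum_negf)
        ultimately show ?thesis by simp
      qed
      moreover have "Poly_Mapping.keys \<beta> \<subseteq> xvars r ns"
        by (auto simp: in_keys_iff lk b_def split: if_splits)
      ultimately have "\<beta> \<in> expts r ns \<mu>" by (simp add: expts_def)
      with z have "lkp (e T) (fst x) = 0" using negb T by auto
      with x show False by (simp add: supp_iff coef_def)
    qed
  qed
  with e show "e \<in> \<O> {} (xvars r ns) (Suc n)" by (simp add: Oc_def)
qed

definition cmul :: "'k::comm_ring_1 coeff \<Rightarrow> 'k chain \<Rightarrow> 'k chain" where
  "cmul a f = (\<lambda>T. Poly_Mapping.single 0 a * f T)"

lemma supp_single: "supp (Poly_Mapping.single 0 a) \<subseteq> {x. fst x = 0 \<and> snd x \<in> Poly_Mapping.keys a}"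
  by (auto simp: supp_iff coef_def lookup_single when_def in_keys_iff split: if_splits)

lemma supp_cmul:
  assumes a: "a \<in> carrier (coeff_ring r ns d)" and f: "x \<in> supp (cmul a f T)"
  obtains t y where "Poly_Mapping.keys t \<subseteq> uvars r ns d" "y \<in> supp (f T)" "x = (fst y, t + snd y)"
proof -
  from f obtain z y where zy: "z \<in> supp (Poly_Mapping.single 0 a :: 'a laurent)" "y \<in> supp (f T)" "x = z + y"
    unfolding cmul_def by (rule supp_mult)
  have "fst z = 0" "snd z \<in> Poly_Mapping.keys a" using zy(1) supp_single[of a] by blast+
  moreover then have "Poly_Mapping.keys (snd z) \<subseteq> uvars r ns d"
    using a by (simp add: coeff_ring_def ring_on_def)
  ultimately show thesis using that[of "snd z" y] zy(2,3) by (simp add: prod_eq_iff)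
qed

lemma cmul_P:
  assumes a: "a \<in> carrier (coeff_ring r ns d)" and f: "f \<in> Pc N A q"
  shows "cmul a f \<in> Pc N A q"
  unfolding Pc_def
proof (intro CollectI conjI allI impI)
  fix T
  { assume "cmul a f T \<noteq> 0"
    then have "f T \<noteq> 0" by (auto simp: cmul_def)
    then show "T \<subseteq> {..<N}" "card T = q" using Pc_card[OF f] by blast+ }
  show "supp (cmul a f T) \<subseteq> Reg A T"
  proof
    fix x assume "x \<in> supp (cmul a f T)"
    then obtain t y where *: "Poly_Mapping.keys t \<subseteq> uvars r ns d" "y \<in> supp (f T)" "x = (fst y, t + snd y)"
      by (rule supp_cmul[OF a])
    then have "y \<in> Reg A T" using Pc_supp[OF f] by blast
    with * show "x \<in> Reg A T" by (simp add: Reg_def keys_add_subset)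
  qed
qed

lemma cmul_O:
  assumes a: "a \<in> carrier (coeff_ring r ns d)" and f: "f \<in> Oc N A B q"
  shows "cmul a f \<in> Oc N A B q"
proof -
  have "supp (cmul a f T) \<subseteq> Up B" for T
  proof
    fix x assume "x \<in> supp (cmul a f T)"
    then obtain t y where *: "y \<in> supp (f T)" "x = (fst y, t + snd y)"
      by (rule supp_cmul[OF a])
    then have "y \<in> Up B" using f unfolding Oc_def by blast
    with * show "x \<in> Up B" by (simp add: Up_def)
  qed
  then show ?thesis using cmul_P[OF a Oc_Pc[OF f]] by (simp add: Oc_def)
qed

lemma cmul_diff: "cmul a (f - g) = cmul a f - cmul a g"
  by (rule ext) (simp add: cmul_def right_diff_distrib)

lemma D_cmul: "D N (cmul a f) = cmul a (D N f)"
  by (rule ext) (simp add: D_def cmul_def sum_distrib_left mult_ac)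

lemma path_cmul:
  assumes a: "a \<in> carrier (coeff_ring r ns d)"
  shows "path A B vs q f e \<Longrightarrow> path A B vs q (cmul a f) (cmul a e)"
proof (induction vs arbitrary: B q f)
  case (Cons v vs)
  from Cons.prems obtain h where h: "h \<in> \<P> (A \<union> set vs) (Suc q)" "f - bd h \<in> \<O> (A \<union> set vs) B q"
    "path A (insert v B) vs (Suc q) h e" unfolding path.simps by blast
  have "cmul a f - bd (cmul a h) \<in> \<O> (A \<union> set vs) B q"
    using cmul_O[OF a h(2)] by (simp only: D_cmul cmul_diff)
  with cmul_P[OF a h(1)] Cons.IH[OF h(3)] show ?case unfolding path.simps by blast
qed simp

lemma rel_cmul:
  assumes a: "a \<in> carrier (coeff_ring r ns d)"
  shows "rel k A B f e \<Longrightarrow> rel k A B (cmul a f) (cmul a e)"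
proof (induction k arbitrary: B f)
  case 0
  then show ?case unfolding rel.simps by (rule path_cmul[OF a])
next
  case (Suc k)
  then show ?case unfolding rel.simps using path_cmul[OF a] by blast
qed

definition chain0 :: "'k::comm_ring_1 laurent \<Rightarrow> 'k chain" where
  "chain0 p = (\<lambda>T. if T = {} then p else 0)"

lemma chain0_diff: "chain0 (p - q) = chain0 p - chain0 q"
  by (rule ext) (simp add: chain0_def)

end

section \<open>From the Sylvester form to an inverse monomial\<close>

context sylvester begin

lemma sc_path:
  assumes "q + length vs \<le> Suc n" "\<And>i. i < length vs \<Longrightarrow> vs ! i = cl ! (q + i)"
    "\<And>c. c < q \<Longrightarrow> cl ! c \<in> B"
    "\<And>i v. i < length vs \<Longrightarrow> v \<in> A \<union> set (drop (Suc i) vs) \<Longrightarrow> 0 \<le> lkp (X (Suc (q + i))) v"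
  shows "path A B vs q (sc q) (sc (q + length vs))"
  using assms
proof (induction vs arbitrary: B q)
  case (Cons v vs)
  have "sc (Suc q) \<in> \<P> (A \<union> set vs) (Suc q)"
    using Cons.prems(1) Cons.prems(4)[of 0] by (intro sc_P) auto
  moreover have "sc q - bd (sc (Suc q)) \<in> \<O> (A \<union> set vs) B q"
    using Cons.prems(1,3) Cons.prems(4)[of 0] by (intro sc_step) auto
  moreover have "path A (insert v B) vs (Suc q) (sc (Suc q)) (sc (Suc q + length vs))"
  proof (rule Cons.IH)
    show "Suc q + length vs \<le> Suc n" using Cons.prems(1) by simp
    show "vs ! i = cl ! (Suc q + i)" if "i < length vs" for i
      using Cons.prems(2)[of "Suc i"] that by simp
    show "cl ! c \<in> insert v B" if "c < Suc q" for c
      using Cons.prems(2)[of 0] Cons.prems(3)[of c] that by (cases "c = q") auto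
    show "0 \<le> lkp (X (Suc (Suc q + i))) u" if "i < length vs" "u \<in> A \<union> set (drop (Suc i) vs)" for i u
      using Cons.prems(4)[of "Suc i" u] that by simp
  qed
  ultimately show ?case unfolding path.simps by auto
qed simp

lemma sc_X_nonneg:
  assumes a: "a \<in> {1..r}" and i: "qs a + i < Suc n" "qs a + i < qs (Suc a) \<or> a = r"
    and v: "fst v \<ge> a" "\<And>c. c \<le> qs a + i \<Longrightarrow> cl ! c \<noteq> v"
  shows "0 \<le> lkp (X (Suc (qs a + i))) v"
proof (rule X_nonneg)
  fix c assume c: "c < Suc (qs a + i)"
  have "fst (cl ! c) \<le> a"
  proof (cases "a = r")
    case True
    have "cl ! c \<in> set cl" using c i by simp
    then show ?thesis using True unfolding set_cl by simp
  next
    case False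
    then show ?thesis using fst_cl_le[of a c] a i c by auto
  qed
  then show "cl ! c \<noteq> v \<and> fst (cl ! c) \<le> fst v" using v c by auto
qed

text \<open>The columns are listed in the order in which \<open>rel\<close> moves the variables. The
  last variable of a group before r is no column, in accordance with its being inverted instead of
  moved.\<close>

lemma sc_rel:
  "k < r \<Longrightarrow> rel k {} (set (take (qs (r - k)) cl)) (sc (qs (r - k))) (sc (Suc n))"
proof (induction k)
  case 0
  let ?vs = "gvs r @ [(r, ns r)]"
  have q: "qs r + ns r = n" using qs_Suc[OF r_pos] qs_top by simp
  have nth: "?vs ! i = cl ! (qs r + i)" if "i < length ?vs" for i
  proof (cases "i < ns r")
    case True
    then show ?thesis using cl_nth[OF r_pos order_refl] by (simp add: nth_append) (simp add: gvs_def)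
  next
    case False
    then have "i = ns r" using that by simp
    then show ?thesis using cl_last q by (simp add: nth_append)
  qed
  have "path {} (set (take (qs r) cl)) ?vs (qs r) (sc (qs r)) (sc (qs r + length ?vs))"
  proof (rule sc_path)
    show "qs r + length ?vs \<le> Suc n" using q by simp
    show "cl ! c \<in> set (take (qs r) cl)" if "c < qs r" for c
      using that q by (auto simp: in_set_conv_nth intro!: exI[of _ c])
    fix i v assume i: "i < length ?vs" "v \<in> {} \<union> set (drop (Suc i) ?vs)"
    then have "v \<in> set (drop (Suc i) ?vs)" by blast
    then obtain j where j: "j < length (drop (Suc i) ?vs)" "drop (Suc i) ?vs ! j = v"
      unfolding in_set_conv_nth by blast
    have "drop (Suc i) ?vs ! j = ?vs ! (Suc i + j)" using i(1) by (intro nth_drop) simp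
    with j have v: "v = cl ! (qs r + (Suc i + j))" "Suc i + j < length ?vs"
      using nth[of "Suc i + j"] by auto
    show "0 \<le> lkp (X (Suc (qs r + i))) v"
    proof (rule sc_X_nonneg)
      have "v \<in> set ?vs" using i by (auto dest: in_set_dropD)
      then show "r \<le> fst v" by (auto simp: gvs_iff)
      show "cl ! c \<noteq> v" if "c \<le> qs r + i" for c
        unfolding v using that v(2) q nth_eq_iff_index_eq[OF distinct_cl, of c "qs r + (Suc i + j)"] by auto
    qed (use r_pos i q in auto)
  qed (use nth in blast)
  then show ?case using q by simp
next
  case (Suc k)
  define a where "a = r - Suc k"
  have a: "a \<in> {1..r}" "r - k = Suc a" "1 \<le> a" "a < r" using Suc.prems by (auto simp: a_def)
  have q: "qs (Suc a) = qs a + ns a" "qs (Suc a) \<le> n" using qs_Suc[OF a(3)] qs_le[of a] a by auto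
  have nth: "gvs a ! i = cl ! (qs a + i)" if "i < ns a" for i
    using cl_nth[of a i] a that by (simp add: gvs_def)
  have "path (insert (a, ns a) ({} \<union> rest (Suc a))) (set (take (qs a) cl)) (gvs a) (qs a) (sc (qs a)) (sc (qs a + length (gvs a)))"
  proof (rule sc_path)
    show "qs a + length (gvs a) \<le> Suc n" using q by simp
    show "cl ! c \<in> set (take (qs a) cl)" if "c < qs a" for c
      using that q by (auto simp: in_set_conv_nth intro!: exI[of _ c])
    fix i v assume i: "i < length (gvs a)" "v \<in> insert (a, ns a) ({} \<union> rest (Suc a)) \<union> set (drop (Suc i) (gvs a))"
    show "0 \<le> lkp (X (Suc (qs a + i))) v"
    proof (rule sc_X_nonneg)
      have cle: "fst (cl ! c) \<le> a \<and> cl ! c \<in> set cl" if "c \<le> qs a + i" for c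
        using fst_cl_le[of a c] that a i q by auto
      consider "v = (a, ns a)" | "v \<in> rest (Suc a)" | "v \<in> set (drop (Suc i) (gvs a))" using i(2) by blast
      then have "a \<le> fst v \<and> (\<forall>c \<le> qs a + i. cl ! c \<noteq> v)"
      proof cases
        case 1
        then have "v \<notin> set cl" using a(4) unfolding set_cl by auto
        moreover have "cl ! c \<in> set cl" if "c \<le> qs a + i" for c using cle[OF that] by blast
        ultimately have "\<forall>c \<le> qs a + i. cl ! c \<noteq> v" by metis
        then show ?thesis using 1 by simp
      next
        case 2
        then have "Suc a \<le> fst v" by (auto simp: rest_def grp_def)
        then show ?thesis using cle by fastforce
      next
        case 3
        then obtain j where j: "j < ns a - Suc i" "drop (Suc i) (gvs a) ! j = v"
          by (auto simp: in_set_conv_nth)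
        then have v: "v = cl ! (qs a + (Suc i + j))" "Suc i + j < ns a"
          using nth[of "Suc i + j"] by auto
        have "v \<in> set (gvs a)" using 3 by (rule in_set_dropD)
        then have "a \<le> fst v" by (simp add: gvs_iff)
        moreover have "cl ! c \<noteq> v" if "c \<le> qs a + i" for c
          unfolding v using that v(2) q nth_eq_iff_index_eq[OF distinct_cl, of c "qs a + (Suc i + j)"] by auto
        ultimately show ?thesis by blast
      qed
      then show "a \<le> fst v" "\<And>c. c \<le> qs a + i \<Longrightarrow> cl ! c \<noteq> v" by blast+
    qed (use a i q in auto)
  qed (use nth in simp)
  moreover have "rel k {} (set (take (qs a) cl) \<union> set (gvs a)) (sc (qs (Suc a))) (sc (Suc n))"
    using Suc.IH Suc.prems set_take_cl_Suc[of a] a by simp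
  ultimately show ?case unfolding rel.simps a_def[symmetric] a(2) using q(1) by auto
qed

lemma sc_0: "sc 0 = chain0 (emb (sylv_form r ns \<alpha> G))"
proof -
  have "emb (sylv_det r ns G) = det (umat (Suc n) [] g)"
  proof -
    interpret emb: comm_ring_hom "emb :: 'k cpoly \<Rightarrow> 'k laurent" by (rule emb_hom)
    have "map_mat emb (mat (Suc n) (Suc n) (\<lambda>(i, c). case cl ! c of (l, j) \<Rightarrow> G i l j)) = umat (Suc n) [] g"
      unfolding det_umat_Nil by (rule eq_matI) (auto simp: g_def split: prod.split)
    then show ?thesis by (simp add: sylv_det_def flip: emb.hom_det)
  qed
  moreover have "sylv_form r ns \<alpha> G = xm pref * sylv_det r ns G"
    by (simp add: sylv_form_def x_var_power xm_prod pref_def)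
  ultimately have e: "emb (sylv_form r ns \<alpha> G) = mterm (X 0, 0) 1 * det (umat (Suc n) [] g)"
    by (simp add: emb_mult emb_xm X_def)
  show ?thesis
  proof (rule ext)
    fix T show "sc 0 T = chain0 (emb (sylv_form r ns \<alpha> G)) T"
    proof (cases "T = {}")
      case True
      then show ?thesis unfolding chain0_def e sc_def by simp
    next
      case False
      then have "\<not> (T \<subseteq> {..<Suc n} \<and> card T = 0)"
        using finite_subset[of T "{..<Suc n}"] by (metis card_0_eq finite_lessThan)
      then show ?thesis using False by (simp only: sc_def chain0_def if_False)
    qed
  qed
qed

lemma sc_top: "sc (Suc n) {..<Suc n} = mterm (negx \<alpha>, 0) 1"
proof -
  have "X (Suc n) = negx \<alpha>"
  proof (rule poly_mapping_eqI)
    fix v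
    have "v \<notin> Poly_Mapping.keys (X (Suc n)) \<and> v \<notin> Poly_Mapping.keys \<alpha>" if "v \<notin> xvars r ns"
      using keys_X[of "Suc n"] alpha that by (auto simp: expts_def)
    then show "lkp (X (Suc n)) v = lkp (negx \<alpha>) v"
      using X_end[of v] by (cases "v \<in> xvars r ns") (simp_all add: lookup_negx in_keys_iff)
  qed
  moreover have "sorted_list_of_set {..<Suc n} = [0..<Suc n]"
    using sorted_list_of_set_range[of 0 "Suc n"] by (simp only: atLeast0LessThan)
  ultimately show ?thesis using det_umat_all[of "Suc n" g] by (simp only: sc_def) simp
qed

end

section \<open>The ideals in terms of supports\<close>

lemma ring_on_simps [simp]:
  "carrier (ring_on S) = S" "x \<otimes>\<^bsub>ring_on S\<^esub> y = x * y" "x \<oplus>\<^bsub>ring_on S\<^esub> y = x + y"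
  "\<one>\<^bsub>ring_on S\<^esub> = 1" "\<zero>\<^bsub>ring_on S\<^esub> = 0"
  by (simp_all add: ring_on_def)

lemma ring_on_cring:
  fixes S :: "'a::comm_ring_1 set"
  assumes S: "0 \<in> S" "1 \<in> S" "\<And>x y. x \<in> S \<Longrightarrow> y \<in> S \<Longrightarrow> x + y \<in> S"
    "\<And>x y. x \<in> S \<Longrightarrow> y \<in> S \<Longrightarrow> x * y \<in> S" "\<And>x. x \<in> S \<Longrightarrow> - x \<in> S"
  shows "cring (ring_on S)"
proof (rule cringI)
  show "abelian_group (ring_on S)"
  proof (rule abelian_groupI)
    fix x assume "x \<in> carrier (ring_on S)"
    then show "\<exists>y\<in>carrier (ring_on S). y \<oplus>\<^bsub>ring_on S\<^esub> x = \<zero>\<^bsub>ring_on S\<^esub>"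
      using S(5) by (intro bexI[of _ "- x"]) auto
  qed (use S in \<open>auto simp: add_ac\<close>)
  show "comm_monoid (ring_on S)"
    by (rule comm_monoidI) (use S in \<open>auto simp: mult_ac\<close>)
qed (auto simp: algebra_simps)

lemma ring_on_ideal:
  fixes S :: "'a::comm_ring_1 set"
  assumes R: "cring (ring_on S)" and I: "I \<subseteq> S" "0 \<in> I" "\<And>x y. x \<in> I \<Longrightarrow> y \<in> I \<Longrightarrow> x + y \<in> I"
    "\<And>x a. x \<in> I \<Longrightarrow> a \<in> S \<Longrightarrow> a * x \<in> I" and m: "\<And>x. x \<in> S \<Longrightarrow> - x \<in> S"
  shows "ideal I (ring_on S)"
proof (rule idealI)
  interpret cring "ring_on S" by (rule R)
  show "ring (ring_on S)" by (rule ring_axioms)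
  show "subgroup I (add_monoid (ring_on S))"
  proof (rule add.subgroupI)
    fix a assume a: "a \<in> I"
    then have aS: "a \<in> S" using I by blast
    have "\<ominus>\<^bsub>ring_on S\<^esub> a = - a"
      using aS m[OF aS] by (intro minus_equality) auto
    moreover have "- 1 * a \<in> I" using m[of 1] one_closed by (intro I(4)[OF a]) simp
    ultimately show "\<ominus>\<^bsub>ring_on S\<^esub> a \<in> I" by simp
  qed (use I in auto)
qed (use I in \<open>auto simp: mult.commute\<close>)

context multigraded begin

abbreviation R :: "'k::comm_ring_1 cpoly ring" where "R \<equiv> poly_ring r ns d"

abbreviation gI :: "'k::comm_ring_1 cpoly set" where "gI \<equiv> generic_ideal r ns d"

definition Cx :: "(expo \<times> ((nat \<times> expo) \<Rightarrow>\<^sub>0 nat)) set" where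
  "Cx = {x. Poly_Mapping.keys (fst x) \<subseteq> xvars r ns \<and> Poly_Mapping.keys (snd x) \<subseteq> uvars r ns d}"

lemma Cx_add: "x \<in> Cx \<Longrightarrow> y \<in> Cx \<Longrightarrow> x + y \<in> Cx"
  by (simp add: Cx_def keys_add_subset)

lemma R_carrier: "p \<in> carrier R \<longleftrightarrow> supp p \<subseteq> Cx"
proof
  assume p: "p \<in> carrier R"
  show "supp p \<subseteq> Cx"
  proof
    fix x assume "x \<in> supp p"
    then have "snd x \<in> Poly_Mapping.keys (lkp p (fst x))" "fst x \<in> Poly_Mapping.keys p"
      by (auto simp: supp_iff coef_def in_keys_iff)
    then show "x \<in> Cx" using p by (auto simp: Cx_def poly_ring_def coeff_ring_def)
  qed
next
  assume p: "supp p \<subseteq> Cx"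
  have *: "Poly_Mapping.keys m \<subseteq> xvars r ns \<and> Poly_Mapping.keys t \<subseteq> uvars r ns d"
    if "t \<in> Poly_Mapping.keys (lkp p m)" for m t
  proof -
    have "(m, t) \<in> supp p" using that by (simp add: supp_iff coef_def in_keys_iff)
    then have "(m, t) \<in> Cx" using p by blast
    then show ?thesis by (simp add: Cx_def)
  qed
  have "\<exists>t. t \<in> Poly_Mapping.keys (lkp p m)" if "m \<in> Poly_Mapping.keys p" for m
    using that by (metis all_not_in_conv in_keys_iff keys_eq_empty)
  then show "p \<in> carrier R" using * unfolding poly_ring_def coeff_ring_def by simp blast
qed

lemma R_simps [simp]:
  "x \<otimes>\<^bsub>R\<^esub> y = x * y" "x \<oplus>\<^bsub>R\<^esub> y = x + y" "\<one>\<^bsub>R\<^esub> = 1" "\<zero>\<^bsub>R\<^esub> = 0"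
  by (simp_all add: poly_ring_def)

lemma Cx_one: "supp (1 :: 'k::comm_ring_1 cpoly) \<subseteq> Cx"
  unfolding one_mterm using supp_mterm[of "0 :: expo \<times> ((nat \<times> expo) \<Rightarrow>\<^sub>0 nat)" "1 :: 'k"]
  by (auto simp: Cx_def)

lemma R_closed:
  fixes p q :: "'k::comm_ring_1 cpoly"
  shows "0 \<in> carrier R" "(1 :: 'k cpoly) \<in> carrier R"
    "p \<in> carrier R \<Longrightarrow> q \<in> carrier R \<Longrightarrow> p + q \<in> carrier R"
    "p \<in> carrier R \<Longrightarrow> q \<in> carrier R \<Longrightarrow> p - q \<in> carrier R"
    "p \<in> carrier R \<Longrightarrow> q \<in> carrier R \<Longrightarrow> p * q \<in> carrier R"
    "p \<in> carrier R \<Longrightarrow> - p \<in> carrier R"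
  unfolding R_carrier
  by (simp_all add: Cx_one supp_addI supp_diffI supp_multI Cx_add subset_iff[of _ Cx, THEN iffD1, rule_format])

lemma R_cring: "cring (R :: 'k::comm_ring_1 cpoly ring)"
proof -
  have "cring (ring_on (carrier R) :: 'k cpoly ring)"
    by (rule ring_on_cring) (rule R_closed; assumption)+
  then show ?thesis by (simp add: poly_ring_def)
qed

lemma R_ideal:
  fixes I :: "'k::comm_ring_1 cpoly set"
  assumes "I \<subseteq> carrier R" "0 \<in> I" "\<And>x y. x \<in> I \<Longrightarrow> y \<in> I \<Longrightarrow> x + y \<in> I"
    "\<And>x a. x \<in> I \<Longrightarrow> a \<in> carrier R \<Longrightarrow> a * x \<in> I"
  shows "ideal I R"
proof -
  have eq: "ring_on (carrier R) = (R :: 'k cpoly ring)" by (simp add: poly_ring_def)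
  have "ideal I (ring_on (carrier R))"
    by (rule ring_on_ideal[OF _ assms R_closed(6)]) (simp_all only: eq R_cring)
  then show ?thesis by (simp only: eq)
qed

lemma R_sum:
  fixes f :: "'i \<Rightarrow> 'k::comm_ring_1 cpoly"
  shows "(\<And>i. i \<in> S \<Longrightarrow> f i \<in> carrier R) \<Longrightarrow> sum f S \<in> carrier R"
  by (induction S rule: infinite_finite_induct) (auto simp: R_closed)

lemma R_prod:
  fixes f :: "'i \<Rightarrow> 'k::comm_ring_1 cpoly"
  shows "(\<And>i. i \<in> S \<Longrightarrow> f i \<in> carrier R) \<Longrightarrow> prod f S \<in> carrier R"
  by (induction S rule: infinite_finite_induct) (auto simp: R_closed)

lemma R_power:
  fixes p :: "'k::comm_ring_1 cpoly"
  shows "p \<in> carrier R \<Longrightarrow> p ^ k \<in> carrier R"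
  by (induction k) (auto simp: R_closed)

lemma R_det:
  fixes M :: "'k::comm_ring_1 cpoly mat"
  assumes M: "M \<in> carrier_mat N N" and e: "\<And>i c. i < N \<Longrightarrow> c < N \<Longrightarrow> M $$ (i, c) \<in> carrier R"
  shows "det M \<in> carrier R"
  unfolding det_def'[OF M]
proof (rule R_sum)
  fix p assume "p \<in> {p. p permutes {0..<N}}"
  then have p: "p permutes {0..<N}" by simp
  have "(\<Prod>i = 0..<N. M $$ (i, p i)) \<in> carrier R"
    using permutes_in_image[OF p] by (intro R_prod e) auto
  then show "signof p * (\<Prod>i = 0..<N. M $$ (i, p i)) \<in> carrier R"
    by (cases "evenperm p") (simp_all add: sign_def R_closed)
qed

lemma generic_R: "i \<le> n \<Longrightarrow> generic_poly r ns d i \<in> carrier R"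
  unfolding R_carrier
proof
  fix x assume i: "i \<le> n" and x: "x \<in> supp (generic_poly r ns d i :: 'k::comm_ring_1 cpoly)"
  have "iexp2 x \<in> supp (F i :: 'k laurent)" unfolding F_def supp_emb using x by blast
  then obtain \<alpha> where "\<alpha> \<in> expts r ns (d i)" "iexp2 x = fmon i \<alpha>" using supp_F by blast
  then have \<alpha>: "\<alpha> \<in> expts r ns (d i)" "fst x = \<alpha>" "snd x = Poly_Mapping.single (i, \<alpha>) 1"
    by (auto simp: iexp2_def fmon_def)
  then show "x \<in> Cx" using i by (auto simp: Cx_def expts_def uvars_def)
qed

lemma xm_R:
  assumes "Poly_Mapping.keys e \<subseteq> xvars r ns"
  shows "xm e \<in> carrier (R :: 'k::comm_ring_1 cpoly ring)"
proof -
  have "supp (mterm (e, 0) 1 :: 'k cpoly) \<subseteq> {(e, 0)}" by (rule supp_mterm)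
  also have "\<dots> \<subseteq> Cx" using assms by (simp add: Cx_def)
  finally show ?thesis unfolding R_carrier xm_mterm .
qed

lemma x_var_R: "v \<in> xvars r ns \<Longrightarrow> x_var v \<in> carrier R"
  using xm_R[of "Poly_Mapping.single v 1"] by (simp add: xm_def x_var_def)

lemma const_R: "a \<in> carrier (coeff_ring r ns d) \<Longrightarrow> const_poly a \<in> carrier R"
  unfolding R_carrier const_poly_def using supp_single[of a] 
  by (auto simp: Cx_def coeff_ring_def supp_iff coef_def lookup_single when_def in_keys_iff split: if_splits)

lemma gI_ideal: "ideal gI (R :: 'k::comm_ring_1 cpoly ring)"
proof -
  interpret cring "R :: 'k cpoly ring" by (rule R_cring)
  show ?thesis unfolding generic_ideal_def
    by (rule genideal_ideal) (auto intro: generic_R)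
qed

lemma gI_closed:
  fixes p q :: "'k::comm_ring_1 cpoly"
  shows "0 \<in> (gI :: 'k cpoly set)" "p \<in> gI \<Longrightarrow> q \<in> gI \<Longrightarrow> p + q \<in> gI"
    "p \<in> gI \<Longrightarrow> q \<in> carrier R \<Longrightarrow> q * p \<in> gI" "p \<in> gI \<Longrightarrow> p \<in> carrier R" "p \<in> gI \<Longrightarrow> - p \<in> gI"
    "p \<in> gI \<Longrightarrow> q \<in> gI \<Longrightarrow> p - q \<in> gI"
proof -
  interpret ideal gI "R :: 'k cpoly ring" by (rule gI_ideal)
  show "0 \<in> (gI :: 'k cpoly set)"
    using additive_subgroup.zero_closed[OF is_additive_subgroup] by simp
  show add: "p \<in> gI \<Longrightarrow> q \<in> gI \<Longrightarrow> p + q \<in> gI" for p q :: "'k cpoly" using additive_subgroup.a_closed[OF is_additive_subgroup, of p q] by simp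
  show mult: "p \<in> gI \<Longrightarrow> q \<in> carrier R \<Longrightarrow> q * p \<in> gI" for p q :: "'k cpoly" using I_l_closed[of p q] by simp
  show "p \<in> gI \<Longrightarrow> p \<in> carrier R" by (rule Icarr)
  show min: "p \<in> gI \<Longrightarrow> - p \<in> gI" for p :: "'k cpoly"
    using mult[of p "- 1"] R_closed(6)[OF R_closed(2)] by simp
  show "p \<in> gI \<Longrightarrow> q \<in> gI \<Longrightarrow> p - q \<in> gI" using add[of p "- q"] min[of q] by simp
qed

lemma gI_sum:
  fixes f :: "'i \<Rightarrow> 'k::comm_ring_1 cpoly"
  shows "(\<And>i. i \<in> S \<Longrightarrow> f i \<in> gI) \<Longrightarrow> sum f S \<in> gI"
  by (induction S rule: infinite_finite_induct) (auto simp: gI_closed)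

lemma generic_gI: "i \<le> n \<Longrightarrow> generic_poly r ns d i \<in> gI"
proof -
  interpret cring "R :: 'a cpoly ring" by (rule R_cring)
  assume i: "i \<le> n"
  have "generic_poly r ns d ` {0..n} \<subseteq> carrier (R :: 'a cpoly ring)" by (auto intro: generic_R)
  from genideal_self[OF this] have "generic_poly r ns d ` {0..n} \<subseteq> (gI :: 'a cpoly set)"
    by (simp only: generic_ideal_def)
  with i show "generic_poly r ns d i \<in> (gI :: 'a cpoly set)" unfolding image_subset_iff by simp
qed

lemma gI_iff:
  fixes p :: "'k::comm_ring_1 cpoly"
  shows "p \<in> gI \<longleftrightarrow> (\<exists>h. (\<forall>i<Suc n. h i \<in> carrier R) \<and> p = (\<Sum>i<Suc n. h i * generic_poly r ns d i))"
proof
  let ?F = "generic_poly r ns d :: nat \<Rightarrow> 'k cpoly"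
  let ?J = "{p. \<exists>h. (\<forall>i<Suc n. h i \<in> carrier R) \<and> p = (\<Sum>i<Suc n. h i * ?F i)}"
  interpret cring "R :: 'k cpoly ring" by (rule R_cring)
  assume p: "p \<in> gI"
  have FR: "?F i \<in> carrier R" if "i < Suc n" for i using that by (intro generic_R) simp
  have "ideal ?J R"
  proof (rule R_ideal)
    show "?J \<subseteq> carrier R" using FR by (auto intro!: R_sum R_closed simp del: sum.lessThan_Suc)
    show "0 \<in> ?J" by (auto intro!: exI[of _ "\<lambda>_. 0"] simp: R_closed)
    show "x + y \<in> ?J" if xy: "x \<in> ?J" "y \<in> ?J" for x y
    proof -
      from xy obtain h h' where "\<forall>i<Suc n. h i \<in> carrier R" "x = (\<Sum>i<Suc n. h i * ?F i)"
        "\<forall>i<Suc n. h' i \<in> carrier R" "y = (\<Sum>i<Suc n. h' i * ?F i)" by blast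
      then have "(\<forall>i<Suc n. h i + h' i \<in> carrier R) \<and> x + y = (\<Sum>i<Suc n. (h i + h' i) * ?F i)"
        by (simp add: R_closed distrib_right sum.distrib del: sum.lessThan_Suc)
      then show ?thesis by (intro CollectI exI[of _ "\<lambda>i. h i + h' i"])
    qed
    show "a * x \<in> ?J" if xy: "x \<in> ?J" "a \<in> carrier R" for x a
    proof -
      from xy obtain h where "\<forall>i<Suc n. h i \<in> carrier R" "x = (\<Sum>i<Suc n. h i * ?F i)" by blast
      then have "(\<forall>i<Suc n. a * h i \<in> carrier R) \<and> a * x = (\<Sum>i<Suc n. (a * h i) * ?F i)"
        using xy(2) by (simp add: R_closed sum_distrib_left mult.assoc del: sum.lessThan_Suc)
      then show ?thesis by (intro CollectI exI[of _ "\<lambda>i. a * h i"])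
    qed
  qed
  moreover have "?F ` {0..n} \<subseteq> ?J"
  proof
    fix q assume "q \<in> ?F ` {0..n}"
    then obtain i where "i \<in> {0..n}" "q = ?F i" by (rule imageE)
    then have i: "i < Suc n" "q = ?F i" by simp_all
    have "(\<Sum>j<Suc n. (if j = i then 1 else 0) * ?F j) = (\<Sum>j<Suc n. if j = i then ?F j else 0)"
      by (intro sum.cong) auto
    then have "q = (\<Sum>j<Suc n. (if j = i then 1 else 0) * ?F j)"
      using i by (simp del: sum.lessThan_Suc)
    moreover have "\<forall>j<Suc n. (if j = i then 1 else 0) \<in> carrier (R :: 'k cpoly ring)"
      by (simp add: R_closed)
    ultimately show "q \<in> ?J" by (intro CollectI exI[of _ "\<lambda>j. if j = i then 1 else 0"] conjI)
  qed
  ultimately have "gI \<subseteq> ?J" unfolding generic_ideal_def by (rule genideal_minimal)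
  then have "p \<in> ?J" using p by (rule subsetD)
  then show "\<exists>h. (\<forall>i<Suc n. h i \<in> carrier R) \<and> p = (\<Sum>i<Suc n. h i * ?F i)" by (rule CollectD)
next
  assume "\<exists>h. (\<forall>i<Suc n. h i \<in> carrier R) \<and> p = (\<Sum>i<Suc n. h i * generic_poly r ns d i)"
  then obtain h where h: "\<forall>i<Suc n. h i \<in> carrier R" "p = (\<Sum>i<Suc n. h i * generic_poly r ns d i)" by blast
  show "p \<in> gI" unfolding h(2)
  proof (rule gI_sum)
    fix i assume "i \<in> {..<Suc n}"
    then show "h i * generic_poly r ns d i \<in> gI" using h(1) generic_gI[of i] by (intro gI_closed(3)) auto
  qed
qed

subsection \<open>Boundaries in degree 0\<close>

definition nudeg :: "nat \<Rightarrow> int" where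
  "nudeg j = delta r ns d j - int (\<mu> j)"

lemma tdeg_empty: "tdeg {} j = nudeg j"
  by (simp add: tdeg_def nudeg_def)

lemma chain0_P:
  assumes p: "p \<in> carrier R" "multihomogeneous r ns nudeg p"
  shows "chain0 (emb p) \<in> \<P> A 0"
proof -
  have "supp (emb p) \<subseteq> Reg A {}"
  proof
    fix x assume "x \<in> supp (emb p)"
    then obtain y where y: "y \<in> supp p" "x = iexp2 y" unfolding supp_emb by blast
    then have "fst y \<in> Poly_Mapping.keys p" by (auto simp: supp_iff coef_def in_keys_iff)
    moreover have "y \<in> Cx" using p(1) y(1) R_carrier by blast
    ultimately show "x \<in> Reg A {}"
      using p(2) by (auto simp: Reg_def Cx_def y(2) iexp2_def gdeg_iexp tdeg_empty multihomogeneous_def)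
  qed
  then show ?thesis by (simp add: Pc_def chain0_def)
qed

lemma chain0_empty [simp]: "chain0 p {} = p"
  by (simp add: chain0_def)

text \<open>\<open>Reg\<close> without the multidegree: the cofactors in a combination of the F_i
  need not be homogeneous.\<close>

definition Px :: "(nat \<times> nat) set \<Rightarrow> (lexpo \<times> ((nat \<times> expo) \<Rightarrow>\<^sub>0 nat)) set" where
  "Px A = {x. Poly_Mapping.keys (fst x) \<subseteq> xvars r ns \<and> Poly_Mapping.keys (snd x) \<subseteq> uvars r ns d \<and>
     (\<forall>v\<in>A. 0 \<le> lkp (fst x) v)}"

lemma bd_chain1: "bd g {} = (\<Sum>i<Suc n. F i * g {i})"
proof -
  have "sg i {} * x = x" for i and x :: "'a laurent" by (simp add: sg_def)
  then show ?thesis by (simp add: D_def)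
qed

lemma chain1_bd:
  assumes "\<And>T. card T \<noteq> 1 \<Longrightarrow> g T = 0"
  shows "bd g = chain0 (\<Sum>i<Suc n. F i * g {i})"
proof (rule ext)
  fix T
  show "bd g T = chain0 (\<Sum>i<Suc n. F i * g {i}) T"
  proof (cases "T = {}")
    case True
    then show ?thesis using bd_chain1[of g] by (simp only: chain0_empty)
  next
    case False
    have "g (insert i T) = 0" if "i \<in> {..<Suc n} - T" "T \<subseteq> {..<Suc n}" for i
    proof (rule assms)
      have "finite T" using that(2) finite_subset by blast
      then show "card (insert i T) \<noteq> 1" using that False by simp
    qed
    then have "bd g T = 0" unfolding D_def by (auto intro!: sum.neutral)
    then show ?thesis using False by (simp only: chain0_def if_False)
  qed
qed

text \<open>Since p and the F i are homogeneous, only the component of f i of the complementary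
  degree contributes; these components form the required chain.\<close>

lemma bnd_of_sum:
  fixes f :: "nat \<Rightarrow> 'k::comm_ring_1 laurent"
  assumes p: "p \<in> carrier R" "multihomogeneous r ns nudeg p"
    and f: "\<And>i. i < Suc n \<Longrightarrow> supp (f i) \<subseteq> Px A" and e: "emb p = (\<Sum>i<Suc n. F i * f i)"
  shows "bnd A {} 0 (chain0 (emb p))"
proof -
  define h where "h i = flt (Reg A {i}) (f i)" for i
  define g where "g T = (if \<exists>i<Suc n. T = {i} then h (the_elem T) else 0)" for T
  have gi: "g {i} = h i" if "i < Suc n" for i using that by (simp add: g_def)
  have gP: "g \<in> \<P> A (Suc 0)"
    unfolding Pc_def
  proof (intro CollectI conjI allI impI)
    fix T
    { assume "g T \<noteq> 0"
      then show "T \<subseteq> {..<Suc n}" "card T = Suc 0" by (auto simp: g_def split: if_splits) }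
    show "supp (g T) \<subseteq> Reg A T" by (auto simp: g_def h_def supp_flt)
  qed
  have "emb p = (\<Sum>i<Suc n. F i * h i)"
  proof (rule coef_eqI)
    fix x
    have pR: "supp (emb p) \<subseteq> Reg A {}"
      using Pc_supp[OF chain0_P[OF p, of A], of _ "{}"] unfolding chain0_empty by blast
    have hR: "supp (\<Sum>i<Suc n. F i * h i) \<subseteq> Reg A {}"
    proof (rule supp_sumI, rule supp_multI)
      fix i y z assume i: "i \<in> {..<Suc n}" and y: "y \<in> supp (F i :: 'k laurent)" and z: "z \<in> supp (h i)"
      from y supp_F obtain \<beta> where "\<beta> \<in> expts r ns (d i)" "y = fmon i \<beta>" by blast
      moreover have "z \<in> Reg A {i}" using z by (simp add: h_def supp_flt)
      ultimately show "y + z \<in> Reg A {}" using i Reg_shift[of z A i "{}" \<beta>] by simp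
    qed
    show "coef (emb p) x = coef (\<Sum>i<Suc n. F i * h i) x"
    proof (cases "x \<in> Reg A {}")
      case False
      then have "x \<notin> supp (emb p)" "x \<notin> supp (\<Sum>i<Suc n. F i * h i)" using pR hR by blast+
      then show ?thesis unfolding supp_iff by simp
    next
      case True
      have "coef (F i * f i) x = coef (F i * h i) x" if i: "i < Suc n" for i
      proof -
        have "F i * f i = F i * h i + F i * flt (- Reg A {i}) (f i)"
          unfolding h_def distrib_left[symmetric] flt_compl[symmetric] ..
        moreover have "x \<notin> supp (F i * flt (- Reg A {i}) (f i))"
        proof
          assume "x \<in> supp (F i * flt (- Reg A {i}) (f i))"
          then obtain y z where y: "y \<in> supp (F i :: 'k laurent)" and z: "z \<in> supp (flt (- Reg A {i}) (f i))"
            and x: "x = y + z" by (rule supp_mult)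
          from y supp_F obtain \<beta> where \<beta>: "\<beta> \<in> expts r ns (d i)" "y = fmon i \<beta>" by blast
          have z': "z \<in> Px A" "z \<notin> Reg A {i}" using z f[OF i] by (auto simp: supp_flt)
          then obtain j where j: "j \<in> {1..r}" "gdeg (fst z) j \<noteq> tdeg {i} j"
            by (auto simp: Px_def Reg_def)
          have "gdeg (fst x) j = tdeg {} j" using True j(1) by (simp add: Reg_def)
          then have "int (d i j) + gdeg (fst z) j = tdeg {} j"
            unfolding x \<beta>(2) using expts_gdeg[OF \<beta>(1) j(1)] by (simp add: fmon_def gdeg_add)
          then show False using j(2) tdeg_insert[of "{}" i j] by simp
        qed
        ultimately show ?thesis by (simp add: coef_add supp_iff)
      qed
      then show ?thesis unfolding e coef_sum by (intro sum.cong) auto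
    qed
  qed
  also have "\<dots> = (\<Sum>i<Suc n. F i * g {i})" by (intro sum.cong) (auto simp: gi)
  finally have "chain0 (emb p) = bd g"
    using chain1_bd[of g] by (simp add: g_def) (metis One_nat_def card_1_singleton_iff)
  then have "chain0 (emb p) - bd g = 0" by (simp only: diff_self)
  then show ?thesis unfolding bnd_def using gP chain0_P[OF p, of A] Oc_zero by metis
qed

text \<open>With all variables polynomial and none moved this is the Koszul complex over C itself,
  with nothing divided out.\<close>

lemma gI_bnd:
  fixes p :: "'k::comm_ring_1 cpoly"
  assumes p: "p \<in> carrier R" "multihomogeneous r ns nudeg p"
  shows "p \<in> gI \<longleftrightarrow> bnd (xvars r ns) {} 0 (chain0 (emb p))"
proof
  assume "p \<in> gI"
  then obtain h where h: "\<forall>i<Suc n. h i \<in> carrier R" "p = (\<Sum>i<Suc n. h i * generic_poly r ns d i)"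
    unfolding gI_iff by blast
  show "bnd (xvars r ns) {} 0 (chain0 (emb p))"
  proof (rule bnd_of_sum[OF p])
    show "supp (emb (h i)) \<subseteq> Px (xvars r ns)" if "i < Suc n" for i
    proof
      fix x assume "x \<in> supp (emb (h i))"
      then obtain y where y: "y \<in> supp (h i)" "x = iexp2 y" unfolding supp_emb by blast
      moreover have "y \<in> Cx" using h(1) that y(1) R_carrier by blast
      ultimately show "x \<in> Px (xvars r ns)" by (simp add: Px_def Cx_def iexp2_def)
    qed
    show "emb p = (\<Sum>i<Suc n. F i * emb (h i))"
      unfolding h(2) emb_sum emb_mult F_def by (simp only: mult.commute)
  qed
next
  assume "bnd (xvars r ns) {} 0 (chain0 (emb p))"
  then obtain g where g: "g \<in> \<P> (xvars r ns) (Suc 0)" "chain0 (emb p) - bd g = 0"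
    unfolding bnd_def Oc_empty by blast
  have "chain0 (emb p) {} = bd g {}" using g(2) by (simp only: right_minus_eq)
  then have e: "emb p = (\<Sum>i<Suc n. F i * g {i})" by (simp only: bd_chain1 chain0_empty)
  have "\<exists>h. h \<in> carrier R \<and> g {i} = emb h" for i
  proof -
    have gR: "x \<in> Reg (xvars r ns) {i}" if "x \<in> supp (g {i})" for x using Pc_supp[OF g(1) that] .
    have "0 \<le> lkp (fst x) v" if "x \<in> supp (g {i})" for x v
    proof (cases "v \<in> xvars r ns")
      case False
      then have "v \<notin> Poly_Mapping.keys (fst x)" using gR[OF that] unfolding Reg_def by blast
      then show ?thesis by (simp add: in_keys_iff)
    qed (use gR[OF that] in \<open>simp add: Reg_def\<close>)
    then obtain h where h: "g {i} = emb h" using emb_surj[of "g {i}"] by blast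
    have "supp h \<subseteq> Cx"
    proof
      fix y assume "y \<in> supp h"
      then have "iexp2 y \<in> supp (g {i})" unfolding h supp_emb by blast
      from gR[OF this] show "y \<in> Cx" by (simp add: Reg_def Cx_def iexp2_def)
    qed
    with h show ?thesis using R_carrier by blast
  qed
  then obtain h where h: "\<And>i. h i \<in> carrier R" "\<And>i. g {i} = emb (h i)" by metis
  have "emb p = emb (\<Sum>i<Suc n. h i * generic_poly r ns d i)"
    unfolding e emb_sum emb_mult F_def h(2) by (simp only: mult.commute)
  then have eq: "p = (\<Sum>i<Suc n. h i * generic_poly r ns d i)" unfolding emb_inject .
  show "p \<in> gI" unfolding gI_iff by (intro exI[of _ h] conjI allI impI h(1)) (rule eq)
qed

end

context multigraded begin

subsection \<open>The irrelevant ideal\<close>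

text \<open>These degree ideals bound the powers of the irrelevant ideal from above, one group at a
  time, without a description of all their elements.\<close>

definition Jg :: "nat \<Rightarrow> nat \<Rightarrow> 'k::comm_ring_1 cpoly set" where
  "Jg j N = {q \<in> carrier R. \<forall>x\<in>supp q. N \<le> group_deg ns (fst x) j}"

lemma group_deg_add: "group_deg ns (a + b) j = group_deg ns a j + group_deg ns b j"
  by (simp add: group_deg_def lookup_add sum.distrib)

lemma Jg_mult:
  fixes p q :: "'k::comm_ring_1 cpoly"
  assumes "p \<in> Jg j M" "q \<in> Jg j N" shows "p * q \<in> Jg j (M + N)"
proof -
  have "supp (p * q) \<subseteq> {x. M + N \<le> group_deg ns (fst x) j}"
  proof (rule supp_multI)
    fix x y assume "x \<in> supp p" "y \<in> supp q"
    then have "M \<le> group_deg ns (fst x) j" "N \<le> group_deg ns (fst y) j" using assms by (auto simp: Jg_def)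
    then show "x + y \<in> {x. M + N \<le> group_deg ns (fst x) j}" by (simp add: group_deg_add)
  qed
  with assms show ?thesis by (auto simp: Jg_def R_closed)
qed

lemma Jg_add:
  fixes p q :: "'k::comm_ring_1 cpoly"
  assumes "p \<in> Jg j N" "q \<in> Jg j N" shows "p + q \<in> Jg j N"
  using assms supp_add[of p q] by (auto simp: Jg_def R_closed)

lemma Jg_0: "carrier (R :: 'k::comm_ring_1 cpoly ring) = Jg j 0"
  by (auto simp: Jg_def)

lemma Jg_ideal: "ideal (Jg j N) (R :: 'k::comm_ring_1 cpoly ring)"
proof (rule R_ideal)
  fix x a :: "'k cpoly" assume "x \<in> Jg j N" "a \<in> carrier R"
  then show "a * x \<in> Jg j N" using Jg_mult[of a j 0 x N] Jg_0 by auto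
next
  fix x y :: "'k cpoly" assume "x \<in> Jg j N" "y \<in> Jg j N"
  then show "x + y \<in> Jg j N" by (rule Jg_add)
qed (auto simp: Jg_def R_closed)

lemma ideals_set_simps:
  "I \<otimes>\<^bsub>ideals_set R\<^esub> J = ideal_prod R I J" "\<one>\<^bsub>ideals_set R\<^esub> = carrier R"
  "I \<in> carrier (ideals_set R) \<longleftrightarrow> ideal I R"
  by (simp_all add: ideals_set_def)

lemma group_ideal_props:
  assumes j: "j \<in> {1..r}"
  shows "ideal (group_ideal r ns d j) (R :: 'k::comm_ring_1 cpoly ring)"
    "group_ideal r ns d j \<subseteq> (Jg j 1 :: 'k cpoly set)"
    "l \<le> ns j \<Longrightarrow> x_var (j, l) \<in> (group_ideal r ns d j :: 'k cpoly set)"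
proof -
  interpret cring "R :: 'k cpoly ring" by (rule R_cring)
  let ?S = "(\<lambda>l. x_var (j, l)) ` {0..ns j} :: 'k cpoly set"
  have SR: "?S \<subseteq> carrier R" using j by (auto intro!: x_var_R simp: xvars_def)
  show "ideal (group_ideal r ns d j) (R :: 'k cpoly ring)"
    unfolding group_ideal_def by (rule genideal_ideal[OF SR])
  show "x_var (j, l) \<in> (group_ideal r ns d j :: 'k cpoly set)" if "l \<le> ns j"
    unfolding group_ideal_def using genideal_self[OF SR] that by (auto simp: image_subset_iff)
  have "?S \<subseteq> Jg j 1"
  proof
    fix q assume q: "q \<in> ?S"
    then obtain l where l: "l \<le> ns j" "q = x_var (j, l)" by auto
    have "q = mterm (Poly_Mapping.single (j, l) 1, 0) 1" unfolding l(2) by (simp add: x_var_def mterm_def)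
    then have "supp q \<subseteq> {(Poly_Mapping.single (j, l) 1, 0)}" using supp_mterm by simp
    moreover have "group_deg ns (Poly_Mapping.single (j, l) 1) j \<ge> 1"
    proof -
      have "lkp (Poly_Mapping.single (j, l) (1::nat)) (j, l) \<le> group_deg ns (Poly_Mapping.single (j, l) 1) j"
        unfolding group_deg_def using l(1) by (intro member_le_sum) auto
      then show ?thesis by simp
    qed
    ultimately show "q \<in> Jg j 1" using q SR by (auto simp: Jg_def)
  qed
  then show "group_ideal r ns d j \<subseteq> (Jg j 1 :: 'k cpoly set)"
    unfolding group_ideal_def by (rule genideal_minimal[OF Jg_ideal])
qed

lemma prod_ideals:
  fixes S :: "nat set"
  assumes "finite S" "S \<subseteq> {1..r}"
  defines "Q \<equiv> \<lambda>S. (\<Otimes>\<^bsub>ideals_set R\<^esub>j\<in>S. group_ideal r ns d j) :: 'k::comm_ring_1 cpoly set"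
  shows "ideal (Q S) R \<and> (\<forall>j\<in>S. Q S \<subseteq> Jg j 1) \<and>
    (\<forall>s. (\<forall>j\<in>S. s j \<le> ns j) \<longrightarrow> (\<Prod>j\<in>S. x_var (j, s j)) \<in> Q S)"
  using assms(1,2)
proof (induction S rule: finite_induct)
  case empty
  interpret cring "R :: 'k cpoly ring" by (rule R_cring)
  interpret ISet: comm_monoid "ideals_set (R :: 'k cpoly ring)" by (rule ideals_set_is_comm_monoid)
  have "Q {} = carrier R" by (simp add: Q_def ideals_set_simps)
  then show ?case using oneideal R_closed(2) by simp
next
  case (insert i S)
  interpret cring "R :: 'k cpoly ring" by (rule R_cring)
  interpret ISet: comm_monoid "ideals_set (R :: 'k cpoly ring)" by (rule ideals_set_is_comm_monoid)
  have i: "i \<in> {1..r}" "S \<subseteq> {1..r}" using insert.prems by auto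
  note gi = group_ideal_props[OF i(1), where 'k='k]
  have Q: "Q (insert i S) = ideal_prod R (group_ideal r ns d i) (Q S)"
    unfolding Q_def using insert.hyps group_ideal_props(1)[where 'k='k] i
    by (subst ISet.finprod_insert) (auto simp: ideals_set_simps)
  have IH: "ideal (Q S) R" "\<forall>j\<in>S. Q S \<subseteq> Jg j 1"
    "\<forall>s. (\<forall>j\<in>S. s j \<le> ns j) \<longrightarrow> (\<Prod>j\<in>S. x_var (j, s j)) \<in> Q S"
    using insert.IH[OF i(2)] by blast+
  have "Q (insert i S) \<subseteq> group_ideal r ns d i \<inter> Q S"
    unfolding Q by (rule ideal_prod_inter[OF gi(1) IH(1)])
  then have "\<forall>j\<in>insert i S. Q (insert i S) \<subseteq> Jg j 1" using gi(2) IH(2) by blast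
  moreover have "ideal (Q (insert i S)) R" unfolding Q by (rule ideal_prod_is_ideal[OF gi(1) IH(1)])
  moreover have "(\<Prod>j\<in>insert i S. x_var (j, s j)) \<in> Q (insert i S)" if s: "\<forall>j\<in>insert i S. s j \<le> ns j" for s
  proof -
    have "x_var (i, s i) \<otimes>\<^bsub>R\<^esub> (\<Prod>j\<in>S. x_var (j, s j)) \<in> Q (insert i S)"
      unfolding Q using s IH(3) gi(3) by (intro ideal_prod.prod) auto
    then show ?thesis using insert.hyps by simp
  qed
  ultimately show ?case by blast
qed

abbreviation bpow :: "nat \<Rightarrow> 'k::comm_ring_1 cpoly set" where
  "bpow N \<equiv> irrelevant_ideal r ns d [^]\<^bsub>ideals_set R\<^esub> N"

lemma xm_sec_power:
  "xm (sec_expo s (\<lambda>_. Suc N)) = xm (sec_expo s (\<lambda>_. N)) * (\<Prod>j\<in>{1..r}. x_var (j, s j))"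
proof -
  have "(\<Prod>j\<in>{1..r}. x_var (j, s j)) = (\<Prod>j\<in>{1..r}. xm (Poly_Mapping.single (j, s j) 1) :: 'a cpoly)"
    by (simp add: xm_def x_var_def)
  then show ?thesis
    by (simp add: xm_prod xm_mult sec_expo_def sum.distrib[symmetric] single_add[symmetric])
qed

text \<open>Two bounds replace an explicit description of the powers. The upper one, by
  \<open>Jg\<close>, serves to show that Sylvester forms are in the saturation; the lower one, the
  powers of one variable per group, serves to restrict elements of the saturation to a
  chart.\<close>

lemma bpow_props:
  "ideal (bpow N) (R :: 'k::comm_ring_1 cpoly ring) \<and> (\<forall>j\<in>{1..r}. bpow N \<subseteq> (Jg j N :: 'k cpoly set)) \<and>
    (\<forall>s. (\<forall>j\<in>{1..r}. s j \<le> ns j) \<longrightarrow> xm (sec_expo s (\<lambda>_. N)) \<in> (bpow N :: 'k cpoly set)) \<and>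
    bpow (Suc N) \<subseteq> (bpow N :: 'k cpoly set)"
proof -
  interpret cring "R :: 'k cpoly ring" by (rule R_cring)
  interpret ISet: comm_monoid "ideals_set (R :: 'k cpoly ring)" by (rule ideals_set_is_comm_monoid)
  let ?b = "irrelevant_ideal r ns d :: 'k cpoly set"
  have b: "ideal ?b R" "\<forall>j\<in>{1..r}. ?b \<subseteq> Jg j 1"
    "\<And>s. (\<forall>j\<in>{1..r}. s j \<le> ns j) \<Longrightarrow> (\<Prod>j\<in>{1..r}. x_var (j, s j)) \<in> ?b"
    unfolding irrelevant_ideal_def using prod_ideals[of "{1..r}", where 'k='k] by blast+
  have Suc: "bpow (Suc N) = ideal_prod R (bpow N) ?b" for N
    by (simp add: ideals_set_simps)
  have main: "ideal (bpow N :: 'k cpoly set) R \<and> (\<forall>j\<in>{1..r}. bpow N \<subseteq> (Jg j N :: 'k cpoly set)) \<and>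
    (\<forall>s. (\<forall>j\<in>{1..r}. s j \<le> ns j) \<longrightarrow> xm (sec_expo s (\<lambda>_. N)) \<in> (bpow N :: 'k cpoly set))" for N
  proof (induction N)
    case 0
    have "sec_expo s (\<lambda>_. 0) = 0" for s by (simp add: sec_expo_def)
    then show ?case using oneideal R_closed(2)[where 'k='k] by (simp add: ideals_set_simps Jg_0[symmetric])
  next
    case (Suc N)
    have "bpow (Suc N) \<subseteq> (Jg j (Suc N) :: 'k cpoly set)" if j: "j \<in> {1..r}" for j
    proof
      fix x :: "'k cpoly" assume "x \<in> bpow (Suc N)"
      then have "x \<in> ideal_prod R (bpow N) ?b" by (simp only: \<open>\<And>N. bpow (Suc N) = ideal_prod R (bpow N) ?b\<close>)
      then show "x \<in> Jg j (Suc N)"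
      proof (induction rule: ideal_prod.induct)
        case (prod p q)
        then have "p \<in> Jg j N" "q \<in> Jg j 1" using Suc.IH b(2) j by blast+
        from Jg_mult[OF this] show ?case by simp
      next
        case (sum p q)
        then show ?case using Jg_add by simp
      qed
    qed
    moreover have "ideal (bpow (Suc N) :: 'k cpoly set) R"
      unfolding \<open>\<And>N. bpow (Suc N) = ideal_prod R (bpow N) ?b\<close> using Suc.IH b(1) by (intro ideal_prod_is_ideal) auto
    moreover have "xm (sec_expo s (\<lambda>_. Suc N)) \<in> (bpow (Suc N) :: 'k cpoly set)"
      if s: "\<forall>j\<in>{1..r}. s j \<le> ns j" for s
    proof -
      have "xm (sec_expo s (\<lambda>_. N)) \<in> (bpow N :: 'k cpoly set)" using Suc.IH s by blast
      from ideal_prod.prod[OF this b(3)[OF s], of R] show ?thesis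
        unfolding \<open>\<And>N. bpow (Suc N) = ideal_prod R (bpow N) ?b\<close> xm_sec_power by simp
    qed
    ultimately show ?case by blast
  qed
  have "ideal_prod R (bpow N) ?b \<subseteq> bpow N \<inter> ?b"
    using main[of N] b(1) by (intro ideal_prod_inter) auto
  then have "bpow (Suc N) \<subseteq> (bpow N :: 'k cpoly set)" unfolding Suc by blast
  with main[of N] show ?thesis by blast
qed

lemma bpow_mono: "M \<le> N \<Longrightarrow> bpow N \<subseteq> (bpow M :: 'k::comm_ring_1 cpoly set)"
proof (induction N rule: dec_induct)
  case (step N)
  then show ?case using bpow_props[of N, where 'k='k] by blast
qed simp

abbreviation sat :: "'k::comm_ring_1 cpoly set" where "sat \<equiv> saturation r ns d"

lemma sat_closed:
  fixes p q :: "'k::comm_ring_1 cpoly"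
  shows "p \<in> sat \<Longrightarrow> q \<in> sat \<Longrightarrow> p + q \<in> sat" "p \<in> sat \<Longrightarrow> a \<in> carrier R \<Longrightarrow> a * p \<in> sat"
    "(0 :: 'k cpoly) \<in> sat" "p \<in> sat \<Longrightarrow> p \<in> carrier R"
proof -
  show "p \<in> sat \<Longrightarrow> p \<in> carrier R" by (simp add: saturation_def)
  show "(0 :: 'k cpoly) \<in> sat" by (simp add: saturation_def R_closed gI_closed)
  show "a * p \<in> sat" if p: "p \<in> sat" and a: "a \<in> carrier R"
  proof -
    from p obtain N where N: "p \<in> carrier R" "\<forall>b\<in>bpow N. b * p \<in> gI" by (auto simp: saturation_def)
    have "b * (a * p) \<in> gI" if "b \<in> bpow N" for b
      using gI_closed(3)[of "b * p" a] N that a by (simp add: mult.left_commute)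
    then show ?thesis using R_closed(5)[OF a N(1)] unfolding saturation_def by blast
  qed
  show "p + q \<in> sat" if pq: "p \<in> sat" "q \<in> sat"
  proof -
    from pq obtain M N where *: "p \<in> carrier R" "\<forall>b\<in>bpow M. b * p \<in> gI" "q \<in> carrier R" "\<forall>b\<in>bpow N. b * q \<in> gI"
      by (auto simp: saturation_def)
    have "b * (p + q) \<in> gI" if "b \<in> bpow (max M N)" for b
    proof -
      have "b \<in> bpow M" "b \<in> bpow N"
        using that bpow_mono[of M "max M N"] bpow_mono[of N "max M N"] by auto
      then show ?thesis using * gI_closed(2)[of "b * p" "b * q"] by (simp add: distrib_left)
    qed
    then show ?thesis using R_closed(3)[OF *(1,3)] unfolding saturation_def by blast
  qed
qed

text \<open>The N-th power of the product of the section variables multiplies p into the ideal; on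
  the chart this monomial is invertible and can be divided out again.\<close>

lemma sat_good:
  fixes p :: "'k::comm_ring_1 cpoly"
  assumes p: "p \<in> sat" "multihomogeneous r ns nudeg p"
  shows "good (xvars r ns) {} 0 (chain0 (emb p))"
  unfolding good_def cyc_def
proof (intro conjI impI allI)
  have pR: "p \<in> carrier R" by (rule sat_closed(4)[OF p(1)])
  show P: "chain0 (emb p) \<in> \<P> (xvars r ns) 0" by (rule chain0_P[OF pR p(2)])
  show "bd (chain0 (emb p)) \<in> \<O> (xvars r ns) {} (0 - 1)" unfolding D_Pc0[OF P] by (rule Oc_zero)
  fix s assume s: "\<forall>j\<in>{1..r}. s j \<le> ns j"
  from p(1) obtain N where N: "\<forall>b\<in>bpow N. b * p \<in> gI" by (auto simp: saturation_def)
  define \<sigma> where "\<sigma> = sec_expo s (\<lambda>_. N)"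
  have "xm \<sigma> * p \<in> gI" using N bpow_props[of N, where 'k='k] s unfolding \<sigma>_def by blast
  then obtain h where h: "\<forall>i<Suc n. h i \<in> carrier R" "xm \<sigma> * p = (\<Sum>i<Suc n. h i * generic_poly r ns d i)"
    unfolding gI_iff by blast
  let ?m = "mterm (- iexp \<sigma>, 0) 1 :: 'k laurent"
  show "bnd (xvars r ns - secv s) {} 0 (chain0 (emb p))"
  proof (rule bnd_of_sum[OF pR p(2)])
    have "?m * emb (xm \<sigma>) = 1"
      by (simp add: emb_xm mterm_mult one_mterm zero_prod_def)
    then have "emb p = ?m * emb (xm \<sigma> * p)"
      unfolding emb_mult mult.assoc[symmetric] by simp
    also have "\<dots> = (\<Sum>i<Suc n. F i * (?m * emb (h i)))"
      unfolding h(2) emb_sum emb_mult F_def sum_distrib_left by (intro sum.cong refl) (simp only: mult_ac)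
    finally show "emb p = (\<Sum>i<Suc n. F i * (?m * emb (h i)))" .
    fix i assume i: "i < Suc n"
    have \<sigma>x: "Poly_Mapping.keys (iexp \<sigma>) \<subseteq> xvars r ns"
      using sec_expo_expts[OF s, of "\<lambda>_. N"] by (simp add: \<sigma>_def expts_def)
    have \<sigma>0: "lkp \<sigma> v = 0" if "v \<in> xvars r ns - secv s" for v
      using that by (cases v) (auto simp: \<sigma>_def lookup_sec_expo secv_def)
    show "supp (?m * emb (h i)) \<subseteq> Px (xvars r ns - secv s)"
    proof (rule supp_multI)
      fix x y assume "x \<in> supp ?m" and y: "y \<in> supp (emb (h i))"
      then have x: "x = (- iexp \<sigma>, 0)" using supp_mterm by blast
      from y obtain z where z: "z \<in> supp (h i)" "y = iexp2 z" unfolding supp_emb by blast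
      have "z \<in> Cx" using z(1) h(1) i R_carrier by blast
      then show "x + y \<in> Px (xvars r ns - secv s)"
        using \<sigma>x keys_diff[of "iexp (fst z)" "iexp \<sigma>"] \<sigma>0 unfolding x z(2) Px_def Cx_def iexp2_def
        by (auto simp: lookup_minus)
    qed
  qed
qed

end

section \<open>Sylvester forms belong to the saturation\<close>

context sylvester begin

lemma sylv_homogeneous:
  "sylv_form r ns \<alpha> G \<in> carrier R" "multihomogeneous r ns nudeg (sylv_form r ns \<alpha> G)"
proof -
  have "sc 0 \<in> \<P> {} 0" by (rule sc_P) auto
  then have sub: "iexp2 y \<in> Reg {} {}" if "y \<in> supp (sylv_form r ns \<alpha> G)" for y
    using that Pc_supp[of "sc 0" "Suc n" "{}" 0 "iexp2 y" "{}"] unfolding sc_0 chain0_empty supp_emb by blast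
  have "supp (sylv_form r ns \<alpha> G) \<subseteq> Cx"
  proof
    fix y assume "y \<in> supp (sylv_form r ns \<alpha> G)"
    from sub[OF this] show "y \<in> Cx" by (simp add: Reg_def Cx_def iexp2_def)
  qed
  then show "sylv_form r ns \<alpha> G \<in> carrier R" unfolding R_carrier .
  show "multihomogeneous r ns nudeg (sylv_form r ns \<alpha> G)"
    unfolding multihomogeneous_def
  proof (intro ballI)
    fix m j assume m: "m \<in> Poly_Mapping.keys (sylv_form r ns \<alpha> G)" and j: "j \<in> {1..r}"
    then have "lkp (sylv_form r ns \<alpha> G) m \<noteq> 0" by (simp add: in_keys_iff)
    then obtain t where "lkp (lkp (sylv_form r ns \<alpha> G) m) t \<noteq> 0"
      using poly_mapping_eqI[of "lkp (sylv_form r ns \<alpha> G) m" 0] by auto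
    then have "(m, t) \<in> supp (sylv_form r ns \<alpha> G)" by (simp add: supp_iff coef_def)
    from sub[OF this] j show "int (group_deg ns m j) = nudeg j"
      by (simp add: Reg_def iexp2_def gdeg_iexp tdeg_empty)
  qed
qed

text \<open>Cramer's rule: the adjugate solves the linear system that expresses the F_i by the
  column monomials.\<close>

lemma yexp_det_gI:
  assumes c: "c < Suc n"
  shows "xm (yexp \<alpha> (cl ! c)) * sylv_det r ns G \<in> gI"
proof -
  define M where "M = mat (Suc n) (Suc n) (\<lambda>(i, c). case cl ! c of (l, j) \<Rightarrow> G i l j)"
  have M: "M \<in> carrier_mat (Suc n) (Suc n)" by (simp add: M_def)
  have Mic: "M $$ (i, c) = G i (fst (cl ! c)) (snd (cl ! c))" if "i < Suc n" "c < Suc n" for i c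
    using that by (simp add: M_def split: prod.split)
  have MR: "M $$ (i, c) \<in> carrier R" if "i < Suc n" "c < Suc n" for i c
    using that decomp[of i] nth_mem[of c cl] unfolding Mic[OF that] by (auto simp: sylv_decomposition_def)
  have Fi: "generic_poly r ns d i = (\<Sum>c<Suc n. xm (yexp \<alpha> (cl ! c)) * M $$ (i, c))" if "i < Suc n" for i
  proof -
    have "generic_poly r ns d i = (\<Sum>c<Suc n. xm (yexp \<alpha> (cl ! c)) * G i (fst (cl ! c)) (snd (cl ! c)))"
      using that generic_decomp[of i] sum_cl[of "\<lambda>v. xm (yexp \<alpha> v) * G i (fst v) (snd v)"] by simp
    then show ?thesis using that by (simp add: Mic del: sum.lessThan_Suc)
  qed
  have adj: "(\<Sum>i<Suc n. cofactor M i c * M $$ (i, c')) = (if c = c' then det M else 0)" if c': "c' < Suc n" for c'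
  proof -
    have "(adj_mat M * M) $$ (c, c') = (det M \<cdot>\<^sub>m 1\<^sub>m (Suc n)) $$ (c, c')"
      using adj_mat(3)[OF M] by simp
    moreover have "(adj_mat M * M) $$ (c, c') = (\<Sum>i<Suc n. cofactor M i c * M $$ (i, c'))"
      using c c' M by (simp add: scalar_prod_def adj_mat_def atLeast0LessThan del: sum.lessThan_Suc)
    ultimately show ?thesis using c c' by simp
  qed
  have "(\<Sum>i<Suc n. cofactor M i c * generic_poly r ns d i) =
      (\<Sum>i<Suc n. \<Sum>c'<Suc n. xm (yexp \<alpha> (cl ! c')) * (cofactor M i c * M $$ (i, c')))"
    by (intro sum.cong refl) (simp add: Fi sum_distrib_left mult_ac del: sum.lessThan_Suc)
  also have "\<dots> = (\<Sum>c'<Suc n. xm (yexp \<alpha> (cl ! c')) * (\<Sum>i<Suc n. cofactor M i c * M $$ (i, c')))"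
    by (subst sum.swap) (simp add: sum_distrib_left del: sum.lessThan_Suc)
  also have "\<dots> = (\<Sum>c'<Suc n. if c = c' then xm (yexp \<alpha> (cl ! c')) * det M else 0)"
    by (intro sum.cong refl) (simp add: adj del: sum.lessThan_Suc)
  also have "\<dots> = xm (yexp \<alpha> (cl ! c)) * det M" using c by (simp del: sum.lessThan_Suc)
  finally have eq: "xm (yexp \<alpha> (cl ! c)) * sylv_det r ns G = (\<Sum>i<Suc n. cofactor M i c * generic_poly r ns d i)"
    by (simp add: sylv_det_def M_def)
  have cof: "cofactor M i c \<in> carrier R" if i: "i < Suc n" for i
  proof -
    have "det (mat_delete M i c) \<in> carrier R"
    proof (rule R_det)
      show "mat_delete M i c \<in> carrier_mat n n" using mat_delete_carrier[OF M] by simp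
      show "mat_delete M i c $$ (a, b) \<in> carrier R" if "a < n" "b < n" for a b
        using that M by (auto simp: mat_delete_def intro!: MR)
    qed
    then show ?thesis unfolding cofactor_def
      by (intro R_closed(5) R_power R_closed(6) R_closed(2))
  qed
  show ?thesis
    unfolding gI_iff by (intro exI[of _ "\<lambda>i. cofactor M i c"] conjI allI impI cof eq)
qed

text \<open>A monomial of large degree in every group is divisible by some column monomial, so
  \<open>yexp_det_gI\<close> applies to it.\<close>

lemma sylv_sat: "sylv_form r ns \<alpha> G \<in> sat"
proof -
  \<comment> \<open>K bounds all \<alpha> v + 1, because \<alpha> v is less than d 0 j for v in
    group j; as a sum it serves all groups at once. Degree at least N in group j forces some
    exponent of that group to be at least K.\<close>
  define K where "K = (\<Sum>j\<in>{1..r}. d 0 j)"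
  define N where "N = (\<Sum>j\<in>{1..r}. Suc (ns j) * K)"
  have \<alpha>K: "lkp \<alpha> v + 1 \<le> K" if "v \<in> xvars r ns" for v
  proof -
    have "fst v \<in> {1..r}" using that by (auto simp: xvars_def)
    then have "d 0 (fst v) \<le> K" unfolding K_def by (intro member_le_sum) auto
    then show ?thesis using alpha_less[OF _ that, of 0] by simp
  qed
  have form: "sylv_form r ns \<alpha> G = xm pref * sylv_det r ns G"
    by (simp add: sylv_form_def x_var_power xm_prod pref_def)
  have prefR: "xm pref \<in> carrier R"
  proof (rule xm_R)
    show "Poly_Mapping.keys pref \<subseteq> xvars r ns"
    proof
      fix v assume "v \<in> Poly_Mapping.keys pref"
      then show "v \<in> xvars r ns"
        unfolding in_keys_iff lookup_pref by (cases v) (auto simp: xvars_def split: if_splits)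
    qed
  qed
  have mono: "mterm x b * sylv_form r ns \<alpha> G \<in> gI"
    if x: "x \<in> Cx" "\<And>j. j \<in> {1..r} \<Longrightarrow> N \<le> group_deg ns (fst x) j" for x b
  proof -
    have "\<exists>l\<le>ns j. K \<le> lkp (fst x) (j, l)" if j: "j \<in> {1..r}" for j
    proof (rule ccontr)
      assume neg: "\<not> (\<exists>l\<le>ns j. K \<le> lkp (fst x) (j, l))"
      have "group_deg ns (fst x) j < (\<Sum>l=0..ns j. K)"
        unfolding group_deg_def
      proof (rule sum_strict_mono)
        fix l assume "l \<in> {0..ns j}"
        then show "lkp (fst x) (j, l) < K" using neg by (meson atLeastAtMost_iff not_le)
      qed auto
      also have "\<dots> = Suc (ns j) * K" by simp
      also have "\<dots> \<le> N" unfolding N_def using j by (intro member_le_sum) auto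
      finally show False using x(2)[OF j] by simp
    qed
    then obtain s where s: "\<And>j. j \<in> {1..r} \<Longrightarrow> s j \<le> ns j \<and> K \<le> lkp (fst x) (j, s j)" by metis
    \<comment> \<open>The group is the first one in which s avoids the last variable, or group r if
      there is none; before it s selects exactly the last variables that occur in the column
      monomial.\<close>
    have "\<exists>a. a \<in> {1..r} \<and> (a, s a) \<in> set cl \<and> (\<forall>l\<in>{1..<a}. s l = ns l)"
    proof (cases "\<exists>a\<in>{1..r}. s a < ns a")
      case True
      obtain a where a: "a \<in> {1..r} \<and> s a < ns a" "\<And>l. l < a \<Longrightarrow> \<not> (l \<in> {1..r} \<and> s l < ns l)"
        using True exists_least_iff[of "\<lambda>a. a \<in> {1..r} \<and> s a < ns a"] by blast
      have "s l = ns l" if "l \<in> {1..<a}" for l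
        using a(1) a(2)[of l] s[of l] that by auto
      then show ?thesis using a unfolding set_cl by (intro exI[of _ a]) simp
    next
      case False
      have "s l = ns l" if "l \<in> {1..r}" for l
      proof -
        have "\<not> s l < ns l" "s l \<le> ns l" using False that s by blast+
        then show ?thesis by simp
      qed
      then show ?thesis using r_pos unfolding set_cl by (intro exI[of _ r]) simp
    qed
    then obtain a where a: "a \<in> {1..r}" "(a, s a) \<in> set cl" "\<forall>l\<in>{1..<a}. s l = ns l" by blast
    then obtain c where c: "c < Suc n" "cl ! c = (a, s a)" unfolding in_set_conv_nth by auto
    let ?y = "yexp \<alpha> (cl ! c)"
    have le: "lkp ?y v \<le> lkp (fst x) v" for v
    proof (cases "v = (a, s a) \<or> fst v \<in> {1..<a} \<and> snd v = ns (fst v)")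
      case True
      then have v: "fst v \<in> {1..r}" "snd v = s (fst v)" using a by auto
      then have "v \<in> xvars r ns" using s[of "fst v"] by (cases v) (auto simp: xvars_def)
      then have "lkp ?y v \<le> K" unfolding c(2) lookup_yexp using \<alpha>K[of v] by (auto split: if_splits)
      moreover have "K \<le> lkp (fst x) v" using s[OF v(1)] v(2) by (metis prod.collapse)
      ultimately show ?thesis by simp
    next
      case False
      then have "lkp ?y v = 0" unfolding c(2) lookup_yexp by auto
      then show ?thesis by simp
    qed
    have split: "?y + (fst x - ?y) = fst x"
      by (rule poly_mapping_eqI) (simp add: lookup_add lookup_minus le)
    have "mterm x b = xm ?y * mterm (fst x - ?y, snd x) b" for b :: 'k
      unfolding xm_mterm mterm_mult by (simp add: split)
    then have "mterm x b * sylv_form r ns \<alpha> G = (mterm (fst x - ?y, snd x) b * xm pref) * (xm ?y * sylv_det r ns G)"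
      unfolding form by (simp only: mult_ac)
    moreover have "mterm (fst x - ?y, snd x) b \<in> carrier R"
    proof -
      have "supp (mterm (fst x - ?y, snd x) b) \<subseteq> {(fst x - ?y, snd x)}" by (rule supp_mterm)
      moreover have "(fst x - ?y, snd x) \<in> Cx"
        using x(1) keys_diff_nat[of "fst x" ?y] by (auto simp: Cx_def simp del: subset_iff)
      ultimately show ?thesis unfolding R_carrier by blast
    qed
    ultimately show ?thesis
      using gI_closed(3)[OF yexp_det_gI[OF c(1)] R_closed(5)[OF _ prefR]] by simp
  qed
  have "q * sylv_form r ns \<alpha> G \<in> gI" if q: "q \<in> bpow N" for q
  proof -
    have qJ: "q \<in> Jg j N" if "j \<in> {1..r}" for j using bpow_props[of N, where 'k='k] q that by blast
    have "q \<in> carrier R" using qJ[of 1] r_pos by (simp add: Jg_def)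
    have "q * sylv_form r ns \<alpha> G = (\<Sum>x\<in>supp q. mterm x (coef q x) * sylv_form r ns \<alpha> G)"
      unfolding sum_distrib_right[symmetric] mterm_expansion[symmetric] ..
    also have "\<dots> \<in> gI"
    proof (rule gI_sum, rule mono)
      fix x assume x: "x \<in> supp q"
      show "x \<in> Cx" using x \<open>q \<in> carrier R\<close> R_carrier by blast
      show "N \<le> group_deg ns (fst x) j" if "j \<in> {1..r}" for j using qJ[OF that] x by (simp add: Jg_def)
    qed
    finally show ?thesis .
  qed
  then show ?thesis using sylv_homogeneous(1) unfolding saturation_def by blast
qed

lemma sylv_rel:
  "\<exists>e. rel (r - 1) {} {} (chain0 (emb (sylv_form r ns \<alpha> G))) e \<and> e {..<Suc n} = mterm (negx \<alpha>, 0) 1"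
proof -
  have "r - (r - 1) = Suc 0" using r_pos by simp
  then have "rel (r - 1) {} {} (sc 0) (sc (Suc n))" using sc_rel[of "r - 1"] r_pos by simp
  then show ?thesis using sc_top unfolding sc_0 by blast
qed

end

context multigraded begin

section \<open>The module and its basis\<close>

abbreviation qc :: "'k::comm_ring_1 cpoly \<Rightarrow> 'k cpoly set" where "qc \<equiv> quot_class r ns d"

abbreviation Q :: "'k::comm_ring_1 cpoly set ring" where "Q \<equiv> quot_ring r ns d"

lemma qc_add:
  fixes p q :: "'k::comm_ring_1 cpoly"
  assumes "p \<in> carrier R" "q \<in> carrier R" shows "qc p \<oplus>\<^bsub>Q\<^esub> qc q = qc (p + q)"
  using ring_hom_add[OF ideal.rcos_ring_hom[OF gI_ideal] assms] by (simp add: quot_class_def quot_ring_def)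

lemma qc_mult:
  fixes p q :: "'k::comm_ring_1 cpoly"
  assumes "p \<in> carrier R" "q \<in> carrier R" shows "qc p \<otimes>\<^bsub>Q\<^esub> qc q = qc (p * q)"
  using ring_hom_mult[OF ideal.rcos_ring_hom[OF gI_ideal] assms] by (simp add: quot_class_def quot_ring_def)

lemma qc_iff: "x \<in> qc p \<longleftrightarrow> (\<exists>h\<in>gI. x = h + p)"
  by (auto simp: quot_class_def a_r_coset_def')

lemma qc_eq:
  fixes p q :: "'k::comm_ring_1 cpoly"
  shows "qc p = qc q \<longleftrightarrow> p - q \<in> gI"
proof
  assume "qc p = qc q"
  moreover have "p \<in> qc p" using gI_closed(1) unfolding qc_iff by (intro bexI[of _ 0]) auto
  ultimately have "p \<in> qc q" by (simp only:)
  then obtain h where "h \<in> gI" "p = h + q" unfolding qc_iff by blast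
  then show "p - q \<in> gI" by simp
next
  assume pq: "p - q \<in> gI"
  show "qc p = qc q"
  proof (intro equalityI subsetI)
    fix x assume "x \<in> qc p"
    then obtain h where "h \<in> gI" "x = h + p" unfolding qc_iff by blast
    then have "h + (p - q) \<in> gI" "x = (h + (p - q)) + q" using pq gI_closed(2) by simp_all
    then show "x \<in> qc q" unfolding qc_iff by blast
  next
    fix x assume "x \<in> qc q"
    then obtain h where "h \<in> gI" "x = h + q" unfolding qc_iff by blast
    then have "h - (p - q) \<in> gI" "x = (h - (p - q)) + p" using pq gI_closed(6) by simp_all
    then show "x \<in> qc p" unfolding qc_iff by blast
  qed
qed

lemma qc_zero: "\<zero>\<^bsub>Q\<^esub> = qc 0"
  by (auto simp: quot_ring_def FactRing_def qc_iff)

definition W :: "'k::comm_ring_1 cpoly set" where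
  "W = {p \<in> sat. multihomogeneous r ns nudeg p}"

abbreviation cR :: "'k::comm_ring_1 coeff ring" where "cR \<equiv> coeff_ring r ns d"

abbreviation MM :: "('k::comm_ring_1 coeff, 'k cpoly set) module" where
  "MM \<equiv> sat_quot_part r ns d nudeg"

lemma W_R: "p \<in> W \<Longrightarrow> p \<in> carrier R"
  using sat_closed(4) by (auto simp: W_def)

lemma W_add:
  fixes p q :: "'k::comm_ring_1 cpoly"
  assumes "p \<in> W" "q \<in> W" shows "p + q \<in> W"
  using assms sat_closed(1)[of p q] Poly_Mapping.keys_add[of p q] unfolding W_def multihomogeneous_def by blast

lemma W_const:
  fixes p :: "'k::comm_ring_1 cpoly"
  assumes a: "a \<in> carrier cR" and p: "p \<in> W" shows "const_poly a * p \<in> W"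
proof -
  have "Poly_Mapping.keys (const_poly a * p) \<subseteq> Poly_Mapping.keys p"
    using keys_mult[of "const_poly a" p] by (auto simp: const_poly_def split: if_splits)
  then have "multihomogeneous r ns nudeg (const_poly a * p)"
    using p unfolding W_def multihomogeneous_def by blast
  then show ?thesis using p sat_closed(2)[OF _ const_R[OF a]] by (simp add: W_def)
qed

lemma W_zero: "(0 :: 'k::comm_ring_1 cpoly) \<in> W"
  using sat_closed(3) by (simp add: W_def multihomogeneous_def)

lemma cR_closed:
  fixes a b :: "'k::comm_ring_1 coeff"
  shows "0 \<in> carrier (cR :: 'k coeff ring)" "1 \<in> carrier (cR :: 'k coeff ring)"
    "a \<in> carrier cR \<Longrightarrow> b \<in> carrier cR \<Longrightarrow> a + b \<in> carrier cR"
    "a \<in> carrier cR \<Longrightarrow> b \<in> carrier cR \<Longrightarrow> a * b \<in> carrier cR"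
    "a \<in> carrier cR \<Longrightarrow> - a \<in> carrier cR"
proof -
  show "a \<in> carrier cR \<Longrightarrow> b \<in> carrier cR \<Longrightarrow> a + b \<in> carrier cR"
    using Poly_Mapping.keys_add[of a b] unfolding coeff_ring_def ring_on_simps by blast
  show "a \<in> carrier cR \<Longrightarrow> b \<in> carrier cR \<Longrightarrow> a * b \<in> carrier cR"
  proof -
    assume ab: "a \<in> carrier cR" "b \<in> carrier cR"
    have "Poly_Mapping.keys t \<subseteq> uvars r ns d" if "t \<in> Poly_Mapping.keys (a * b)" for t
    proof -
      from that keys_mult[of a b] obtain u v where uv: "t = u + v" "u \<in> Poly_Mapping.keys a" "v \<in> Poly_Mapping.keys b"
        by blast
      then show ?thesis unfolding uv(1) using ab by (intro keys_add_subset) (simp_all add: coeff_ring_def)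
    qed
    then show ?thesis by (simp add: coeff_ring_def)
  qed
qed (simp_all add: coeff_ring_def)

lemma cR_cring: "cring (cR :: 'k::comm_ring_1 coeff ring)"
proof -
  have "cring (ring_on (carrier cR) :: 'k coeff ring)"
    by (rule ring_on_cring) (rule cR_closed; assumption)+
  then show ?thesis by (simp add: coeff_ring_def)
qed

lemma cR_simps [simp]:
  "x \<otimes>\<^bsub>cR\<^esub> y = x * y" "x \<oplus>\<^bsub>cR\<^esub> y = x + y" "\<one>\<^bsub>cR\<^esub> = 1" "\<zero>\<^bsub>cR\<^esub> = 0"
  by (simp_all add: coeff_ring_def)

lemma MM_carrier: "carrier MM = qc ` W"
  by (simp add: sat_quot_part_def W_def)

lemma MM_add:
  fixes p q :: "'k::comm_ring_1 cpoly"
  shows "p \<in> W \<Longrightarrow> q \<in> W \<Longrightarrow> qc p \<oplus>\<^bsub>MM\<^esub> qc q = qc (p + q)"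
  using qc_add[of p q] W_R[of p] W_R[of q] by (simp add: sat_quot_part_def)

lemma MM_zero: "\<zero>\<^bsub>MM\<^esub> = qc 0"
  by (simp add: sat_quot_part_def qc_zero)

lemma MM_smult:
  fixes p :: "'k::comm_ring_1 cpoly"
  shows "a \<in> carrier cR \<Longrightarrow> p \<in> W \<Longrightarrow> a \<odot>\<^bsub>MM\<^esub> qc p = qc (const_poly a * p)"
  using qc_mult[OF const_R, of a p] W_R[of p] by (simp add: sat_quot_part_def)

lemma const_poly_simps:
  "const_poly (a + b) = const_poly a + const_poly b" "const_poly (a * b) = const_poly a * const_poly b"
  "const_poly 1 = 1" "const_poly (- a) = - const_poly a" "const_poly 0 = 0"
  by (simp_all add: const_poly_def single_add mult_single single_uminus)

lemma MM_abelian_group: "abelian_group (MM :: ('k::comm_ring_1 coeff, 'k cpoly set) module)"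
proof (rule abelian_groupI)
  fix x y z :: "'k cpoly set"
  assume "x \<in> carrier MM" "y \<in> carrier MM" "z \<in> carrier MM"
  then obtain p q s where "p \<in> W" "q \<in> W" "s \<in> W" "x = qc p" "y = qc q" "z = qc s"
    unfolding MM_carrier by blast
  then show "(x \<oplus>\<^bsub>MM\<^esub> y) \<oplus>\<^bsub>MM\<^esub> z = x \<oplus>\<^bsub>MM\<^esub> (y \<oplus>\<^bsub>MM\<^esub> z)"
    by (simp add: MM_add W_add add.assoc)
next
  fix x y :: "'k cpoly set"
  assume "x \<in> carrier MM" "y \<in> carrier MM"
  then obtain p q where "p \<in> W" "q \<in> W" "x = qc p" "y = qc q"
    unfolding MM_carrier by blast
  then show "x \<oplus>\<^bsub>MM\<^esub> y \<in> carrier MM" "x \<oplus>\<^bsub>MM\<^esub> y = y \<oplus>\<^bsub>MM\<^esub> x"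
    by (simp_all add: MM_carrier MM_add W_add add.commute)
next
  fix x :: "'k cpoly set"
  assume "x \<in> carrier MM"
  then obtain p where p: "p \<in> W" "x = qc p" unfolding MM_carrier by blast
  then show "\<zero>\<^bsub>MM\<^esub> \<oplus>\<^bsub>MM\<^esub> x = x" by (simp add: MM_zero MM_add W_zero)
  have "const_poly (- 1) * p \<in> W" by (intro W_const cR_closed p)
  then have "- p \<in> W" by (simp add: const_poly_simps)
  moreover have "qc (- p) \<oplus>\<^bsub>MM\<^esub> x = \<zero>\<^bsub>MM\<^esub>"
    using p \<open>- p \<in> W\<close> by (simp add: MM_add MM_zero)
  ultimately show "\<exists>y\<in>carrier MM. y \<oplus>\<^bsub>MM\<^esub> x = \<zero>\<^bsub>MM\<^esub>" unfolding MM_carrier by blast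
next
  show "\<zero>\<^bsub>MM\<^esub> \<in> carrier (MM :: ('k coeff, 'k cpoly set) module)"
    unfolding MM_carrier MM_zero using W_zero by blast
qed

lemma MM_module: "Module.module (cR :: 'k::comm_ring_1 coeff ring) MM"
proof (rule moduleI)
  show "cring (cR :: 'k coeff ring)" by (rule cR_cring)
  show "abelian_group (MM :: ('k coeff, 'k cpoly set) module)" by (rule MM_abelian_group)
next
  fix a :: "'k coeff" and x :: "'k cpoly set" assume a: "a \<in> carrier cR" and "x \<in> carrier MM"
  then obtain p where p: "p \<in> W" "x = qc p" unfolding MM_carrier by blast
  show "a \<odot>\<^bsub>MM\<^esub> x \<in> carrier MM"
    unfolding p(2) MM_smult[OF a p(1)] MM_carrier using W_const[OF a p(1)] by blast
next
  fix a b :: "'k coeff" and x :: "'k cpoly set" assume ab: "a \<in> carrier cR" "b \<in> carrier cR" and "x \<in> carrier MM"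
  then obtain p where p: "p \<in> W" "x = qc p" unfolding MM_carrier by blast
  show "(a \<oplus>\<^bsub>cR\<^esub> b) \<odot>\<^bsub>MM\<^esub> x = a \<odot>\<^bsub>MM\<^esub> x \<oplus>\<^bsub>MM\<^esub> b \<odot>\<^bsub>MM\<^esub> x"
    unfolding p(2) cR_simps using ab p(1)
    by (simp add: MM_smult MM_add W_const cR_closed const_poly_simps distrib_right)
  show "(a \<otimes>\<^bsub>cR\<^esub> b) \<odot>\<^bsub>MM\<^esub> x = a \<odot>\<^bsub>MM\<^esub> (b \<odot>\<^bsub>MM\<^esub> x)"
    unfolding p(2) cR_simps using ab p(1)
    by (simp add: MM_smult W_const cR_closed const_poly_simps mult.assoc)
next
  fix a :: "'k coeff" and x y :: "'k cpoly set" assume a: "a \<in> carrier cR" and "x \<in> carrier MM" "y \<in> carrier MM"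
  then obtain p q where p: "p \<in> W" "x = qc p" "q \<in> W" "y = qc q" unfolding MM_carrier by blast
  show "a \<odot>\<^bsub>MM\<^esub> (x \<oplus>\<^bsub>MM\<^esub> y) = a \<odot>\<^bsub>MM\<^esub> x \<oplus>\<^bsub>MM\<^esub> a \<odot>\<^bsub>MM\<^esub> y"
    unfolding p(2,4) using a p(1,3) by (simp add: MM_smult MM_add W_const W_add distrib_left)
next
  fix x :: "'k cpoly set" assume "x \<in> carrier MM"
  then obtain p where p: "p \<in> W" "x = qc p" unfolding MM_carrier by blast
  show "\<one>\<^bsub>cR\<^esub> \<odot>\<^bsub>MM\<^esub> x = x"
    unfolding p(2) cR_simps using p(1) by (simp add: MM_smult cR_closed const_poly_simps)
qed

lemma W_sum:
  fixes b :: "'i \<Rightarrow> 'k::comm_ring_1 cpoly"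
  shows "(\<And>s. s \<in> S \<Longrightarrow> b s \<in> W) \<Longrightarrow> sum b S \<in> W"
  by (induction S rule: infinite_finite_induct) (auto simp: W_zero W_add)

lemma MM_finsum:
  fixes b :: "'i \<Rightarrow> 'k::comm_ring_1 cpoly"
  assumes "finite S" "\<And>s. s \<in> S \<Longrightarrow> b s \<in> W" "\<And>s. s \<in> S \<Longrightarrow> c s \<in> carrier cR"
  shows "(\<Oplus>\<^bsub>MM\<^esub>s\<in>S. c s \<odot>\<^bsub>MM\<^esub> qc (b s)) = qc (\<Sum>s\<in>S. const_poly (c s) * b s)"
  using assms
proof (induction S rule: finite_induct)
  case empty
  interpret abelian_group "MM :: ('k coeff, 'k cpoly set) module" by (rule MM_abelian_group)
  show ?case by (simp add: MM_zero)
next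
  case (insert i S)
  interpret abelian_group "MM :: ('k coeff, 'k cpoly set) module" by (rule MM_abelian_group)
  have cl: "c s \<odot>\<^bsub>MM\<^esub> qc (b s) \<in> carrier MM" if "s \<in> insert i S" for s
    using that insert.prems W_const[of "c s" "b s"] unfolding MM_carrier by (simp add: MM_smult)
  have "(\<Oplus>\<^bsub>MM\<^esub>s\<in>insert i S. c s \<odot>\<^bsub>MM\<^esub> qc (b s)) =
      c i \<odot>\<^bsub>MM\<^esub> qc (b i) \<oplus>\<^bsub>MM\<^esub> (\<Oplus>\<^bsub>MM\<^esub>s\<in>S. c s \<odot>\<^bsub>MM\<^esub> qc (b s))"
    using insert.hyps cl by (intro finsum_insert) auto
  also have "\<dots> = qc (const_poly (c i) * b i) \<oplus>\<^bsub>MM\<^esub> qc (\<Sum>s\<in>S. const_poly (c s) * b s)"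
    using insert by (simp add: MM_smult)
  also have "\<dots> = qc (const_poly (c i) * b i + (\<Sum>s\<in>S. const_poly (c s) * b s))"
    using insert.prems by (intro MM_add W_const W_sum) auto
  finally show ?case using insert.hyps by simp
qed

lemma rest_1: "rest (Suc 0) = xvars r ns"
  by (auto simp: rest_def grp_def xvars_def)

lemma rel_combination:
  assumes "finite S" "rel k A B f0 e0"
    "\<And>s. s \<in> S \<Longrightarrow> c s \<in> carrier cR \<and> rel k A B (f s) (e s)"
  shows "rel k A B (f0 - (\<Sum>s\<in>S. cmul (c s) (f s))) (e0 - (\<Sum>s\<in>S. cmul (c s) (e s)))"
  using assms
proof (induction S rule: finite_induct)
  case (insert i S)
  have "rel k A B (f0 - (\<Sum>s\<in>S. cmul (c s) (f s)) - cmul (c i) (f i))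
      (e0 - (\<Sum>s\<in>S. cmul (c s) (e s)) - cmul (c i) (e i))"
    using insert.IH[OF insert.prems(1)] insert.prems(2) by (intro rel_diff[OF _ rel_cmul]) blast+
  moreover have "a - x - y = a - (y + x)" for a x y :: "'b chain" by (simp only: diff_diff_add add.commute)
  ultimately show ?case by (simp only: sum.insert[OF insert.hyps(1,2)])
qed (simp only: sum.empty diff_zero)

lemma sum_chain_apply: "(\<Sum>s\<in>S. f s) T = (\<Sum>s\<in>S. f s T)"
  for f :: "'i \<Rightarrow> 'k::comm_ring_1 chain"
  by (induction S rule: infinite_finite_induct) auto

lemma chain0_combination:
  "chain0 (emb (p - (\<Sum>s\<in>S. const_poly (c s) * b s))) =
    chain0 (emb p) - (\<Sum>s\<in>S. cmul (c s) (chain0 (emb (b s))))"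
proof -
  interpret emb: comm_ring_hom emb by (rule emb_hom)
  have const: "emb (const_poly a) = Poly_Mapping.single 0 a" for a :: "'a coeff"
  proof (rule emb_eqI)
    fix x
    show "coef (emb (const_poly a)) (iexp2 x) = coef (Poly_Mapping.single 0 a) (iexp2 x)"
      using iexp_inject[of 0 "fst x"] unfolding coef_emb
      by (auto simp: const_poly_def coef_def lookup_single when_def iexp2_def)
  next
    fix y :: "lexpo \<times> ((nat \<times> expo) \<Rightarrow>\<^sub>0 nat)" assume y: "y \<notin> range iexp2"
    have "fst y \<noteq> 0"
    proof
      assume "fst y = 0"
      then have "y = iexp2 (0, snd y)" by (simp add: iexp2_def prod_eq_iff)
      then show False using y by blast
    qed
    then show "coef (Poly_Mapping.single 0 a) y = 0" by (simp add: coef_def lookup_single when_def)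
  qed
  have "emb (p - (\<Sum>s\<in>S. const_poly (c s) * b s)) = emb p - (\<Sum>s\<in>S. Poly_Mapping.single 0 (c s) * emb (b s))"
    by (simp add: emb.hom_minus emb_sum emb_mult const)
  then show ?thesis
    by (intro ext) (simp add: chain0_def cmul_def sum_chain_apply)
qed

text \<open>The image of the difference is the difference of the images, and E \<beta> has
  coefficient 1 at x^(-1-\<beta>) and 0 at the other inverse monomials. By \<open>rel_bnd\<close>
  and \<open>top_zero_iff\<close>, the coefficients c are thus read off from e.\<close>

lemma basis_aux:
  fixes S :: "expo \<Rightarrow> 'k::comm_ring_1 cpoly"
  assumes SW: "\<And>\<beta>. \<beta> \<in> expts r ns \<mu> \<Longrightarrow> S \<beta> \<in> W"
    and E: "\<And>\<beta>. \<beta> \<in> expts r ns \<mu> \<Longrightarrow> rel (r - 1) {} {} (chain0 (emb (S \<beta>))) (E \<beta>) \<and>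
      E \<beta> {..<Suc n} = mterm (negx \<beta>, 0) 1"
    and T: "T \<subseteq> expts r ns \<mu>" "\<And>\<beta>. \<beta> \<in> T \<Longrightarrow> c \<beta> \<in> carrier cR"
    and p: "p \<in> W" "rel (r - 1) {} {} (chain0 (emb p)) e"
  shows "p - (\<Sum>\<beta>\<in>T. const_poly (c \<beta>) * S \<beta>) \<in> gI \<longleftrightarrow>
    (\<forall>\<gamma>\<in>expts r ns \<mu>. lkp (e {..<Suc n}) (negx \<gamma>) = (if \<gamma> \<in> T then c \<gamma> else 0))"
proof -
  have finT: "finite T" using T(1) finite_expts finite_subset by blast
  define p' where "p' = p - (\<Sum>\<beta>\<in>T. const_poly (c \<beta>) * S \<beta>)"
  define e' where "e' = e - (\<Sum>\<beta>\<in>T. cmul (c \<beta>) (E \<beta>))"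
  have p'W: "p' \<in> W"
  proof -
    have "(\<Sum>\<beta>\<in>T. const_poly (c \<beta>) * S \<beta>) \<in> W" using T SW by (intro W_sum W_const) auto
    then have "const_poly (- 1) * (\<Sum>\<beta>\<in>T. const_poly (c \<beta>) * S \<beta>) \<in> W" by (intro W_const cR_closed)
    from W_add[OF p(1) this] show ?thesis by (simp add: p'_def const_poly_simps)
  qed
  have rel': "rel (r - 1) {} {} (chain0 (emb p')) e'"
    unfolding p'_def e'_def chain0_combination using finT p(2) T E by (intro rel_combination) auto
  have k: "r - 1 < r" "r - (r - 1) = Suc 0" using r_pos by auto
  have hom: "p' \<in> carrier R" "multihomogeneous r ns nudeg p'"
    using p'W W_R by (auto simp: W_def)
  have cyc: "cyc (xvars r ns) {} 0 (chain0 (emb p'))"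
    unfolding cyc_def D_Pc0[OF chain0_P[OF hom]] using chain0_P[OF hom] Oc_zero by blast
  have adm: "adm (Suc 0) {} {}" by (simp add: adm_def low_def)
  have "p' \<in> gI \<longleftrightarrow> bnd (xvars r ns) {} 0 (chain0 (emb p'))" by (rule gI_bnd[OF hom])
  also have "\<dots> \<longleftrightarrow> e' \<in> \<O> {} (xvars r ns) (Suc n)"
    using rel_bnd[OF k(1) _ _ rel'] adm cyc unfolding k(2) rest_1 by simp
  also have "\<dots> \<longleftrightarrow> (\<forall>\<gamma>\<in>expts r ns \<mu>. lkp (e' {..<Suc n}) (negx \<gamma>) = 0)"
    using rel_P[OF k(1) _ rel'] cyc unfolding k(2) rest_1 by (intro top_zero_iff) simp
  also have "\<dots> \<longleftrightarrow> (\<forall>\<gamma>\<in>expts r ns \<mu>. lkp (e {..<Suc n}) (negx \<gamma>) = (if \<gamma> \<in> T then c \<gamma> else 0))"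
  proof (rule ball_cong[OF refl])
    fix \<gamma> assume "\<gamma> \<in> expts r ns \<mu>"
    have "lkp (cmul (c \<beta>) (E \<beta>) {..<Suc n}) (negx \<gamma>) = (if \<beta> = \<gamma> then c \<gamma> else 0)" if "\<beta> \<in> T" for \<beta>
    proof -
      have "cmul (c \<beta>) (E \<beta>) {..<Suc n} = Poly_Mapping.single (negx \<beta>) (c \<beta>)"
        using E[of \<beta>] T(1) that by (auto simp: cmul_def mterm_def mult_single)
      moreover have "negx \<beta> = negx \<gamma> \<longleftrightarrow> \<beta> = \<gamma>" by (auto simp: negx_def)
      ultimately show ?thesis by (simp add: lookup_single when_def)
    qed
    then have "(\<Sum>\<beta>\<in>T. lkp (cmul (c \<beta>) (E \<beta>) {..<Suc n}) (negx \<gamma>)) = (\<Sum>\<beta>\<in>T. if \<beta> = \<gamma> then c \<gamma> else 0)"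
      by (intro sum.cong refl)
    then have "lkp (e' {..<Suc n}) (negx \<gamma>) = lkp (e {..<Suc n}) (negx \<gamma>) - (if \<gamma> \<in> T then c \<gamma> else 0)"
      unfolding e'_def using finT by (simp add: lookup_minus lookup_sum sum_chain_apply)
    then show "lkp (e' {..<Suc n}) (negx \<gamma>) = 0 \<longleftrightarrow> lkp (e {..<Suc n}) (negx \<gamma>) = (if \<gamma> \<in> T then c \<gamma> else 0)"
      by simp
  qed
  finally show ?thesis unfolding p'_def .
qed

lemma top_coeff_carrier:
  assumes e: "e \<in> \<P> {} (Suc n)"
  shows "lkp (e T) m \<in> carrier cR"
proof -
  have "Poly_Mapping.keys t \<subseteq> uvars r ns d" if "t \<in> Poly_Mapping.keys (lkp (e T) m)" for t
  proof -
    have "(m, t) \<in> supp (e T)" using that by (simp add: supp_iff coef_def in_keys_iff)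
    from Pc_supp[OF e this] show ?thesis by (simp add: Reg_def)
  qed
  then show ?thesis by (simp add: coeff_ring_def)
qed

text \<open>Both properties are instances of \<open>basis_aux\<close>: for generation the
  coefficients are those of the image e of p, for independence p and e are zero.\<close>

lemma sylv_basis:
  fixes G :: "expo \<Rightarrow> nat \<Rightarrow> nat \<Rightarrow> nat \<Rightarrow> 'k::comm_ring_1 cpoly"
  assumes G: "\<And>\<alpha>. \<alpha> \<in> expts r ns \<mu> \<Longrightarrow> sylvester r ns d \<mu> \<alpha> (G \<alpha>)"
  shows "module_basis cR (MM :: ('k coeff, 'k cpoly set) module) (expts r ns \<mu>)
    (\<lambda>\<alpha>. qc (sylv_form r ns \<alpha> (G \<alpha>)))"
proof -
  let ?X = "expts r ns \<mu>"
  define S where "S \<alpha> = sylv_form r ns \<alpha> (G \<alpha>)" for \<alpha>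
  have SW: "S \<alpha> \<in> W" if "\<alpha> \<in> ?X" for \<alpha>
    using sylvester.sylv_sat[OF G[OF that]] sylvester.sylv_homogeneous(2)[OF G[OF that]]
    by (simp add: S_def W_def)
  have "\<forall>\<alpha>\<in>?X. \<exists>e. rel (r - 1) {} {} (chain0 (emb (S \<alpha>))) e \<and> e {..<Suc n} = mterm (negx \<alpha>, 0) 1"
    using sylvester.sylv_rel[OF G] unfolding S_def by blast
  from bchoice[OF this] obtain E where E: "\<And>\<alpha>. \<alpha> \<in> ?X \<Longrightarrow> rel (r - 1) {} {} (chain0 (emb (S \<alpha>))) (E \<alpha>) \<and>
      E \<alpha> {..<Suc n} = mterm (negx \<alpha>, 0) 1" by blast
  have span: "\<exists>c. c \<in> ?X \<rightarrow> carrier cR \<and> x = (\<Oplus>\<^bsub>MM\<^esub>s\<in>?X. c s \<odot>\<^bsub>MM\<^esub> qc (S s))"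
    if x: "x \<in> carrier (MM :: ('k coeff, 'k cpoly set) module)" for x
  proof -
    from x obtain p where p: "p \<in> W" "x = qc p" unfolding MM_carrier by blast
    then have "good (xvars r ns) {} 0 (chain0 (emb p))" by (intro sat_good) (auto simp: W_def)
    moreover have k: "r - 1 < r" "r - (r - 1) = Suc 0" using r_pos by auto
    moreover have "adm (Suc 0) {} {}" by (simp add: adm_def low_def)
    ultimately obtain e where e: "rel (r - 1) {} {} (chain0 (emb p)) e"
      using rel_total[of "r - 1" "{}" "{}" "chain0 (emb p)"] unfolding k(2) rest_1 by auto
    have eP: "e \<in> \<P> {} (Suc n)"
      using \<open>good (xvars r ns) {} 0 (chain0 (emb p))\<close> rel_P[OF k(1) _ e] unfolding k(2) rest_1 good_def by simp
    define c where "c \<beta> = lkp (e {..<Suc n}) (negx \<beta>)" for \<beta>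
    have c: "c \<beta> \<in> carrier cR" for \<beta> unfolding c_def by (rule top_coeff_carrier[OF eP])
    have "p - (\<Sum>\<beta>\<in>?X. const_poly (c \<beta>) * S \<beta>) \<in> gI"
      using basis_aux[of S E ?X c p e] SW E c p(1) e by (simp add: c_def)
    then have "x = qc (\<Sum>\<beta>\<in>?X. const_poly (c \<beta>) * S \<beta>)" unfolding p(2) qc_eq .
    also have "\<dots> = (\<Oplus>\<^bsub>MM\<^esub>s\<in>?X. c s \<odot>\<^bsub>MM\<^esub> qc (S s))"
      using c SW by (intro MM_finsum[symmetric] finite_expts) auto
    finally have eq: "x = (\<Oplus>\<^bsub>MM\<^esub>s\<in>?X. c s \<odot>\<^bsub>MM\<^esub> qc (S s))" .
    show ?thesis by (intro exI[of _ c] conjI Pi_I c eq)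
  qed
  have indep: "c s = 0"
    if T: "finite T" "T \<subseteq> ?X" "c \<in> T \<rightarrow> carrier cR" and z: "(\<Oplus>\<^bsub>MM\<^esub>s\<in>T. c s \<odot>\<^bsub>MM\<^esub> qc (S s)) = \<zero>\<^bsub>MM\<^esub>"
      and s: "s \<in> T" for T c s
  proof -
    have "qc 0 = \<zero>\<^bsub>MM\<^esub>" by (rule MM_zero[symmetric])
    also have "\<dots> = (\<Oplus>\<^bsub>MM\<^esub>s\<in>T. c s \<odot>\<^bsub>MM\<^esub> qc (S s))" by (rule z[symmetric])
    also have "\<dots> = qc (\<Sum>s\<in>T. const_poly (c s) * S s)"
      using T SW by (intro MM_finsum) auto
    finally have "qc 0 = qc (\<Sum>s\<in>T. const_poly (c s) * S s)" .
    then have gI: "0 - (\<Sum>s\<in>T. const_poly (c s) * S s) \<in> gI" unfolding qc_eq .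
    have "s \<in> ?X" using s T(2) by blast
    \<comment> \<open>The zero polynomial is related to the zero chain, as the difference of a
      related pair with itself.\<close>
    then have "rel (r - 1) {} {} (chain0 (emb (S s)) - chain0 (emb (S s))) (E s - E s)"
      using E by (intro rel_diff) auto
    then have "rel (r - 1) {} {} (chain0 (emb (0 :: 'k cpoly))) 0"
      unfolding chain0_diff[symmetric] by (simp only: diff_self emb_zero)
    with gI have "\<forall>\<gamma>\<in>?X. lkp ((0 :: 'k chain) {..<Suc n}) (negx \<gamma>) = (if \<gamma> \<in> T then c \<gamma> else 0)"
      using basis_aux[OF SW E T(2) _ W_zero, of c 0] T(3) by (simp add: Pi_iff)
    from bspec[OF this \<open>s \<in> ?X\<close>] show ?thesis using s by simp
  qed
  show ?thesis
    unfolding module_basis_def S_def[symmetric]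
  proof (intro conjI ballI allI impI)
    show "Module.module cR (MM :: ('k coeff, 'k cpoly set) module)" by (rule MM_module)
    show "(\<lambda>\<alpha>. qc (S \<alpha>)) \<in> ?X \<rightarrow> carrier MM" unfolding MM_carrier using SW by blast
    fix x assume "x \<in> carrier (MM :: ('k coeff, 'k cpoly set) module)"
    from span[OF this] obtain c where c: "c \<in> ?X \<rightarrow> carrier cR"
      "x = (\<Oplus>\<^bsub>MM\<^esub>s\<in>?X. c s \<odot>\<^bsub>MM\<^esub> qc (S s))" by (elim exE conjE)
    show "\<exists>T c. finite T \<and> T \<subseteq> ?X \<and> c \<in> T \<rightarrow> carrier cR \<and>
        x = (\<Oplus>\<^bsub>MM\<^esub>s\<in>T. c s \<odot>\<^bsub>MM\<^esub> qc (S s))"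
      by (intro exI[of _ ?X] exI[of _ c] conjI finite_expts subset_refl c)
  next
    fix T c s assume "finite T \<and> T \<subseteq> ?X \<and> c \<in> T \<rightarrow> carrier cR \<and>
      (\<Oplus>\<^bsub>MM\<^esub>s\<in>T. c s \<odot>\<^bsub>MM\<^esub> qc (S s)) = \<zero>\<^bsub>MM\<^esub>" "s \<in> T"
    then show "c s = \<zero>\<^bsub>cR\<^esub>" unfolding cR_simps by (elim conjE) (rule indep)
  qed
qed

end

text \<open>\<open>free_module\<close> asks for a basis that is a set, so the family has to be
  injective. A repetition b i = b j would give the relation with coefficients 1 and - 1, excluded by
  independence when 1 is not 0.\<close>

lemma module_basis_free:
  assumes b: "module_basis R M J b" and nz: "\<one>\<^bsub>R\<^esub> \<noteq> \<zero>\<^bsub>R\<^esub>"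
  shows "free_module R M"
proof -
  interpret M: Module.module R M using b by (simp add: module_basis_def)
  note b' = b[unfolded module_basis_def]
  have span: "\<exists>S c. finite S \<and> S \<subseteq> J \<and> c \<in> S \<rightarrow> carrier R \<and> x = (\<Oplus>\<^bsub>M\<^esub>s\<in>S. c s \<odot>\<^bsub>M\<^esub> b s)"
    if "x \<in> carrier M" for x
    using b' that by (elim conjE) (rule bspec)
  have indep: "c s = \<zero>\<^bsub>R\<^esub>" if "finite S" "S \<subseteq> J" "c \<in> S \<rightarrow> carrier R"
    "(\<Oplus>\<^bsub>M\<^esub>s\<in>S. c s \<odot>\<^bsub>M\<^esub> b s) = \<zero>\<^bsub>M\<^esub>" "s \<in> S" for S c s
    using b' that by (elim conjE) simp
  have bJ: "b \<in> J \<rightarrow> carrier M" using b by (simp add: module_basis_def)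
  have inj: "inj_on b J"
  proof (rule inj_onI, rule ccontr)
    fix i j assume ij: "i \<in> J" "j \<in> J" "b i = b j" "i \<noteq> j"
    define c where "c s = (if s = i then \<one>\<^bsub>R\<^esub> else \<ominus>\<^bsub>R\<^esub> \<one>\<^bsub>R\<^esub>)" for s
    have bc: "b i \<in> carrier M" "b j \<in> carrier M" using bJ ij by auto
    have "(\<Oplus>\<^bsub>M\<^esub>s\<in>{i, j}. c s \<odot>\<^bsub>M\<^esub> b s) = c i \<odot>\<^bsub>M\<^esub> b i \<oplus>\<^bsub>M\<^esub> c j \<odot>\<^bsub>M\<^esub> b j"
      using ij bc by (simp add: c_def)
    also have "\<dots> = b i \<oplus>\<^bsub>M\<^esub> \<ominus>\<^bsub>M\<^esub> b i"
      using ij bc M.smult_l_minus[of "\<one>\<^bsub>R\<^esub>" "b i"] by (simp add: c_def)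
    also have "\<dots> = \<zero>\<^bsub>M\<^esub>" using bc by (simp add: M.r_neg)
    finally have "(\<Oplus>\<^bsub>M\<^esub>s\<in>{i, j}. c s \<odot>\<^bsub>M\<^esub> b s) = \<zero>\<^bsub>M\<^esub>" .
    moreover have "c \<in> {i, j} \<rightarrow> carrier R" by (simp add: c_def)
    ultimately have "c i = \<zero>\<^bsub>R\<^esub>" using ij(1,2) by (intro indep[of "{i, j}" c]) auto
    then show False using nz by (simp add: c_def)
  qed
  have fin: "(\<Oplus>\<^bsub>M\<^esub>x\<in>b ` S. c x \<odot>\<^bsub>M\<^esub> x) = (\<Oplus>\<^bsub>M\<^esub>s\<in>S. c (b s) \<odot>\<^bsub>M\<^esub> b s)"
    if "S \<subseteq> J" "c \<in> b ` S \<rightarrow> carrier R" for S c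
    using that bJ inj_on_subset[OF inj that(1)] by (intro M.finsum_reindex) (auto simp: Pi_iff subset_iff)
  have "module_basis R M (b ` J) (\<lambda>x. x)"
    unfolding module_basis_def
  proof (intro conjI ballI allI impI)
    show "Module.module R M" by (rule M.module_axioms)
    show "(\<lambda>x. x) \<in> b ` J \<rightarrow> carrier M" using bJ by auto
    fix x assume "x \<in> carrier M"
    then obtain S c where S: "finite S" "S \<subseteq> J" "c \<in> S \<rightarrow> carrier R" "x = (\<Oplus>\<^bsub>M\<^esub>s\<in>S. c s \<odot>\<^bsub>M\<^esub> b s)"
      using span by blast
    define c' where "c' y = c (the_inv_into J b y)" for y
    have c': "c' (b s) = c s" if "s \<in> S" for s
      using that S(2) inj by (simp add: c'_def the_inv_into_f_f subset_iff)
    have c'R: "c' \<in> b ` S \<rightarrow> carrier R" using S(3) c' by auto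
    have "x = (\<Oplus>\<^bsub>M\<^esub>s\<in>S. c' (b s) \<odot>\<^bsub>M\<^esub> b s)"
      unfolding S(4) using S(2,3) c' bJ by (intro M.finsum_cong') (auto simp: Pi_iff subset_iff)
    then have "x = (\<Oplus>\<^bsub>M\<^esub>y\<in>b ` S. c' y \<odot>\<^bsub>M\<^esub> y)" using fin[OF S(2) c'R] by simp
    moreover have "finite (b ` S)" "b ` S \<subseteq> b ` J" using S by auto
    ultimately show "\<exists>S c. finite S \<and> S \<subseteq> b ` J \<and> c \<in> S \<rightarrow> carrier R \<and> x = (\<Oplus>\<^bsub>M\<^esub>s\<in>S. c s \<odot>\<^bsub>M\<^esub> s)"
      using c'R by blast
  next
    fix S' c y
    assume S': "finite S' \<and> S' \<subseteq> b ` J \<and> c \<in> S' \<rightarrow> carrier R \<and> (\<Oplus>\<^bsub>M\<^esub>s\<in>S'. c s \<odot>\<^bsub>M\<^esub> s) = \<zero>\<^bsub>M\<^esub>" and y: "y \<in> S'"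
    then obtain S where S: "S \<subseteq> J" "S' = b ` S" unfolding subset_image_iff by blast
    have "finite S" using S' S inj by (metis finite_imageD inj_on_subset)
    moreover have "(\<Oplus>\<^bsub>M\<^esub>s\<in>S. c (b s) \<odot>\<^bsub>M\<^esub> b s) = \<zero>\<^bsub>M\<^esub>" using S' fin[OF S(1), of c] S(2) by simp
    moreover have "(\<lambda>s. c (b s)) \<in> S \<rightarrow> carrier R" using S' S(2) by auto
    ultimately have "\<forall>s\<in>S. c (b s) = \<zero>\<^bsub>R\<^esub>" using indep[OF _ S(1)] by blast
    then show "c y = \<zero>\<^bsub>R\<^esub>" using y S(2) by auto
  qed
  then show ?thesis unfolding free_module_def by blast
qed

theorem theorem2:
  fixes r :: nat and ns :: "nat \<Rightarrow> nat" and d :: "nat \<Rightarrow> nat \<Rightarrow> nat" and \<mu> :: "nat \<Rightarrow> nat"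
    and G :: "expo \<Rightarrow> nat \<Rightarrow> nat \<Rightarrow> nat \<Rightarrow> 'k::comm_ring_1 cpoly"
  assumes "r \<ge> 1"
    and "\<forall>j \<in> {1..r}. ns j \<ge> 1"
    and "\<forall>i \<in> {0..total_dim r ns}. \<forall>j \<in> {1..r}. d i j \<ge> 1"
    and "\<forall>j \<in> {1..r}. \<mu> j < Min ((\<lambda>i. d i j) ` {0..total_dim r ns})"
    and "\<forall>\<alpha> \<in> expts r ns \<mu>. \<forall>i \<in> {0..total_dim r ns}. sylv_decomposition r ns d \<alpha> i (G \<alpha> i)"
  shows "free_module (coeff_ring r ns d :: 'k coeff ring)
           (sat_quot_part r ns d (\<lambda>j. delta r ns d j - int (\<mu> j)))
       \<and> module_basis (coeff_ring r ns d :: 'k coeff ring)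
           (sat_quot_part r ns d (\<lambda>j. delta r ns d j - int (\<mu> j)))
           (expts r ns \<mu>)
           (\<lambda>\<alpha>. quot_class r ns d (sylv_form r ns \<alpha> (G \<alpha>)))"
proof -
  interpret multigraded r ns d \<mu>
    by unfold_locales (use assms(1,2,4) in auto)
  have "nudeg = (\<lambda>j. delta r ns d j - int (\<mu> j))" by (rule ext) (rule nudeg_def)
  moreover have "module_basis cR (MM :: ('k coeff, 'k cpoly set) module) (expts r ns \<mu>)
    (\<lambda>\<alpha>. qc (sylv_form r ns \<alpha> (G \<alpha>)))"
  proof (rule sylv_basis)
    fix \<alpha> assume "\<alpha> \<in> expts r ns \<mu>"
    then show "sylvester r ns d \<mu> \<alpha> (G \<alpha>)"
      using assms(5) by unfold_locales auto
  qed
  moreover from this have "free_module cR (MM :: ('k coeff, 'k cpoly set) module)"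
    by (rule module_basis_free) simp
  ultimately show ?thesis by simp
qed

end
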